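(* For integers $n,m\ge 1$ let $C(n,m)$ denote the competition complexity of $n$ bidders with additive valuations over $m$ independent, regular items, i.e. the least integer $c\ge 0$ such that $\mathrm{OPT}(F,n)\le \mathrm{Rev}(\mathrm{VCG},F,n+c)$ for every distribution $F$ that is additive over $m$ independent, regular items. Then $C(n,m)\le n+2m-2$ for all $n,m\ge 1$. Moreover $C(n,m)=\Omega(\log m)$: for every fixed $n$ there are constants $\kappa>0$ and $m_0$ such that $C(n,m)\ge \kappa\log m$ for all $m\ge m_0$.
   Context: There are $m$ items and some number of bidders. A one-dimensional distribution $F_j$ on $[0,\infty)$ (identified with its CDF) is taken to be continuous, with density $f_j$ positive on an interval; its virtual value function is $\varphi_j(x)=x-\frac{1-F_j(x)}{f_j(x)}$, and $F_j$ is regular if $\varphi_j$ is non-decreasing. A distribution $F$ over valuations is additive over $m$ independent, regular items if there are regular $F_1,\dots,F_m$ such that a draw $v\sim F$ is obtained by drawing $v_j\sim F_j$ independently and setting $v(S)=\sum_{j\in S}v_j$ for $S\subseteq[m]$. Bidders' valuations are i.i.d. from $F$, and utilities are quasi-linear (value of the received set minus payment). A (possibly randomized) mechanism maps bids to an allocation of the items (each item to at most one bidder) and payments. It is BIC (Bayesian incentive compatible) if truth-telling maximizes each bidder's expected utility given that the others report truthfully, and BIR (Bayesian individually rational) if each bidder's expected utility from truthful reporting is non-negative; expectations are over the mechanism's randomness and the other bidders' valuations. $\mathrm{OPT}(F,n)$ is the optimal (supremum) expected revenue (sum of payments) over all BIC and BIR mechanisms for $n$ bidders with valuations i.i.d.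 from $F$. $\mathrm{Rev}(M,F,k)$ is the expected revenue of mechanism $M$ with $k$ bidders with valuations i.i.d. from $F$. VCG chooses a welfare-maximizing allocation and charges each bidder her externality (maximum welfare of the others without her, minus the welfare of the others in the chosen allocation); for additive bidders this is a separate second-price auction for each item. *)

theory Defs
  imports "HOL-Probability.Probability" "HOL-Library.Extended_Nat"
begin

section \<open>Regular one-dimensional distributions\<close>

definition virtual_value :: "real measure \<Rightarrow> (real \<Rightarrow> real) \<Rightarrow> real \<Rightarrow> real" where
  "virtual_value D f x = x - (1 - cdf D x) / f x"

text \<open>The density is positive exactly on the interval \<open>I\<close> and vanishes outside it.\<close>

definition has_density_on :: "real measure \<Rightarrow> (real \<Rightarrow> real) \<Rightarrow> real set \<Rightarrow> bool" where
  "has_density_on D f I \<longleftrightarrow>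
     is_interval I \<and> I \<subseteq> {0..} \<and> f \<in> borel_measurable borel \<and>
     (\<forall>x\<in>I. 0 < f x) \<and> (\<forall>x. x \<notin> I \<longrightarrow> f x = 0) \<and>
     D = density lborel (\<lambda>x. ennreal (f x))"

text \<open>A density is determined only up to null sets; regularity asks for a version of it whose
  virtual value function is non-decreasing on the interval where it is defined.
  No moment is required to be finite.\<close>

definition regular_distribution :: "real measure \<Rightarrow> bool" where
  "regular_distribution D \<longleftrightarrow>
     real_distribution D \<and>
     (\<exists>f I. has_density_on D f I \<and> mono_on I (virtual_value D f))"

definition support :: "real measure \<Rightarrow> real set" where
  "support D = {x. \<forall>U. open U \<and> x \<in> U \<longrightarrow> 0 < emeasure D U}"


section \<open>Additive valuations over independent items\<close>

text \<open>Items are \<open>{..<m}\<close> and bidders \<open>{..<n}\<close>. An additive valuation is given by its vector of item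
  values, so the distribution of one bidder's valuation is the product of the item distributions
  \<open>D j\<close>.\<close>

type_synonym valuation = "nat \<Rightarrow> real"
type_synonym profile = "nat \<Rightarrow> valuation"
type_synonym allocation = "nat \<Rightarrow> nat set"

definition value_of :: "valuation \<Rightarrow> nat set \<Rightarrow> real" where
  "value_of v S = (\<Sum>j\<in>S. v j)"

definition valuation_dist :: "nat \<Rightarrow> (nat \<Rightarrow> real measure) \<Rightarrow> valuation measure" where
  "valuation_dist m D = Pi\<^sub>M {..<m} D"

definition types :: "nat \<Rightarrow> (nat \<Rightarrow> real measure) \<Rightarrow> valuation set" where
  "types m D = Pi\<^sub>E {..<m} (\<lambda>j. support (D j))"

definition profile_dist :: "nat \<Rightarrow> (nat \<Rightarrow> real measure) \<Rightarrow> nat set \<Rightarrow> profile measure" where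
  "profile_dist m D N = Pi\<^sub>M N (\<lambda>i. valuation_dist m D)"

definition allocations :: "nat \<Rightarrow> nat set \<Rightarrow> allocation set" where
  "allocations m N = {A \<in> N \<rightarrow>\<^sub>E Pow {..<m}. disjoint_family_on A N}"


section \<open>Mechanisms\<close>

text \<open>Randomization is made explicit: \<open>seed\<close> is the law of the mechanism's internal random
  variable, and the allocation and the payments are functions of its realization and of the bids.\<close>

record mechanism =
  seed :: "real measure"
  alloc :: "real \<Rightarrow> profile \<Rightarrow> allocation"
  pay :: "real \<Rightarrow> profile \<Rightarrow> nat \<Rightarrow> real"

text \<open>Well-defined only if the positive or the negative part of \<open>f\<close> has finite integral.\<close>

definition ext_expectation :: "'a measure \<Rightarrow> ('a \<Rightarrow> real) \<Rightarrow> ereal" where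
  "ext_expectation M f =
     enn2ereal (\<integral>\<^sup>+ x. ennreal (f x) \<partial>M) - enn2ereal (\<integral>\<^sup>+ x. ennreal (- f x) \<partial>M)"

text \<open>In \<open>is_mechanism\<close>, the last two conditions only say that the expected payments used below
  make sense: for each report \<open>w\<close> of bidder \<open>i\<close> the expectation over the other bidders and the seed
  is finite, and the ex-ante expected payment of each bidder is defined, possibly as \<open>\<infinity>\<close>.
  The latter is required for each bidder separately. For the sum of the payments alone it would not
  suffice: the failure of Fubini for non-integrable functions then lets the sum be an arbitrary
  constant while all interim expected payments are \<open>0\<close>.\<close>

definition is_mechanism :: "nat \<Rightarrow> (nat \<Rightarrow> real measure) \<Rightarrow> nat \<Rightarrow> mechanism \<Rightarrow> bool" where
  "is_mechanism m D n M \<longleftrightarrow>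
     real_distribution (seed M) \<and>
     (\<forall>r. \<forall>b \<in> space (profile_dist m D {..<n}). alloc M r b \<in> allocations m {..<n}) \<and>
     (\<forall>i<n. \<forall>j<m. {(r, b) \<in> space (seed M \<Otimes>\<^sub>M profile_dist m D {..<n}). j \<in> alloc M r b i}
                 \<in> sets (seed M \<Otimes>\<^sub>M profile_dist m D {..<n})) \<and>
     (\<forall>i<n. (\<lambda>(r, b). pay M r b i)
              \<in> borel_measurable (seed M \<Otimes>\<^sub>M profile_dist m D {..<n})) \<and>
     (\<forall>i<n. \<forall>w \<in> types m D.
        integrable (seed M \<Otimes>\<^sub>M profile_dist m D ({..<n} - {i})) (\<lambda>(r, b). pay M r (b(i := w)) i)) \<and>
     (\<forall>i<n. (\<integral>\<^sup>+ (r, b). ennreal (- pay M r b i) \<partial>(seed M \<Otimes>\<^sub>M profile_dist m D {..<n})) < \<infinity>)"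

text \<open>Expected utility of bidder \<open>i\<close> with valuation \<open>v\<close> who reports \<open>w\<close> while all others are
  truthful.\<close>

definition expected_utility ::
  "nat \<Rightarrow> (nat \<Rightarrow> real measure) \<Rightarrow> nat \<Rightarrow> mechanism \<Rightarrow> nat \<Rightarrow> valuation \<Rightarrow> valuation \<Rightarrow> real" where
  "expected_utility m D n M i v w =
     (\<integral> (r, b). (value_of v (alloc M r (b(i := w)) i) - pay M r (b(i := w)) i)
        \<partial>(seed M \<Otimes>\<^sub>M profile_dist m D ({..<n} - {i})))"

definition BIC :: "nat \<Rightarrow> (nat \<Rightarrow> real measure) \<Rightarrow> nat \<Rightarrow> mechanism \<Rightarrow> bool" where
  "BIC m D n M \<longleftrightarrow>
     (\<forall>i<n. \<forall>v \<in> types m D. \<forall>w \<in> types m D.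
        expected_utility m D n M i v w \<le> expected_utility m D n M i v v)"

definition BIR :: "nat \<Rightarrow> (nat \<Rightarrow> real measure) \<Rightarrow> nat \<Rightarrow> mechanism \<Rightarrow> bool" where
  "BIR m D n M \<longleftrightarrow> (\<forall>i<n. \<forall>v \<in> types m D. 0 \<le> expected_utility m D n M i v v)"

definition Rev :: "nat \<Rightarrow> (nat \<Rightarrow> real measure) \<Rightarrow> nat \<Rightarrow> mechanism \<Rightarrow> ereal" where
  "Rev m D n M =
     ext_expectation (seed M \<Otimes>\<^sub>M profile_dist m D {..<n}) (\<lambda>(r, b). \<Sum>i<n. pay M r b i)"

definition OPT :: "nat \<Rightarrow> (nat \<Rightarrow> real measure) \<Rightarrow> nat \<Rightarrow> ereal" where
  "OPT m D n = (SUP M \<in> {M. is_mechanism m D n M \<and> BIC m D n M \<and> BIR m D n M}. Rev m D n M)"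


section \<open>The VCG mechanism\<close>

definition welfare :: "nat set \<Rightarrow> profile \<Rightarrow> allocation \<Rightarrow> real" where
  "welfare N b A = (\<Sum>i\<in>N. value_of (b i) (A i))"

definition max_welfare :: "nat \<Rightarrow> nat set \<Rightarrow> profile \<Rightarrow> real" where
  "max_welfare m N b = Max (welfare N b ` allocations m N)"

text \<open>Ties are broken by choice; under continuous value distributions they have probability \<open>0\<close>.\<close>

definition vcg_alloc :: "nat \<Rightarrow> nat \<Rightarrow> profile \<Rightarrow> allocation" where
  "vcg_alloc m k b = arg_max_on (welfare {..<k} b) (allocations m {..<k})"

definition vcg_pay :: "nat \<Rightarrow> nat \<Rightarrow> profile \<Rightarrow> nat \<Rightarrow> real" where
  "vcg_pay m k b i =
     max_welfare m ({..<k} - {i}) b - welfare ({..<k} - {i}) b (vcg_alloc m k b)"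

definition VCG :: "nat \<Rightarrow> nat \<Rightarrow> mechanism" where
  "VCG m k = \<lparr> seed = return borel 0, alloc = (\<lambda>_. vcg_alloc m k), pay = (\<lambda>_. vcg_pay m k) \<rparr>"


section \<open>Competition complexity\<close>

text \<open>The infimum in \<open>enat\<close> is the least such \<open>c\<close>, and \<open>\<infinity>\<close> if there is none.\<close>

definition competition_complexity :: "nat \<Rightarrow> nat \<Rightarrow> enat" where
  "competition_complexity n m =
     Inf {enat c | c. \<forall>D. (\<forall>j<m. regular_distribution (D j)) \<longrightarrow>
                        OPT m D n \<le> Rev m D (n + c) (VCG m (n + c))}"

end

theory Submission
  imports Defs
begin

text \<open>Upper bound. Call a bidder lucky for item \<open>j\<close> if her value for \<open>j\<close> has a larger quantile than her
  values for all other items. On the types that are lucky for \<open>j\<close>, incentive compatibility leaves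
  her the area under her allocation probability as a function of \<open>v\<^sub>j\<close>, and integration by parts
  turns her value for \<open>j\<close> into her virtual value. So the revenue is at most the expected sum over
  the items of the highest score, where a bidder's score for \<open>j\<close> is her virtual value for \<open>j\<close> if she
  is lucky for \<open>j\<close> and her value otherwise, plus a term for prices that tend to infinity. For a single item,
  the probability that the highest score exceeds \<open>t\<close> is a polynomial in the tails at \<open>t\<close> of the
  value and of the virtual value. A polynomial inequality and a Bulow--Klemperer bound at every opportunity
  cost \<open>t\<close>, averaged over \<open>t\<close>, compare it with a second-price auction with \<open>2n + 2m - 2\<close> bidders.

  Lower bound. For equal-revenue items VCG earns exactly one per item and bidder, whereas the sum of
  \<open>m\<close> values exceeds \<open>m ln m / 4\<close> with probability at least \<open>1/2\<close>, so that the grand bundle can be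
  sold at this price.\<close>

section \<open>A polynomial inequality\<close>

text \<open>Luck is compared by quantiles so that the items separate: quantiles are uniform, hence
  the chance that all other items fall below the quantile of a level t of item j depends on
  \<open>D j\<close> alone. For one item no comparison level by level is possible: if the virtual
  value exceeds t as often as the value does, the probability for the benchmark is of first order in
  the tail q, that for the second price only of second order. The polynomial inequality therefore
  carries a correction, in which each of the n bidders faces the second highest of M - 1 rivals as
  her opportunity cost. At single levels it may favour the benchmark; integrated over all levels it
  has the right sign, and this is the averaged Bulow--Klemperer bound. Values may have infinite
  mean. Hence integrals are kept in \<open>ennreal\<close> or truncated at a level T, inequalities
  are arranged without subtraction, a common term is cancelled only once it is known to be finite,
  and the boundary term T * tail T survives in the limit as \<open>top_revenue\<close>.\<close>

lemma quadratic_Bernoulli: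
  fixes x :: real
  assumes "0 \<le> x"
  shows "1 + real n * x + real n * (real n - 1) / 2 * x\<^sup>2 \<le> (1 + x) ^ n"
proof (induction n)
  case 0
  then show ?case by simp
next
  case (Suc n)
  let ?c = "real n * (real n - 1) / 2"
  have c: "0 \<le> ?c" by (cases n) auto
  have "1 + real (Suc n) * x + real (Suc n) * (real (Suc n) - 1) / 2 * x\<^sup>2
      \<le> (1 + x) * (1 + real n * x + ?c * x\<^sup>2)"
    using mult_nonneg_nonneg[OF c, of "x^3"] assms
    by (simp add: field_simps power2_eq_square power3_eq_cube)
  also have "\<dots> \<le> (1 + x) * (1 + x) ^ n"
    using Suc assms by (intro mult_left_mono) auto
  finally show ?case by simp
qed

text \<open>\<open>y\<close> stands for (1 + z)^l. Its square yields the linear term 2 l z, and it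
  turns the linear term of the power into n w y. Since w \<le> z, the latter is at least n (w + l
  w^2), which raises the coefficient of w^2 from n (n - 1) / 2 to n (n + 2 l - 1) / 2.\<close>

lemma polynomial_bound_1:
  fixes w y z l :: real
  assumes "0 \<le> w" "w \<le> z" "0 \<le> l" "1 + l * z \<le> y" "1 \<le> n"
  shows "1 + 2 * l * z + real n * w + real n * (real n + 2 * l - 1) / 2 * w\<^sup>2
    \<le> y\<^sup>2 * (1 + w / y) ^ n"
proof -
  have y: "1 \<le> y" using assms by (smt (verit) mult_nonneg_nonneg)
  have "(1 + l * z) * (1 + l * z) \<le> y * y"
    using assms y by (intro mult_mono) auto
  then have y2: "1 + 2 * l * z \<le> y\<^sup>2"
    using zero_le_square[of "l*z"] by (simp add: power2_eq_square algebra_simps)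
  have "l * (w * w) \<le> l * (w * z)"
    using assms by (intro mult_left_mono) auto
  moreover have "w * (1 + l * z) \<le> w * y"
    using assms by (intro mult_left_mono) auto
  ultimately have "w + l * (w * w) \<le> w * y"
    by (simp add: algebra_simps)
  then have lin: "real n * (w + l * (w * w)) \<le> real n * (w * y)"
    by (intro mult_left_mono) auto
  have "y\<^sup>2 * (1 + real n * (w / y) + real n * (real n - 1) / 2 * (w / y)\<^sup>2) \<le> y\<^sup>2 * (1 + w / y) ^ n"
    using quadratic_Bernoulli[of "w / y" n] assms y by (intro mult_left_mono) auto
  moreover have "y\<^sup>2 * (1 + real n * (w / y) + real n * (real n - 1) / 2 * (w / y)\<^sup>2)
      = y\<^sup>2 + real n * (w * y) + real n * (real n - 1) / 2 * w\<^sup>2"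
    using y by (simp add: field_simps power2_eq_square)
  moreover have "1 + 2 * l * z + real n * w + real n * (real n + 2 * l - 1) / 2 * w\<^sup>2
      = 1 + 2 * l * z + real n * (w + l * (w * w)) + real n * (real n - 1) / 2 * w\<^sup>2"
    by (simp add: field_simps power2_eq_square)
  ultimately show ?thesis
    using y2 lin by linarith
qed

text \<open>The linear terms agree. The mixed term in z w is absorbed by the squares of z and w
  through (z - w)^2 \<ge> 0; this is why both factors must be expanded to second order and the
  linear Bernoulli inequality would not do.\<close>

lemma polynomial_bound_2:
  fixes w z l n :: real
  assumes "0 \<le> w" "w \<le> z" "0 \<le> l" "1 \<le> n"
  shows "1 + (n + 2 * l) * z + n * w + n * (2 * n + 2 * l - 1) * (z * w)
    \<le> (1 + n * z + n * (n - 1) / 2 * z\<^sup>2)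
       * (1 + 2 * l * z + n * w + n * (n + 2 * l - 1) / 2 * w\<^sup>2)"
proof -
  define C where "C = n * (n - 1) / 2 * z\<^sup>2"
  define E where "E = n * (n + 2 * l - 1) / 2 * w\<^sup>2"
  have z: "0 \<le> z" using assms by simp
  have C: "0 \<le> C" and E: "0 \<le> E" using assms by (auto simp: C_def E_def)
  have "0 \<le> C * (2 * l * z + n * w + E)"
    using assms z C E by (intro mult_nonneg_nonneg add_nonneg_nonneg) auto
  moreover have "0 \<le> n * z * E" using assms z E by simp
  moreover have "0 \<le> n * (n + 2 * l - 1) / 2 * (z - w)\<^sup>2 + n * l * z\<^sup>2"
    using assms z by simp
  then have "n * (2 * n + 2 * l - 1) * (z * w)
      \<le> E + n * n * (z * w) + n * 2 * l * z\<^sup>2 + C"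
    unfolding C_def E_def by (simp add: field_simps power2_eq_square)
  ultimately show ?thesis
    unfolding C_def[symmetric] E_def[symmetric] by (simp add: algebra_simps power2_eq_square)
qed

text \<open>In the application \<open>a = 1 - q\<close> and \<open>q\<close>, \<open>s\<close> are the probabilities that a value, respectively
  a virtual value, exceeds a level. The left side then bounds the probability that the benchmark
  exceeds this level, and \<open>1 - a ^ M - M * q * a ^ (M - 1)\<close> is the same probability for the second
  highest of \<open>M\<close> values. With \<open>z = q / a\<close> and \<open>w = (q - s) / a\<close> the claim becomes a comparison of
  quadratic polynomials.\<close>

lemma benchmark_polynomial:
  fixes q s :: real and n m M :: nat
  assumes q: "0 \<le> s" "s \<le> q" "q \<le> 1" and nm: "1 \<le> n" "1 \<le> m" and M: "M = 2 * n + 2 * m - 2"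
  defines "a \<equiv> 1 - q"
  shows "1 - (a + a ^ (m - 1) * (q - s)) ^ n + n * ((real M - 1) * q\<^sup>2 * a ^ (M - 2))
    \<le> (1 - a ^ M - M * q * a ^ (M - 1)) + n * (s * (a ^ (M - 1) + (real M - 1) * q * a ^ (M - 2)))"
proof -
  define d where "d = q - s"
  let ?T = "a ^ M + (real M - n) * q * a ^ (M - 1) + n * d * a ^ (M - 1)
    + n * (real M - 1) * (q * d) * a ^ (M - 2)"
  have M2: "2 \<le> M" using nm M by simp
  \<comment> \<open>With s = q - d the correction terms in q^2 cancel, and the claim becomes this
    lower bound on the n-th power that stands for the probability of the benchmark staying at or
    below the level.\<close>
  have "?T \<le> (a + a ^ (m - 1) * d) ^ n"
  proof (cases "a = 0")
    case True
    \<comment> \<open>Here z and w make no sense. M = 2 is separate because a ^ (M - 2) is then 1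
      rather than 0.\<close>
    show ?thesis
    proof (cases "M = 2")
      case True
      then have "n = 1" "m = 1" using M nm by auto
      then show ?thesis using \<open>a = 0\<close> True a_def by simp
    next
      case False
      then show ?thesis using \<open>a = 0\<close> M2 q d_def by (simp add: power_0_left)
    qed
  next
    case False
    then have a: "0 < a" using q a_def by simp
    define z where "z = q / a"
    define w where "w = d / a"
    define l where "l = m - 1"
    have lM: "M = 2 * n + 2 * l" using M nm l_def by simp
    have az: "a * (1 + z) = 1" using a by (simp add: z_def a_def field_simps)
    have q': "q = a * z" and d': "d = a * w" using a by (auto simp: z_def w_def)
    have w: "0 \<le> w" "w \<le> z" using a q by (auto simp: w_def z_def d_def divide_right_mono)
    have z: "0 \<le> z" using w by simp
    define y where "y = (1 + z) ^ l"
    have y: "1 + real l * z \<le> y" using Bernoulli_inequality[of z l] z by (simp add: y_def)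
    have y0: "0 < y" using z by (simp add: y_def)
    have aly: "a ^ l * y = 1" using az by (simp add: y_def flip: power_mult_distrib)
    let ?B = "1 + 2 * real l * z + real n * w + real n * (real n + 2 * real l - 1) / 2 * w\<^sup>2"
    have n1: "1 \<le> real n" using nm by simp
    have B0: "0 \<le> ?B" using n1 w z by (intro add_nonneg_nonneg mult_nonneg_nonneg) auto
    have "1 + (real n + 2 * real l) * z + n * w + n * (2 * real n + 2 * real l - 1) * (z * w)
        \<le> (1 + n * z + n * (real n - 1) / 2 * z\<^sup>2) * ?B"
      using polynomial_bound_2[of w z "real l" "real n"] w n1 by auto
    also have "\<dots> \<le> (1 + z) ^ n * ?B"
      using quadratic_Bernoulli[of z n] z B0 by (intro mult_right_mono) auto
    also have "\<dots> \<le> (1 + z) ^ n * (y\<^sup>2 * (1 + w / y) ^ n)"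
      using polynomial_bound_1[of w z "real l" y n] w nm y z by (intro mult_left_mono) auto
    finally have main: "1 + (real n + 2 * real l) * z + n * w
        + n * (2 * real n + 2 * real l - 1) * (z * w) \<le> (1 + z) ^ n * (y\<^sup>2 * (1 + w / y) ^ n)" .
    obtain k where k: "M = Suc (Suc k)" using M2 by (metis add_2_eq_Suc le_Suc_ex)
    have "?T = a ^ M * (1 + (real n + 2 * real l) * z + n * w
        + n * (2 * real n + 2 * real l - 1) * (z * w))"
    proof -
      have r: "real M = 2 * real n + 2 * real l" using lM by simp
      have "?T = a ^ M * (1 + (real M - n) * z + n * w + n * (real M - 1) * (z * w))"
        unfolding q' d' k by (simp add: algebra_simps)
      then show ?thesis unfolding r by simp
    qed
    also have "\<dots> \<le> a ^ M * ((1 + z) ^ n * (y\<^sup>2 * (1 + w / y) ^ n))"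
      using main a by (intro mult_left_mono) auto
    \<comment> \<open>The origin of M: of its 2 n + 2 l factors a, n are used up by (1 + z)^n and 2
      l by y^2, both products being 1, and the remaining n form the power on the right.\<close>
    also have "\<dots> = a ^ n * ((a * (1 + z)) ^ n * (a ^ l * y)\<^sup>2 * (1 + w / y) ^ n)"
      unfolding lM by (simp add: power_add power_mult_distrib power_mult mult_2 power2_eq_square ac_simps)
    also have "\<dots> = (a * (1 + w / y)) ^ n"
      unfolding az aly by (simp add: power_mult_distrib)
    also have "a * (1 + w / y) = a + a ^ (m - 1) * d"
    proof -
      have "w / y = w * a ^ l" using aly y0 by (simp add: field_simps)
      then show ?thesis unfolding d' l_def by (simp add: algebra_simps)
    qed
    finally show ?thesis .
  qed
  moreover obtain k where "M = Suc (Suc k)" using M2 by (metis add_2_eq_Suc le_Suc_ex)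
  ultimately show ?thesis
    by (simp add: d_def algebra_simps power2_eq_square)
qed

text \<open>The right side is the probability that at least two of k independent values exceed a
  level with tail q, the left side that two given ones do.\<close>

lemma at_least_two_ge:
  fixes q :: real
  assumes "0 \<le> q" "q \<le> 1" "2 \<le> k"
  shows "q\<^sup>2 \<le> 1 - (1 - q) ^ k - real k * q * (1 - q) ^ (k - 1)"
  using assms(3)
proof (induction k rule: dec_induct)
  case base
  then show ?case by (simp add: power2_eq_square algebra_simps)
next
  case (step k)
  define P where "P = (1 - q) ^ (k - 1)"
  have k: "(1 - q) ^ k = P * (1 - q)" and Sk: "(1 - q) ^ Suc k = P * (1 - q) * (1 - q)"
    using step(1) by (cases k; simp add: P_def)+
  have "0 \<le> real k * q * P * q" using assms by (simp add: P_def)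
  then show ?case
    using step.IH unfolding P_def[symmetric] k Sk diff_Suc_1 by (simp add: algebra_simps)
qed

section \<open>Tails of regular distributions\<close>

definition tail :: "real measure \<Rightarrow> real \<Rightarrow> real" where
  "tail D x = 1 - cdf D x"

section \<open>Tails and partial expectations of arbitrary real distributions\<close>

context real_distribution
begin

lemma tail_nonneg: "0 \<le> tail M x" and tail_le_1: "tail M x \<le> 1"
  using cdf_bounded_prob[of x] cdf_nonneg[of x] by (auto simp: tail_def)

lemma tail_antimono: "x \<le> y \<Longrightarrow> tail M y \<le> tail M x"
  using cdf_nondecreasing by (auto simp: tail_def)

lemma tail_eq: "tail M x = measure M {x<..}"
  using prob_compl[of "{..x}"] by (auto simp: tail_def cdf_def Compl_eq_Diff_UNIV[symmetric])

lemma emeasure_tail: "emeasure M {x<..} = ennreal (tail M x)"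
  by (simp add: tail_eq emeasure_eq_measure)

lemma emeasure_Ioc_tail: "x \<le> y \<Longrightarrow> emeasure M {x<..y} = ennreal (tail M x - tail M y)"
  by (simp add: emeasure_Ioc tail_def)

lemma borel_measurable_cdf [measurable]: "cdf M \<in> borel_measurable borel"
  by (rule borel_measurable_mono) (simp add: mono_def cdf_nondecreasing)

lemma borel_measurable_tail [measurable]: "tail M \<in> borel_measurable borel"
  unfolding tail_def by measurable

lemma tail_tendsto_0: "(\<lambda>k. tail M (real k)) \<longlonglongrightarrow> 0"
  unfolding tail_def using tendsto_diff[OF tendsto_const cdf_lim_infty_prob, of 1] by simp

text \<open>Both sides measure the region x < s < z \<le> y under the product of Lebesgue measure in
  s and \<open>M\<close> in z.\<close>

lemma nn_integral_excess:
  assumes "x \<le> y"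
  shows "(\<integral>\<^sup>+ s. emeasure M {s<..y} * indicator {x<..y} s \<partial>lborel)
    = (\<integral>\<^sup>+ z. ennreal (z - x) * indicator {x<..y} z \<partial>M)"
proof -
  have "(\<integral>\<^sup>+ s. emeasure M {s<..y} * indicator {x<..y} s \<partial>lborel)
      = (\<integral>\<^sup>+ s. (\<integral>\<^sup>+ z. indicator {p. x < snd p \<and> snd p < fst p \<and> fst p \<le> y} (z, s) \<partial>M) \<partial>lborel)"
  proof (intro nn_integral_cong)
    fix s :: real
    have "emeasure M {s<..y} * indicator {x<..y} s = (\<integral>\<^sup>+ z. indicator {s<..y} z * indicator {x<..y} s \<partial>M)"
      by (subst nn_integral_multc) auto
    also have "\<dots> = (\<integral>\<^sup>+ z. indicator {p. x < snd p \<and> snd p < fst p \<and> fst p \<le> y} (z, s) \<partial>M)"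
      by (intro nn_integral_cong) (auto split: split_indicator)
    finally show "emeasure M {s<..y} * indicator {x<..y} s
        = (\<integral>\<^sup>+ z. indicator {p. x < snd p \<and> snd p < fst p \<and> fst p \<le> y} (z, s) \<partial>M)" .
  qed
  also have "\<dots> = (\<integral>\<^sup>+ z. (\<integral>\<^sup>+ s. indicator {p. x < snd p \<and> snd p < fst p \<and> fst p \<le> y} (z, s) \<partial>lborel) \<partial>M)"
  proof -
    interpret pair_sigma_finite M lborel ..
    have [measurable]: "{p. x < snd p \<and> snd p < fst p \<and> fst p \<le> y} \<in> sets (M \<Otimes>\<^sub>M lborel)"
    proof -
      have "{p \<in> space (borel \<Otimes>\<^sub>M borel). x < snd p \<and> snd p < fst p \<and> fst p \<le> y} \<in> sets (borel \<Otimes>\<^sub>M borel)"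
        by measurable
      then show ?thesis
        by (subst sets_pair_measure_cong[OF events_eq_borel sets_lborel]) (simp add: space_pair_measure)
    qed
    show ?thesis by (rule Fubini') measurable
  qed
  also have "\<dots> = (\<integral>\<^sup>+ z. ennreal (z - x) * indicator {x<..y} z \<partial>M)"
  proof (intro nn_integral_cong)
    fix z :: real
    have "(\<integral>\<^sup>+ s. indicator {p. x < snd p \<and> snd p < fst p \<and> fst p \<le> y} (z, s) \<partial>lborel)
        = (\<integral>\<^sup>+ s. indicator {x<..<z} s * indicator {x<..y} z \<partial>lborel)"
      by (intro nn_integral_cong) (auto split: split_indicator)
    also have "\<dots> = ennreal (z - x) * indicator {x<..y} z"
      by (subst nn_integral_multc) (auto split: split_indicator)
    finally show "(\<integral>\<^sup>+ s. indicator {p. x < snd p \<and> snd p < fst p \<and> fst p \<le> y} (z, s) \<partial>lborel)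
        = ennreal (z - x) * indicator {x<..y} z" .
  qed
  finally show ?thesis .
qed

text \<open>Integration by parts, with the boundary terms distributed over the two sides so that
  nothing is subtracted in \<open>ennreal\<close>.\<close>

lemma nn_integral_partial_expectation:
  assumes "0 \<le> x" "x \<le> y"
  shows "(\<integral>\<^sup>+ z. ennreal z * indicator {x<..y} z \<partial>M) + ennreal (y * tail M y)
    = ennreal (x * tail M x) + (\<integral>\<^sup>+ s. ennreal (tail M s) * indicator {x<..y} s \<partial>lborel)"
proof -
  define K where "K = (\<integral>\<^sup>+ z. ennreal (z - x) * indicator {x<..y} z \<partial>M)"
  have "(\<integral>\<^sup>+ s. ennreal (tail M s) * indicator {x<..y} s \<partial>lborel)
      = (\<integral>\<^sup>+ s. emeasure M {s<..y} * indicator {x<..y} s + ennreal (tail M y) * indicator {x<..y} s \<partial>lborel)"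
  proof (intro nn_integral_cong)
    fix s :: real
    have "ennreal (tail M s) = emeasure M {s<..y} + ennreal (tail M y)" if "s \<le> y"
      using that tail_antimono[OF that] tail_nonneg[of y]
      by (simp add: emeasure_Ioc_tail flip: ennreal_plus)
    then show "ennreal (tail M s) * indicator {x<..y} s
        = emeasure M {s<..y} * indicator {x<..y} s + ennreal (tail M y) * indicator {x<..y} s"
      by (auto split: split_indicator)
  qed
  also have "\<dots> = (\<integral>\<^sup>+ s. emeasure M {s<..y} * indicator {x<..y} s \<partial>lborel)
      + (\<integral>\<^sup>+ s. ennreal (tail M y) * indicator {x<..y} s \<partial>lborel)"
  proof (rule nn_integral_add)
    have "(\<lambda>s. emeasure M {s<..y} * indicator {x<..y} s) = (\<lambda>s. ennreal (tail M s - tail M y) * indicator {x<..y} s)"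
      by (auto simp: fun_eq_iff emeasure_Ioc_tail split: split_indicator)
    then show "(\<lambda>s. emeasure M {s<..y} * indicator {x<..y} s) \<in> borel_measurable lborel" by simp
  qed simp
  also have "\<dots> = K + ennreal ((y - x) * tail M y)"
    using assms tail_nonneg[of y]
    by (simp add: nn_integral_excess[OF assms(2)] K_def nn_integral_cmult flip: ennreal_mult' mult.commute[of "tail M y"])
  finally have A: "(\<integral>\<^sup>+ s. ennreal (tail M s) * indicator {x<..y} s \<partial>lborel)
      = K + ennreal ((y - x) * tail M y)" .
  have "(\<integral>\<^sup>+ z. ennreal z * indicator {x<..y} z \<partial>M)
      = (\<integral>\<^sup>+ z. ennreal (z - x) * indicator {x<..y} z + ennreal x * indicator {x<..y} z \<partial>M)"
    using assms by (intro nn_integral_cong) (auto simp flip: ennreal_plus split: split_indicator)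
  also have "\<dots> = K + ennreal (x * (tail M x - tail M y))"
    using assms tail_antimono[OF assms(2)]
    by (subst nn_integral_add) (auto simp: K_def nn_integral_cmult emeasure_Ioc_tail ennreal_mult')
  finally have B: "(\<integral>\<^sup>+ z. ennreal z * indicator {x<..y} z \<partial>M) = K + ennreal (x * (tail M x - tail M y))" .
  have "ennreal (x * (tail M x - tail M y)) + ennreal (y * tail M y)
      = ennreal (x * tail M x) + ennreal ((y - x) * tail M y)"
    using assms tail_antimono[OF assms(2)] tail_nonneg[of x] tail_nonneg[of y]
    by (subst (1 2) ennreal_plus[symmetric]) (auto simp: algebra_simps intro: mult_left_mono mult_right_mono)
  then show ?thesis unfolding A B by (metis add.assoc add.left_commute)
qed

lemma partial_expectation:
  assumes "0 \<le> x" "x \<le> y"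
  shows "(LINT z|M. z * indicator {x<..y} z)
    = x * tail M x - y * tail M y + (LINT s|lborel. tail M s * indicator {x<..y} s)"
proof -
  have i1: "integrable M (\<lambda>z. z * indicator {x<..y} z)"
    by (rule integrable_const_bound[where B=y]) (use assms in \<open>auto split: split_indicator\<close>)
  have i2: "integrable lborel (\<lambda>s. tail M s * indicator {x<..y} s)"
  proof (rule Bochner_Integration.integrable_bound)
    show "integrable lborel (indicator {x<..y} :: real \<Rightarrow> real)"
      using assms by (intro integrable_real_indicator) auto
  qed (auto simp: tail_nonneg tail_le_1 split: split_indicator)
  have e1: "(\<integral>\<^sup>+ z. ennreal z * indicator {x<..y} z \<partial>M) = ennreal (LINT z|M. z * indicator {x<..y} z)"
    using assms by (subst nn_integral_eq_integral[OF i1, symmetric])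
       (auto intro!: nn_integral_cong AE_I2 split: split_indicator)
  have e2: "(\<integral>\<^sup>+ s. ennreal (tail M s) * indicator {x<..y} s \<partial>lborel)
      = ennreal (LINT s|lborel. tail M s * indicator {x<..y} s)"
    by (subst nn_integral_eq_integral[OF i2, symmetric])
       (auto intro!: nn_integral_cong AE_I2 simp: tail_nonneg split: split_indicator)
  have p1: "0 \<le> (LINT z|M. z * indicator {x<..y} z)"
    using assms by (intro integral_nonneg_AE AE_I2) (auto split: split_indicator)
  have p2: "0 \<le> (LINT s|lborel. tail M s * indicator {x<..y} s)"
    by (intro integral_nonneg_AE AE_I2) (auto simp: tail_nonneg split: split_indicator)
  have "ennreal ((LINT z|M. z * indicator {x<..y} z) + y * tail M y)
      = ennreal (x * tail M x + (LINT s|lborel. tail M s * indicator {x<..y} s))"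
    using nn_integral_partial_expectation[OF assms] assms p1 p2 tail_nonneg[of x] tail_nonneg[of y] unfolding e1 e2
    by (simp del: ennreal_plus add: ennreal_plus[symmetric])
  then show ?thesis
    using assms p1 p2 tail_nonneg[of x] tail_nonneg[of y] by (subst (asm) ennreal_inj) auto
qed

end

section \<open>Virtual values as slopes of the revenue curve\<close>

locale regular_item =
  fixes D :: "real measure" and f :: "real \<Rightarrow> real" and I :: "real set"
  assumes dist: "real_distribution D"
    and dens: "has_density_on D f I"
    and mono_virtual: "mono_on I (virtual_value D f)"
begin

sublocale real_distribution D by (rule dist)

abbreviation "\<phi> \<equiv> virtual_value D f"

lemma f_measurable [measurable]: "f \<in> borel_measurable borel"
  and f_pos: "x \<in> I \<Longrightarrow> 0 < f x" and f_zero: "x \<notin> I \<Longrightarrow> f x = 0"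
  and D_eq: "D = density lborel (\<lambda>x. ennreal (f x))"
  and I_nonneg: "x \<in> I \<Longrightarrow> 0 \<le> x" and I_interval: "is_interval I"
  using dens by (auto simp: has_density_on_def)

lemma f_nonneg: "0 \<le> f x"
  using f_pos[of x] f_zero[of x] by (cases "x \<in> I") auto

lemma I_between: "a \<in> I \<Longrightarrow> b \<in> I \<Longrightarrow> a \<le> x \<Longrightarrow> x \<le> b \<Longrightarrow> x \<in> I"
  using I_interval unfolding is_interval_1 by blast

lemma I_measurable [measurable]: "I \<in> sets borel"
  using real_interval_borel_measurable[OF I_interval] .

lemma virtual_measurable [measurable]: "\<phi> \<in> borel_measurable borel"
  unfolding virtual_value_def by measurable

lemma virtual_eq: "\<phi> x = x - tail D x / f x"
  by (simp add: virtual_value_def tail_def)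

lemma virtual_le: "\<phi> x \<le> x"
  by (simp add: virtual_eq tail_nonneg f_nonneg)

lemma emeasure_point: "emeasure D {x} = 0"
  unfolding D_eq by (subst emeasure_density) (auto simp: nn_integral_cong_AE[of _ "\<lambda>_. 0"])

lemma isCont_cdf_D: "isCont (cdf D) x"
  by (simp add: isCont_cdf emeasure_point measure_def)

lemma emeasure_Ici: "emeasure D {x..} = ennreal (tail D x)"
proof -
  have "emeasure D {x..} = emeasure D {x} + emeasure D {x<..}"
    by (subst plus_emeasure) (auto intro!: arg_cong[where f="emeasure D"])
  then show ?thesis by (simp add: emeasure_point emeasure_tail)
qed

lemma AE_in_I: "AE x in D. x \<in> I"
proof -
  have "AE x in lborel. 0 < ennreal (f x) \<longrightarrow> x \<in> I"
    using f_zero by (intro AE_I2) force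
  then show ?thesis unfolding D_eq by (subst AE_density) auto
qed

lemma nn_integral_D:
  assumes [measurable]: "g \<in> borel_measurable borel"
  shows "(\<integral>\<^sup>+ x. g x \<partial>D) = (\<integral>\<^sup>+ x. ennreal (f x) * g x \<partial>lborel)"
  by (subst (1) D_eq) (simp add: nn_integral_density)

text \<open>Against \<open>D\<close> the density in the denominator cancels, so the gap between
  value and virtual value integrates to the area under the tail. Only \<open>I\<close> counts,
  because \<open>D\<close> has no mass elsewhere.\<close>

lemma nn_integral_hazard:
  assumes [measurable]: "g \<in> borel_measurable borel"
  shows "(\<integral>\<^sup>+ z. ennreal (tail D z / f z) * g z \<partial>D) = (\<integral>\<^sup>+ s. ennreal (tail D s) * g s * indicator I s \<partial>lborel)"
proof (subst nn_integral_D, measurable, intro nn_integral_cong)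
  fix s
  show "ennreal (f s) * (ennreal (tail D s / f s) * g s) = ennreal (tail D s) * g s * indicator I s"
  proof (cases "s \<in> I")
    case True
    then have "ennreal (f s) * ennreal (tail D s / f s) = ennreal (tail D s)"
      using f_pos[OF True] by (subst ennreal_mult[symmetric]) (auto simp: tail_nonneg)
    then show ?thesis using True by (simp add: mult.assoc[symmetric])
  qed (simp add: f_zero)
qed

lemma tail_above_I: "s \<notin> I \<Longrightarrow> c \<in> I \<Longrightarrow> c \<le> s \<Longrightarrow> tail D s = 0"
proof -
  assume s: "s \<notin> I" "c \<in> I" "c \<le> s"
  have "AE x in D. x \<notin> {s<..}" using AE_in_I by eventually_elim (metis s I_between greaterThan_iff less_imp_le)
  then have "emeasure D {s<..} = 0" by (subst (asm) AE_iff_measurable[of "{s<..}"]) auto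
  then show ?thesis using tail_nonneg[of s] by (simp add: emeasure_tail)
qed

lemma tail_below_I: "(\<And>c. c \<in> I \<Longrightarrow> s \<le> c) \<Longrightarrow> tail D s = 1"
proof -
  assume s: "\<And>c. c \<in> I \<Longrightarrow> s \<le> c"
  then have "AE x in D. x \<in> {s..}" using AE_in_I by auto
  then have "prob {s..} = 1" by (subst (asm) AE_in_set_eq_1) auto
  then show ?thesis using emeasure_Ici[of s] tail_nonneg[of s] by (simp add: emeasure_eq_measure)
qed

text \<open>The value contributes the area under the tail over the whole range, the hazard term
  removes it only over \<open>I\<close>. The remaining area comes from the points below
  \<open>I\<close>, where the tail is 1.\<close>

lemma integrable_virtual:
  assumes "0 \<le> x" "x \<le> y"
  shows "integrable D (\<lambda>z. \<phi> z * indicator {x<..y} z)" (is ?int)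
    and "(LINT z|D. \<phi> z * indicator {x<..y} z)
      = x * tail D x - y * tail D y + (LINT s|lborel. tail D s * indicator ({x<..y} - I) s)" (is ?eq)
proof -
  have i1: "integrable D (\<lambda>z. z * indicator {x<..y} z)"
    by (rule integrable_const_bound[where B=y]) (use assms in \<open>auto split: split_indicator\<close>)
  have i2: "integrable lborel (\<lambda>s. tail D s * indicator A s)" if "A \<in> sets borel" "A \<subseteq> {x<..y}" for A
  proof (rule Bochner_Integration.integrable_bound)
    show "integrable lborel (indicator {x<..y} :: real \<Rightarrow> real)"
      using assms by (intro integrable_real_indicator) auto
  qed (use that in \<open>auto intro!: AE_I2 simp: tail_nonneg tail_le_1 subset_eq split: split_indicator\<close>)
  let ?h = "\<lambda>z. tail D z / f z * indicator {x<..y} z"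
  have "(\<integral>\<^sup>+ z. ennreal (?h z) \<partial>D) = (\<integral>\<^sup>+ z. ennreal (tail D z / f z) * indicator {x<..y} z \<partial>D)"
    by (intro nn_integral_cong) (auto split: split_indicator)
  also have "\<dots> = (\<integral>\<^sup>+ s. ennreal (tail D s * indicator ({x<..y} \<inter> I) s) \<partial>lborel)"
    by (subst nn_integral_hazard) (auto intro!: nn_integral_cong split: split_indicator)
  also have "\<dots> = ennreal (LINT s|lborel. tail D s * indicator ({x<..y} \<inter> I) s)"
    by (intro nn_integral_eq_integral i2 AE_I2) (auto simp: tail_nonneg split: split_indicator)
  finally have nn: "(\<integral>\<^sup>+ z. ennreal (?h z) \<partial>D) = ennreal (LINT s|lborel. tail D s * indicator ({x<..y} \<inter> I) s)" .
  have h0: "0 \<le> ?h z" for z by (auto simp: tail_nonneg f_nonneg split: split_indicator)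
  have ih: "integrable D ?h"
    by (rule integrableI_nonneg) (use nn h0 in auto)
  have eh: "(LINT z|D. ?h z) = (LINT s|lborel. tail D s * indicator ({x<..y} \<inter> I) s)"
    using nn h0 by (subst integral_eq_nn_integral) (auto intro!: enn2real_ennreal integral_nonneg_AE AE_I2 simp: tail_nonneg split: split_indicator)
  have phi: "(\<lambda>z. \<phi> z * indicator {x<..y} z) = (\<lambda>z. z * indicator {x<..y} z - ?h z)"
    by (auto simp: virtual_eq algebra_simps)
  show ?int unfolding phi using i1 ih by (rule Bochner_Integration.integrable_diff)
  have "(LINT s|lborel. tail D s * indicator {x<..y} s)
      = (LINT s|lborel. tail D s * indicator ({x<..y} \<inter> I) s + tail D s * indicator ({x<..y} - I) s)"
    by (intro Bochner_Integration.integral_cong) (auto split: split_indicator)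
  also have "\<dots> = (LINT s|lborel. tail D s * indicator ({x<..y} \<inter> I) s) + (LINT s|lborel. tail D s * indicator ({x<..y} - I) s)"
    by (intro Bochner_Integration.integral_add i2) auto
  finally show ?eq
    unfolding phi using partial_expectation[OF assms] eh
    by (subst Bochner_Integration.integral_diff[OF i1 ih]) simp
qed

lemma integral_virtual_ge:
  assumes "0 \<le> x" "x \<le> y"
  shows "x * tail D x - y * tail D y \<le> (LINT z|D. \<phi> z * indicator {x<..y} z)"
proof -
  have "0 \<le> (LINT s|lborel. tail D s * indicator ({x<..y} - I) s)"
    by (intro integral_nonneg_AE AE_I2) (auto simp: tail_nonneg)
  then show ?thesis using integrable_virtual(2)[OF assms] by simp
qed

text \<open>The condition says that no point above x lies below all of \<open>I\<close>, so what the
  range misses of \<open>I\<close> lies above \<open>I\<close> and has tail 0.\<close>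

lemma integral_virtual_eq:
  assumes "0 \<le> x" "x \<le> y" and "\<And>s. x < s \<Longrightarrow> \<exists>c\<in>I. c \<le> s"
  shows "(LINT z|D. \<phi> z * indicator {x<..y} z) = x * tail D x - y * tail D y"
proof -
  have "(\<lambda>s. tail D s * indicator ({x<..y} - I) s) = (\<lambda>s. 0)"
    using assms(3) tail_above_I by (auto simp: fun_eq_iff split: split_indicator)
  then show ?thesis using integrable_virtual(2)[OF assms(1,2)] by simp
qed

lemma integral_Ioc: "x \<le> y \<Longrightarrow> (LINT z|D. c * indicator {x<..y} z) = c * (tail D x - tail D y)"
  using emeasure_Ioc_tail[of x y] tail_antimono[of x y] by (simp add: measure_def)

text \<open>A price x earns x * tail x from one bidder. As a function of the tail this revenue has
  slope \<open>\<phi>\<close>, and monotonicity of \<open>\<phi>\<close> makes it concave. The chord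
  from x to y is compared here with the slope at its upper price, and in the next lemma with the
  slope at its lower price.\<close>

lemma revenue_slope_left:
  assumes "0 \<le> x" "x \<le> y" "y \<in> I"
  shows "x * tail D x - y * tail D y \<le> \<phi> y * (tail D x - tail D y)"
proof -
  have "(LINT z|D. \<phi> z * indicator {x<..y} z) \<le> (LINT z|D. \<phi> y * indicator {x<..y} z)"
  proof (rule integral_mono_AE)
    show "integrable D (\<lambda>z. \<phi> z * indicator {x<..y} z)" by (rule integrable_virtual) fact+
    show "AE z in D. \<phi> z * indicator {x<..y} z \<le> \<phi> y * indicator {x<..y} z"
      using AE_in_I by eventually_elim (use assms in \<open>auto intro: mono_onD[OF mono_virtual] split: split_indicator\<close>)
  qed (auto simp: emeasure_eq_measure intro!: integrable_real_indicator integrable_mult_right)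
  then show ?thesis using integral_virtual_ge[OF assms(1,2)] integral_Ioc[OF assms(2), of "\<phi> y"] by linarith
qed

lemma revenue_slope_right:
  assumes "x \<in> I" "x \<le> y"
  shows "\<phi> x * (tail D x - tail D y) \<le> x * tail D x - y * tail D y"
proof -
  have x0: "0 \<le> x" using I_nonneg assms by auto
  have "(LINT z|D. \<phi> x * indicator {x<..y} z) \<le> (LINT z|D. \<phi> z * indicator {x<..y} z)"
  proof (rule integral_mono_AE)
    show "integrable D (\<lambda>z. \<phi> z * indicator {x<..y} z)" by (rule integrable_virtual) fact+
    show "AE z in D. \<phi> x * indicator {x<..y} z \<le> \<phi> z * indicator {x<..y} z"
      using AE_in_I by eventually_elim (use assms in \<open>auto intro: mono_onD[OF mono_virtual] split: split_indicator\<close>)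
  qed (auto simp: emeasure_eq_measure intro!: integrable_real_indicator integrable_mult_right)
  moreover have "(LINT z|D. \<phi> z * indicator {x<..y} z) = x * tail D x - y * tail D y"
    using assms x0 by (intro integral_virtual_eq) (auto intro: less_imp_le)
  ultimately show ?thesis using integral_Ioc[OF assms(2), of "\<phi> x"] by linarith
qed

text \<open>Eliminating \<open>\<phi> x\<close> from the two slope bounds at x shows that 1 / tail
  lies below its chord from t to p.\<close>

lemma inverse_tail_convex:
  assumes "0 \<le> t" "t \<le> x" "x \<le> p" "0 < tail D p"
  shows "(p - t) / tail D x \<le> (x - t) / tail D p + (p - x) / tail D t"
proof -
  let ?q = "tail D"
  have qx: "0 < ?q x" and qt: "0 < ?q t" using assms tail_antimono[of x p] tail_antimono[of t p] by auto
  show ?thesis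
  proof (cases "x \<in> I")
    case True
    let ?a = "?q t - ?q x" and ?b = "?q x - ?q p"
    have ab: "0 \<le> ?a" "0 \<le> ?b" using tail_antimono assms by auto
    have "(t * ?q t - x * ?q x) * ?b \<le> (\<phi> x * ?a) * ?b"
      using revenue_slope_left[of t x] assms True ab by (intro mult_right_mono) auto
    also have "\<dots> = (\<phi> x * ?b) * ?a" by simp
    also have "\<dots> \<le> (x * ?q x - p * ?q p) * ?a"
      using revenue_slope_right[of x p] assms True ab by (intro mult_right_mono) auto
    finally have "(p - t) * (?q t * ?q p) \<le> (x - t) * (?q x * ?q t) + (p - x) * (?q x * ?q p)"
      by (simp add: algebra_simps)
    then have "(p - t) * (?q t * ?q p) / (?q x * ?q t * ?q p)
        \<le> ((x - t) * (?q x * ?q t) + (p - x) * (?q x * ?q p)) / (?q x * ?q t * ?q p)"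
      using qx qt assms by (intro divide_right_mono) auto
    then show ?thesis using qx qt assms by (simp add: add_divide_distrib)
  next
    case False
    \<comment> \<open>With positive tail and outside \<open>I\<close>, the point x can only lie
      below \<open>I\<close>.\<close>
    have "?q x = 1"
    proof (rule tail_below_I)
      fix c assume "c \<in> I"
      then show "x \<le> c" using tail_above_I[OF False, of c] qx by force
    qed
    then have "?q t = 1" using tail_antimono[of t x] tail_le_1[of t] assms by auto
    have "(x - t) * 1 \<le> (x - t) * (1 / ?q p)"
      using assms tail_le_1[of p] by (intro mult_left_mono) auto
    then show ?thesis using \<open>?q x = 1\<close> \<open>?q t = 1\<close> by simp
  qed
qed

text \<open>A chord of \<open>1 / tail\<close> is linear, and the square of the reciprocal of a linear function
  \<open>l\<close> integrates to \<open>(p - t) / (l t * l p)\<close>.\<close>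

lemma price_difference_le:
  assumes "0 \<le> t" "t \<le> p"
  shows "ennreal ((p - t) * tail D p * tail D t)
    \<le> (\<integral>\<^sup>+ x. ennreal ((tail D x)\<^sup>2) * indicator {t..} x \<partial>lborel)"
proof (cases "tail D p = 0 \<or> t = p")
  case False
  let ?q = "tail D"
  have tp: "t < p" using False assms by auto
  have qp: "0 < ?q p" using False tail_nonneg[of p] by auto
  have qt: "0 < ?q t" using qp tail_antimono[OF assms(2)] by simp
  define l where "l x = ((x - t) / ?q p + (p - x) / ?q t) / (p - t)" for x
  have l_pos: "0 < l x" if "t \<le> x" "x \<le> p" for x
  proof -
    have "0 < (x - t) / ?q p + (p - x) / ?q t"
    proof (cases "x = t")
      case True
      then show ?thesis using tp qt by simp
    next
      case False
      then show ?thesis using that qt qp by (intro add_pos_nonneg) auto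
    qed
    then show ?thesis using tp by (simp add: l_def)
  qed
  have lt: "l t = 1 / ?q t" and lp: "l p = 1 / ?q p" using tp by (auto simp: l_def)
  define c where "c = (1 / ?q p - 1 / ?q t) / (p - t)"
  have l_lin: "l x = 1 / ?q t + c * (x - t)" for x
  proof -
    have "1 / ?q t = (p - t) / ?q t / (p - t)" using tp by simp
    then have "1 / ?q t + c * (x - t) = ((p - t) / ?q t + (1 / ?q p - 1 / ?q t) * (x - t)) / (p - t)"
      unfolding c_def by (simp add: add_divide_distrib)
    also have "(p - t) / ?q t + (1 / ?q p - 1 / ?q t) * (x - t) = (x - t) / ?q p + (p - x) / ?q t"
      by (simp add: algebra_simps diff_divide_distrib)
    finally show ?thesis by (simp add: l_def)
  qed
  \<comment> \<open>An antiderivative of 1 / l^2 that vanishes at t and equals (p - t) / (l t * l p)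
    at p.\<close>
  define G where "G x = (x - t) * ?q t / l x" for x
  have deriv: "DERIV G x :> 1 / (l x)\<^sup>2" if "t \<le> x" "x \<le> p" for x
  proof -
    have "(l has_real_derivative c) (at x)"
      unfolding l_lin[abs_def] by (auto intro!: derivative_eq_intros)
    then have "DERIV G x :> (?q t * l x - (x - t) * ?q t * c) / (l x * l x)"
      unfolding G_def[abs_def] using l_pos[OF that] by (auto intro!: derivative_eq_intros)
    moreover have "?q t * l x - (x - t) * ?q t * c = 1"
      unfolding l_lin using qt by (simp add: field_simps)
    ultimately show ?thesis by (simp add: power2_eq_square)
  qed
  have [measurable]: "l \<in> borel_measurable borel" unfolding l_def[abs_def] by measurable
  have "ennreal ((p - t) * ?q p * ?q t) = ennreal (G p - G t)"
    using lp by (simp add: G_def ac_simps)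
  also have "\<dots> = (\<integral>\<^sup>+ x. ennreal (1 / (l x)\<^sup>2) * indicator {t..p} x \<partial>lborel)"
    by (rule nn_integral_FTC_Icc[symmetric]) (use assms deriv in auto)
  also have "\<dots> \<le> (\<integral>\<^sup>+ x. ennreal ((?q x)\<^sup>2) * indicator {t..} x \<partial>lborel)"
  proof (intro nn_integral_mono)
    fix x
    have "1 / (l x)\<^sup>2 \<le> (?q x)\<^sup>2" if x: "t \<le> x" "x \<le> p"
    proof -
      have qx: "0 < ?q x" using qp tail_antimono[OF x(2)] by simp
      have "1 / ?q x = (p - t) / ?q x / (p - t)" using tp by simp
      also have "\<dots> \<le> l x"
        unfolding l_def using inverse_tail_convex[of t x p] assms x qp tp
        by (intro divide_right_mono) auto
      finally have "1 / l x \<le> ?q x" using qx l_pos[OF x] by (simp add: field_simps)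
      then have "(1 / l x)\<^sup>2 \<le> (?q x)\<^sup>2" using l_pos[OF x] by (intro power_mono) auto
      then show ?thesis by (simp add: power_divide)
    qed
    then show "ennreal (1 / (l x)\<^sup>2) * indicator {t..p} x \<le> ennreal ((?q x)\<^sup>2) * indicator {t..} x"
      by (auto split: split_indicator intro!: ennreal_leI)
  qed
  finally show ?thesis .
qed auto

text \<open>A Bulow--Klemperer bound: up to the factor \<open>tail D t\<close>, the left side is the revenue above the
  opportunity cost \<open>t\<close> of the best price for one bidder, and the right side is the expected excess
  over \<open>t\<close> of the lower of two values.\<close>

lemma virtual_surplus_truncated:
  assumes t: "0 \<le> t" "t \<le> T"
  shows "ennreal (tail D t) *
      ((\<integral>\<^sup>+ x. ennreal (\<phi> x - t) * indicator {..<T} x \<partial>D) + ennreal ((T - t) * tail D T))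
    \<le> (\<integral>\<^sup>+ x. ennreal ((tail D x)\<^sup>2) * indicator {t..} x \<partial>lborel)"
proof -
  let ?q = "tail D"
  define S where "S = {x \<in> I. t < \<phi> x \<and> x < T}"
  \<comment> \<open>The best price at opportunity cost t among the prices up to \<open>T\<close>: on
    \<open>I\<close> below \<open>T\<close>, the virtual value is at most t before p and exceeds t
    after it.\<close>
  define p where "p = (if S = {} then T else Inf S)"
  have bdd: "bdd_below S" using I_nonneg by (auto simp: S_def intro!: bdd_belowI[of _ 0])
  have St: "t < x" if "x \<in> S" for x using that virtual_le[of x] by (auto simp: S_def)
  have tp: "t \<le> p" using t St cInf_greatest[of S t] by (force simp: p_def)
  have pT: "p \<le> T"
  proof (cases "S = {}")
    case False
    then obtain x where "x \<in> S" by auto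
    then have "Inf S \<le> x" "x < T" using bdd by (auto intro: cInf_lower simp: S_def)
    then show ?thesis using False by (simp add: p_def)
  qed (simp add: p_def)
  have above: "t < \<phi> x" if x: "p < x" "x < T" "x \<in> I" for x
  proof -
    have "S \<noteq> {}" using x by (auto simp: p_def split: if_splits)
    then obtain y where "y \<in> S" "y < x" using x bdd cInf_lessD[of S x] by (auto simp: p_def)
    then have "\<phi> y \<le> \<phi> x" "t < \<phi> y"
      using x mono_onD[OF mono_virtual, of y x] by (auto simp: S_def)
    then show ?thesis by simp
  qed
  have below: "\<phi> x \<le> t" if x: "x < p" "x < T" "x \<in> I" for x
  proof (rule ccontr)
    assume "\<not> \<phi> x \<le> t"
    then have "x \<in> S" using x by (auto simp: S_def)
    then show False using x bdd cInf_lower[of x S] by (auto simp: p_def split: if_splits)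
  qed
  have Ip: "\<exists>c\<in>I. c \<le> s" if s: "p < s" "S \<noteq> {}" for s
  proof -
    obtain c where "c \<in> S" "c < s" using s cInf_lessD[of S s] by (auto simp: p_def)
    then show ?thesis by (intro bexI[of _ c]) (auto simp: S_def)
  qed
  have AE_neq: "AE x in D. x \<noteq> c" for c
    using emeasure_point[of c] by (subst AE_iff_measurable[OF _ refl]) auto
  have int: "integrable D (\<lambda>x. (\<phi> x - t) * indicator {p<..T} x)"
    unfolding left_diff_distrib using integrable_virtual(1)[of p T] t tp pT
    by (intro Bochner_Integration.integrable_diff integrable_mult_right integrable_real_indicator)
       (auto simp: emeasure_eq_measure)
  have "(\<integral>\<^sup>+ x. ennreal (\<phi> x - t) * indicator {..<T} x \<partial>D)
      = (\<integral>\<^sup>+ x. ennreal ((\<phi> x - t) * indicator {p<..T} x) \<partial>D)"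
    using AE_in_I AE_neq[of p] AE_neq[of T]
    by (intro nn_integral_cong_AE, eventually_elim)
       (auto split: split_indicator intro!: ennreal_neg below)
  also have "\<dots> = ennreal (LINT x|D. (\<phi> x - t) * indicator {p<..T} x)"
    using AE_in_I AE_neq[of T]
    by (intro nn_integral_eq_integral int, eventually_elim) (auto split: split_indicator dest: above)
  also have "(LINT x|D. (\<phi> x - t) * indicator {p<..T} x) = p * ?q p - T * ?q T - t * (?q p - ?q T)"
  proof (cases "S = {}")
    case True
    then show ?thesis by (simp add: p_def)
  next
    case False
    have "(LINT x|D. (\<phi> x - t) * indicator {p<..T} x)
        = (LINT x|D. \<phi> x * indicator {p<..T} x - t * indicator {p<..T} x)"
      by (simp add: left_diff_distrib)
    also have "\<dots> = (LINT x|D. \<phi> x * indicator {p<..T} x) - (LINT x|D. t * indicator {p<..T} x)"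
      using integrable_virtual(1)[of p T] t tp pT
      by (intro Bochner_Integration.integral_diff integrable_mult_right integrable_real_indicator)
         (auto simp: emeasure_eq_measure)
    also have "(LINT x|D. \<phi> x * indicator {p<..T} x) = p * ?q p - T * ?q T"
      using False t tp pT Ip by (intro integral_virtual_eq) auto
    finally show ?thesis using integral_Ioc[OF pT, of t] by simp
  qed
  finally have E: "(\<integral>\<^sup>+ x. ennreal (\<phi> x - t) * indicator {..<T} x \<partial>D)
      = ennreal (p * ?q p - T * ?q T - t * (?q p - ?q T))" .
  have pos: "0 \<le> p * ?q p - T * ?q T - t * (?q p - ?q T)"
  proof -
    have "0 \<le> (LINT x|D. (\<phi> x - t) * indicator {p<..T} x)"
      using AE_in_I AE_neq[of T]
      by (intro integral_nonneg_AE, eventually_elim) (auto split: split_indicator dest: above)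
    then show ?thesis using \<open>(LINT x|D. (\<phi> x - t) * indicator {p<..T} x) = _\<close> by simp
  qed
  \<comment> \<open>The virtual surplus is the net revenue of price p minus that of price
    \<open>T\<close>; the term at \<open>T\<close> on the left of the claim restores the
    latter.\<close>
  have "ennreal (p * ?q p - T * ?q T - t * (?q p - ?q T)) + ennreal ((T - t) * ?q T)
      = ennreal ((p - t) * ?q p)"
    using pos t tail_nonneg[of T]
    by (subst ennreal_plus[symmetric]) (auto simp: algebra_simps intro: mult_right_mono)
  then have "ennreal (?q t) * (ennreal (p * ?q p - T * ?q T - t * (?q p - ?q T)) + ennreal ((T - t) * ?q T))
      = ennreal ((p - t) * ?q p * ?q t)"
    using tp tail_nonneg by (simp add: mult.commute[of "?q t"] flip: ennreal_mult)
  then show ?thesis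
    unfolding E using price_difference_le[OF t(1) tp] by simp
qed

end

section \<open>The benchmark of a single item\<close>

lemma nn_integral_layer_cake:
  assumes "sigma_finite_measure M" and [measurable]: "g \<in> borel_measurable M"
  shows "(\<integral>\<^sup>+ x. ennreal (g x - t) \<partial>M)
    = (\<integral>\<^sup>+ s. emeasure M {x \<in> space M. s < g x} * indicator {t..} s \<partial>lborel)"
proof -
  interpret sigma_finite_measure M by fact
  interpret pair_sigma_finite M lborel ..
  have "(\<integral>\<^sup>+ x. ennreal (g x - t) \<partial>M)
      = (\<integral>\<^sup>+ x. (\<integral>\<^sup>+ s. indicator {y \<in> space (M \<Otimes>\<^sub>M lborel). t \<le> snd y \<and> snd y < g (fst y)} (x, s) \<partial>lborel) \<partial>M)"
  proof (intro nn_integral_cong)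
    fix x assume x: "x \<in> space M"
    have "ennreal (g x - t) = emeasure lborel {t..<g x}"
      by (cases "t \<le> g x") (auto simp: ennreal_neg)
    also have "\<dots> = (\<integral>\<^sup>+ s. indicator {t..<g x} s \<partial>lborel)" by simp
    also have "\<dots> = (\<integral>\<^sup>+ s. indicator {y \<in> space (M \<Otimes>\<^sub>M lborel). t \<le> snd y \<and> snd y < g (fst y)} (x, s) \<partial>lborel)"
      using x by (intro nn_integral_cong) (auto simp: space_pair_measure split: split_indicator)
    finally show "ennreal (g x - t) = \<dots>" .
  qed
  also have "\<dots> = (\<integral>\<^sup>+ s. (\<integral>\<^sup>+ x. indicator {y \<in> space (M \<Otimes>\<^sub>M lborel). t \<le> snd y \<and> snd y < g (fst y)} (x, s) \<partial>M) \<partial>lborel)"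
    by (rule Fubini'[symmetric]) measurable
  also have "\<dots> = (\<integral>\<^sup>+ s. emeasure M {x \<in> space M. s < g x} * indicator {t..} s \<partial>lborel)"
  proof (intro nn_integral_cong)
    fix s :: real
    have "(\<integral>\<^sup>+ x. indicator {y \<in> space (M \<Otimes>\<^sub>M lborel). t \<le> snd y \<and> snd y < g (fst y)} (x, s) \<partial>M)
        = (\<integral>\<^sup>+ x. indicator {x \<in> space M. s < g x} x * indicator {t..} s \<partial>M)"
      by (intro nn_integral_cong) (auto simp: space_pair_measure split: split_indicator)
    also have "\<dots> = emeasure M {x \<in> space M. s < g x} * indicator {t..} s"
      by (subst nn_integral_multc) auto
    finally show "(\<integral>\<^sup>+ x. indicator {y \<in> space (M \<Otimes>\<^sub>M lborel). t \<le> snd y \<and> snd y < g (fst y)} (x, s) \<partial>M) = \<dots>" .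
  qed
  finally show ?thesis .
qed

definition virtual_tail :: "real measure \<Rightarrow> (real \<Rightarrow> real) \<Rightarrow> real \<Rightarrow> real" where
  "virtual_tail D f t = measure D {x. t < virtual_value D f x}"

text \<open>The revenue that can be extracted at arbitrarily high prices. It is not captured by virtual
  values: for the equal-revenue distribution these vanish, while every price has revenue \<open>1\<close>.\<close>

definition top_revenue :: "real measure \<Rightarrow> ennreal" where
  "top_revenue D = liminf (\<lambda>k. ennreal (real k * tail D (real k)))"

text \<open>The expected second highest of k independent values, as the integral over t of the
  probability that at least two of them exceed t.\<close>

definition second_price :: "real measure \<Rightarrow> nat \<Rightarrow> ennreal" where
  "second_price D k = (\<integral>\<^sup>+ t. ennreal (1 - (1 - tail D t) ^ k - k * tail D t * (1 - tail D t) ^ (k - 1))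
     * indicator {0..} t \<partial>lborel)"

section \<open>The Bulow--Klemperer bound and its average over opportunity costs\<close>

context regular_item
begin

text \<open>The truncation level tends to infinity along the naturals. \<open>E\<close> and the tail
  infima \<open>b\<close> both increase, so their suprema add up, and this is where the liminf in
  \<open>top_revenue\<close> comes from. The difference between T * tail T and (T - t) * tail T
  vanishes in the limit.\<close>

lemma virtual_surplus:
  assumes t: "0 \<le> t"
  shows "ennreal (tail D t) * ((\<integral>\<^sup>+ x. ennreal (\<phi> x - t) \<partial>D) + top_revenue D)
    \<le> (\<integral>\<^sup>+ x. ennreal ((tail D x)\<^sup>2) * indicator {t..} x \<partial>lborel)"
proof -
  let ?B = "(\<integral>\<^sup>+ x. ennreal ((tail D x)\<^sup>2) * indicator {t..} x \<partial>lborel)"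
  define a where "a k = ennreal (real k * tail D (real k))" for k
  define b where "b k = (INF j\<in>{k..}. a j)" for k
  define E where "E k = (\<integral>\<^sup>+ x. ennreal (\<phi> x - t) * indicator {..<real k} x \<partial>D)" for k
  have Einc: "incseq E"
    unfolding E_def incseq_def by (intro allI impI nn_integral_mono) (auto split: split_indicator)
  have binc: "incseq b"
    unfolding b_def incseq_def by (intro allI impI INF_superset_mono) auto
  have "(SUP k. E k) = (\<integral>\<^sup>+ x. (SUP k. ennreal (\<phi> x - t) * indicator {..<real k} x) \<partial>D)"
    unfolding E_def
    by (subst nn_integral_monotone_convergence_SUP)
       (auto simp: incseq_def le_fun_def split: split_indicator)
  also have "\<dots> = (\<integral>\<^sup>+ x. ennreal (\<phi> x - t) \<partial>D)"
  proof (intro nn_integral_cong antisym)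
    fix x
    show "(SUP k. ennreal (\<phi> x - t) * indicator {..<real k} x) \<le> ennreal (\<phi> x - t)"
      by (intro SUP_least) (auto split: split_indicator)
    obtain k where "x < real k" using reals_Archimedean2 by auto
    then show "ennreal (\<phi> x - t) \<le> (SUP k. ennreal (\<phi> x - t) * indicator {..<real k} x)"
      by (intro SUP_upper2[of k]) auto
  qed
  finally have E: "(SUP k. E k) = (\<integral>\<^sup>+ x. ennreal (\<phi> x - t) \<partial>D)" .
  have b: "(SUP k. b k) = top_revenue D"
    unfolding top_revenue_def b_def a_def liminf_SUP_INF ..
  have step: "ennreal (tail D t) * (E k + a k) \<le> ?B + ennreal (t * tail D (real k))" if "t \<le> real k" for k
  proof -
    have "a k = ennreal ((real k - t) * tail D (real k)) + ennreal (t * tail D (real k))"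
      unfolding a_def using that t tail_nonneg[of "real k"]
      by (subst ennreal_plus[symmetric]) (auto simp: algebra_simps intro: mult_right_mono)
    then have "ennreal (tail D t) * (E k + a k)
        = ennreal (tail D t) * (E k + ennreal ((real k - t) * tail D (real k)))
          + ennreal (tail D t) * ennreal (t * tail D (real k))"
      by (simp add: distrib_left add.assoc)
    also have "\<dots> \<le> ?B + 1 * ennreal (t * tail D (real k))"
      using virtual_surplus_truncated[OF t that] tail_le_1[of t] unfolding E_def
      by (intro add_mono mult_right_mono) auto
    finally show ?thesis by simp
  qed
  have "ennreal (tail D t) * (E k + b k) \<le> ?B" for k
  proof (rule LIMSEQ_le_const)
    have "(\<lambda>k. ennreal (t * tail D (real k))) \<longlonglongrightarrow> ennreal (t * 0)"
      by (intro tendsto_intros tail_tendsto_0 tendsto_ennrealI)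
    then show "(\<lambda>k. ?B + ennreal (t * tail D (real k))) \<longlonglongrightarrow> ?B"
      using tendsto_add[OF tendsto_const, of _ "ennreal (t * 0)" _ ?B] by simp
    obtain k' where k': "t \<le> real k'" using real_arch_simple by auto
    have "ennreal (tail D t) * (E k + b k) \<le> ?B + ennreal (t * tail D (real j))" if "max k k' \<le> j" for j
    proof -
      have "E k \<le> E j" using that incseqD[OF Einc, of k j] by simp
      moreover have "b k \<le> a j" unfolding b_def using that by (intro INF_lower) simp
      ultimately have "ennreal (tail D t) * (E k + b k) \<le> ennreal (tail D t) * (E j + a j)"
        by (intro mult_left_mono add_mono) simp_all
      also have "\<dots> \<le> ?B + ennreal (t * tail D (real j))" using that k' by (intro step) auto
      finally show ?thesis .
    qed
    then show "\<exists>N. \<forall>j\<ge>N. ennreal (tail D t) * (E k + b k) \<le> ?B + ennreal (t * tail D (real j))"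
      by blast
  qed
  then have "(SUP k. ennreal (tail D t) * (E k + b k)) \<le> ?B" by (intro SUP_least)
  also have "(SUP k. ennreal (tail D t) * (E k + b k)) = ennreal (tail D t) * (SUP k. E k + b k)"
    by (rule SUP_mult_left_ennreal[symmetric])
  also have "(SUP k. E k + b k) = (SUP k. E k) + (SUP k. b k)"
    by (rule ennreal_SUP_add) fact+
  finally show ?thesis unfolding E b .
qed

lemma virtual_tail_nonneg: "0 \<le> virtual_tail D f t"
  and virtual_tail_le: "virtual_tail D f t \<le> tail D t"
proof -
  show "0 \<le> virtual_tail D f t" by (simp add: virtual_tail_def)
  show "virtual_tail D f t \<le> tail D t"
    unfolding virtual_tail_def tail_eq using virtual_le
    by (intro finite_measure_mono) (auto intro: less_le_trans)
qed

lemma virtual_tail_measurable [measurable]: "virtual_tail D f \<in> borel_measurable borel"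
proof -
  have "mono (\<lambda>t. - virtual_tail D f t)"
    unfolding virtual_tail_def by (intro monoI) (auto intro!: finite_measure_mono)
  then have "(\<lambda>t. - (- virtual_tail D f t)) \<in> borel_measurable borel"
    by (intro borel_measurable_uminus borel_measurable_mono)
  then show ?thesis by simp
qed

lemma virtual_surplus_layers:
  assumes "0 \<le> t"
  shows "ennreal (tail D t) * ((\<integral>\<^sup>+ x. ennreal (virtual_tail D f x) * indicator {t..} x \<partial>lborel) + top_revenue D)
    \<le> (\<integral>\<^sup>+ x. ennreal ((tail D x)\<^sup>2) * indicator {t..} x \<partial>lborel)"
proof -
  have "(\<integral>\<^sup>+ x. ennreal (\<phi> x - t) \<partial>D)
      = (\<integral>\<^sup>+ x. ennreal (virtual_tail D f x) * indicator {t..} x \<partial>lborel)"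
    by (subst nn_integral_layer_cake)
       (auto intro: sigma_finite_measure_axioms simp: virtual_tail_def emeasure_eq_measure)
  then show ?thesis using virtual_surplus[OF assms] by simp
qed

lemma tail_0: "tail D 0 = 1"
  by (rule tail_below_I) (rule I_nonneg)

lemma tail_surj:
  assumes "0 < u" "u < 1"
  obtains t where "0 \<le> t" "tail D t = u"
proof -
  have "eventually (\<lambda>k. tail D (real k) < u) sequentially"
    using order_tendstoD(2)[OF tail_tendsto_0 assms(1)] .
  then obtain k where k: "tail D (real k) < u" by (auto simp: eventually_sequentially)
  have "\<exists>t\<ge>0. t \<le> real k \<and> tail D t = u"
    using k assms tail_0 by (intro IVT2) (auto simp: tail_def[abs_def] isCont_cdf_D intro!: continuous_intros)
  then show thesis using that by auto
qed

lemma virtual_surplus_average_aux: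
  fixes M :: nat
  assumes M: "3 \<le> M"
  defines "\<rho> \<equiv> \<lambda>q. (1 - q) ^ (M - 1) + (real M - 1) * q * (1 - q) ^ (M - 2)"
  shows "top_revenue D + (\<integral>\<^sup>+ t. ennreal (virtual_tail D f t * \<rho> (tail D t)) * indicator {0..} t \<partial>lborel)
    \<le> (\<integral>\<^sup>+ t. ennreal ((real M - 1) * (tail D t)\<^sup>2 * (1 - tail D t) ^ (M - 2)) * indicator {0..} t \<partial>lborel)"
proof -
  let ?q = "tail D" and ?s = "virtual_tail D f"
  obtain N where N: "M = N + 3" using M by (metis add.commute le_iff_add)
  \<comment> \<open>\<open>\<rho> q\<close> is the probability that the second smallest of M - 1
    uniform variables exceeds q, and \<open>\<kappa>\<close> is the density of that variable.
    \<open>\<kappa>'\<close> is \<open>\<kappa>\<close> divided by u: the bound at the level with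
    tail u has the factor u on its left side, and this division removes it.\<close>
  define \<kappa> where "\<kappa> u = (real N + 2) * (real N + 1) * u * (1 - u) ^ N" for u :: real
  define \<kappa>' where "\<kappa>' u = (real N + 2) * (real N + 1) * (1 - u) ^ N" for u :: real
  have [measurable]: "\<kappa> \<in> borel_measurable borel" "\<kappa>' \<in> borel_measurable borel"
    unfolding \<kappa>_def[abs_def] \<kappa>'_def[abs_def] by measurable
  have \<kappa>0: "0 \<le> \<kappa> u" "0 \<le> \<kappa>' u" if "0 \<le> u" "u \<le> 1" for u using that by (auto simp: \<kappa>_def \<kappa>'_def)
  have rho_eq: "\<rho> u = (1 - u) ^ (N + 2) + (real N + 2) * u * (1 - u) ^ (N + 1)" for u
    by (simp add: \<rho>_def N numeral_eq_Suc)
  have drho: "((\<lambda>u. - \<rho> u) has_real_derivative \<kappa> u) (at u)" for u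
    unfolding rho_eq[abs_def] \<kappa>_def
    by ((rule derivative_eq_intros refl)+, simp add: algebra_simps)
  have int\<kappa>: "(\<integral>\<^sup>+ u. ennreal (\<kappa> u) * indicator {q<..1} u \<partial>lborel) = ennreal (\<rho> q)"
    if "0 \<le> q" "q \<le> 1" for q
  proof -
    have "(\<integral>\<^sup>+ u. ennreal (\<kappa> u) * indicator {q<..1} u \<partial>lborel) = (\<integral>\<^sup>+ u. ennreal (\<kappa> u) * indicator {q..1} u \<partial>lborel)"
      using AE_lborel_singleton[of q] by (intro nn_integral_cong_AE) (auto split: split_indicator)
    also have "\<dots> = ennreal (- \<rho> 1 - - \<rho> q)"
      using that drho \<kappa>0 by (intro nn_integral_FTC_Icc) auto
    also have "- \<rho> 1 - - \<rho> q = \<rho> q" by (simp add: rho_eq)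
    finally show ?thesis .
  qed
  have int\<kappa>': "(\<integral>\<^sup>+ u. ennreal (\<kappa>' u) * indicator {q..1} u \<partial>lborel) = ennreal ((real N + 2) * (1 - q) ^ (N + 1))"
    if "0 \<le> q" "q \<le> 1" for q
  proof -
    have "((\<lambda>u. - ((real N + 2) * (1 - u) ^ (N + 1))) has_real_derivative \<kappa>' u) (at u)" for u
      unfolding \<kappa>'_def by ((rule derivative_eq_intros refl)+, simp add: algebra_simps)
    then have "(\<integral>\<^sup>+ u. ennreal (\<kappa>' u) * indicator {q..1} u \<partial>lborel)
        = ennreal (- ((real N + 2) * (1 - 1) ^ (N + 1)) - - ((real N + 2) * (1 - q) ^ (N + 1)))"
      using that \<kappa>0 by (intro nn_integral_FTC_Icc) auto
    then show ?thesis by simp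
  qed
  let ?W = "\<integral>\<^sup>+ t. ennreal (?s t * \<rho> (?q t)) * indicator {0..} t \<partial>lborel"
  let ?w = "\<lambda>u t. ennreal (\<kappa> u) * indicator {0..1} u * (ennreal (?s t) * indicator {0..} t * (if ?q t < u then 1 else 0))"
  let ?v = "\<lambda>u t. ennreal (\<kappa>' u) * indicator {0..1} u * (ennreal ((?q t)\<^sup>2) * indicator {0..} t * (if ?q t \<le> u then 1 else 0))"
  have "?W = (\<integral>\<^sup>+ t. (\<integral>\<^sup>+ u. ?w u t \<partial>lborel) \<partial>lborel)"
  proof (intro nn_integral_cong)
    fix t
    have "(\<integral>\<^sup>+ u. ?w u t \<partial>lborel) = (\<integral>\<^sup>+ u. (ennreal (?s t) * indicator {0..} t) * (ennreal (\<kappa> u) * indicator {?q t<..1} u) \<partial>lborel)"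
      using tail_nonneg[of t]
      by (intro nn_integral_cong) (auto simp: ac_simps split: split_indicator)
    also have "\<dots> = (ennreal (?s t) * indicator {0..} t) * ennreal (\<rho> (?q t))"
      by (subst nn_integral_cmult) (auto simp: int\<kappa> tail_nonneg tail_le_1)
    also have "\<dots> = ennreal (?s t * \<rho> (?q t)) * indicator {0..} t"
      by (simp add: ennreal_mult' virtual_tail_nonneg ac_simps)
    finally show "ennreal (?s t * \<rho> (?q t)) * indicator {0..} t = (\<integral>\<^sup>+ u. ?w u t \<partial>lborel)" by simp
  qed
  also have "\<dots> = (\<integral>\<^sup>+ u. (\<integral>\<^sup>+ t. ?w u t \<partial>lborel) \<partial>lborel)"
    by (rule lborel_pair.Fubini') measurable
  also have "\<dots> = (\<integral>\<^sup>+ u. ennreal (\<kappa> u) * indicator {0..1} u *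
      (\<integral>\<^sup>+ t. ennreal (?s t) * indicator {0..} t * (if ?q t < u then 1 else 0) \<partial>lborel) \<partial>lborel)"
    by (intro nn_integral_cong nn_integral_cmult) measurable
  finally have W: "?W = \<dots>" .
  \<comment> \<open>The weights \<open>\<kappa>\<close> have total mass 1, so averaging leaves
    \<open>top_revenue\<close> with coefficient 1.\<close>
  have "top_revenue D = ennreal (\<rho> 0) * top_revenue D" by (simp add: rho_eq)
  also have "\<dots> = (\<integral>\<^sup>+ u. ennreal (\<kappa> u) * indicator {0<..1} u * top_revenue D \<partial>lborel)"
    using int\<kappa>[of 0] by (subst nn_integral_multc) auto
  also have "\<dots> = (\<integral>\<^sup>+ u. ennreal (\<kappa> u) * indicator {0..1} u * top_revenue D \<partial>lborel)"
    by (intro nn_integral_cong) (auto split: split_indicator simp: \<kappa>_def)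
  finally have "top_revenue D + ?W = (\<integral>\<^sup>+ u. ennreal (\<kappa> u) * indicator {0..1} u * top_revenue D \<partial>lborel) + ?W"
    by simp
  also have "\<dots> = (\<integral>\<^sup>+ u. ennreal (\<kappa> u) * indicator {0..1} u * (top_revenue D +
      (\<integral>\<^sup>+ t. ennreal (?s t) * indicator {0..} t * (if ?q t < u then 1 else 0) \<partial>lborel)) \<partial>lborel)"
    unfolding W by (subst nn_integral_add[symmetric]) (auto simp: distrib_left)
  also have "\<dots> \<le> (\<integral>\<^sup>+ u. ennreal (\<kappa>' u) * indicator {0..1} u *
      (\<integral>\<^sup>+ t. ennreal ((?q t)\<^sup>2) * indicator {0..} t * (if ?q t \<le> u then 1 else 0) \<partial>lborel) \<partial>lborel)"
  proof (rule nn_integral_mono_AE)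
    \<comment> \<open>A level with tail u comes from \<open>tail_surj\<close>, which covers 0 < u <
      1; at u = 0 the weight vanishes, and u = 1 is a null set.\<close>
    have pointwise: "ennreal (\<kappa> u) * indicator {0..1} u * (top_revenue D +
        (\<integral>\<^sup>+ t. ennreal (?s t) * indicator {0..} t * (if ?q t < u then 1 else 0) \<partial>lborel))
      \<le> ennreal (\<kappa>' u) * indicator {0..1} u *
        (\<integral>\<^sup>+ t. ennreal ((?q t)\<^sup>2) * indicator {0..} t * (if ?q t \<le> u then 1 else 0) \<partial>lborel)"
      if u: "u \<noteq> 1" for u
    proof (cases "0 < u \<and> u < 1")
      case True
      then obtain t0 where t0: "0 \<le> t0" "?q t0 = u" using tail_surj by blast
      have "ennreal (\<kappa> u) * (top_revenue D +
          (\<integral>\<^sup>+ t. ennreal (?s t) * indicator {0..} t * (if ?q t < u then 1 else 0) \<partial>lborel))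
        \<le> ennreal (\<kappa>' u * u) * ((\<integral>\<^sup>+ t. ennreal (?s t) * indicator {t0..} t \<partial>lborel) + top_revenue D)"
      proof (intro mult_mono)
        show "ennreal (\<kappa> u) \<le> ennreal (\<kappa>' u * u)" by (simp add: \<kappa>_def \<kappa>'_def ac_simps)
        have "t0 \<le> t" if "?q t < u" for t using tail_antimono[of t t0] t0 that by (cases "t0 \<le> t") auto
        then show "top_revenue D +
            (\<integral>\<^sup>+ t. ennreal (?s t) * indicator {0..} t * (if ?q t < u then 1 else 0) \<partial>lborel)
          \<le> (\<integral>\<^sup>+ t. ennreal (?s t) * indicator {t0..} t \<partial>lborel) + top_revenue D"
          by (subst add.commute) (intro add_mono nn_integral_mono, auto split: split_indicator)
      qed auto
      also have "\<dots> = ennreal (\<kappa>' u) * (ennreal (?q t0) * ((\<integral>\<^sup>+ t. ennreal (?s t) * indicator {t0..} t \<partial>lborel) + top_revenue D))"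
        using True \<kappa>0 t0 by (simp add: ennreal_mult' mult.assoc)
      also have "\<dots> \<le> ennreal (\<kappa>' u) * (\<integral>\<^sup>+ t. ennreal ((?q t)\<^sup>2) * indicator {t0..} t \<partial>lborel)"
        by (intro mult_left_mono virtual_surplus_layers t0) auto
      also have "\<dots> \<le> ennreal (\<kappa>' u) * (\<integral>\<^sup>+ t. ennreal ((?q t)\<^sup>2) * indicator {0..} t * (if ?q t \<le> u then 1 else 0) \<partial>lborel)"
        using t0 tail_antimono[of t0]
        by (intro mult_left_mono nn_integral_mono) (auto split: split_indicator)
      finally show ?thesis using True by simp
    next
      case False
      then have "u = 0 \<or> u \<notin> {0..1}" using u by auto
      then show ?thesis by (auto simp: \<kappa>_def split: split_indicator)
    qed
    show "AE u in lborel. ennreal (\<kappa> u) * indicator {0..1} u * (top_revenue D +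
        (\<integral>\<^sup>+ t. ennreal (?s t) * indicator {0..} t * (if ?q t < u then 1 else 0) \<partial>lborel))
      \<le> ennreal (\<kappa>' u) * indicator {0..1} u *
        (\<integral>\<^sup>+ t. ennreal ((?q t)\<^sup>2) * indicator {0..} t * (if ?q t \<le> u then 1 else 0) \<partial>lborel)"
      by (rule AE_mp[OF AE_lborel_singleton[of 1]]) (intro AE_I2 impI pointwise)
  qed
  also have "\<dots> = (\<integral>\<^sup>+ u. (\<integral>\<^sup>+ t. ?v u t \<partial>lborel) \<partial>lborel)"
    by (intro nn_integral_cong nn_integral_cmult[symmetric]) measurable
  also have "\<dots> = (\<integral>\<^sup>+ t. (\<integral>\<^sup>+ u. ?v u t \<partial>lborel) \<partial>lborel)"
    by (rule lborel_pair.Fubini') measurable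
  also have "\<dots> = (\<integral>\<^sup>+ t. ennreal ((real M - 1) * (?q t)\<^sup>2 * (1 - ?q t) ^ (M - 2)) * indicator {0..} t \<partial>lborel)"
  proof (intro nn_integral_cong)
    fix t
    have "(\<integral>\<^sup>+ u. ?v u t \<partial>lborel) = (\<integral>\<^sup>+ u. (ennreal ((?q t)\<^sup>2) * indicator {0..} t) * (ennreal (\<kappa>' u) * indicator {?q t..1} u) \<partial>lborel)"
      using tail_nonneg[of t]
      by (intro nn_integral_cong) (auto simp: ac_simps split: split_indicator)
    also have "\<dots> = (ennreal ((?q t)\<^sup>2) * indicator {0..} t) * ennreal ((real N + 2) * (1 - ?q t) ^ (N + 1))"
      by (subst nn_integral_cmult) (auto simp: int\<kappa>' tail_nonneg tail_le_1)
    also have "\<dots> = ennreal ((?q t)\<^sup>2 * ((real N + 2) * (1 - ?q t) ^ (N + 1))) * indicator {0..} t"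
      by (subst ennreal_mult'[of "(?q t)\<^sup>2"]) (simp_all only: ac_simps zero_le_power2)
    also have "(?q t)\<^sup>2 * ((real N + 2) * (1 - ?q t) ^ (N + 1)) = (real M - 1) * (?q t)\<^sup>2 * (1 - ?q t) ^ (M - 2)"
      by (simp add: N)
    finally show "(\<integral>\<^sup>+ u. ?v u t \<partial>lborel) = ennreal ((real M - 1) * (?q t)\<^sup>2 * (1 - ?q t) ^ (M - 2)) * indicator {0..} t" .
  qed
  finally show ?thesis .
qed

text \<open>For \<open>M \<ge> 3\<close> this averages the previous bound over \<open>tail D t\<close>, with the density of the second
  smallest of \<open>M - 1\<close> uniform variables as weight.\<close>

lemma virtual_surplus_average:
  fixes M :: nat
  assumes M: "2 \<le> M"
  shows "top_revenue D + (\<integral>\<^sup>+ t. ennreal (virtual_tail D f t *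
      ((1 - tail D t) ^ (M - 1) + (real M - 1) * tail D t * (1 - tail D t) ^ (M - 2))) * indicator {0..} t \<partial>lborel)
    \<le> (\<integral>\<^sup>+ t. ennreal ((real M - 1) * (tail D t)\<^sup>2 * (1 - tail D t) ^ (M - 2)) * indicator {0..} t \<partial>lborel)"
proof (cases "M = 2")
  case True
  \<comment> \<open>With a single rival the second highest is absent: the opportunity cost is 0 and
    the weight is constantly 1.\<close>
  then show ?thesis using virtual_surplus_layers[of 0] by (simp add: tail_0 add.commute)
next
  case False
  then show ?thesis using virtual_surplus_average_aux[of M] M by simp
qed

text \<open>Integrating the polynomial inequality gives X + n Y \<le> second price + n W, and the
  averaged bound \<open>top_revenue\<close> + W \<le> Y settles the corrections and pays for
  \<open>top_revenue\<close> as well. If the integral of the squared tail is infinite, so is the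
  second price; otherwise W is finite and can be cancelled.\<close>

lemma benchmark_le_second_price:
  fixes n m :: nat
  assumes nm: "1 \<le> n" "1 \<le> m"
  defines "M \<equiv> 2 * n + 2 * m - 2"
  shows "(\<integral>\<^sup>+ t. ennreal (1 - (1 - tail D t + (1 - tail D t) ^ (m - 1) * (tail D t - virtual_tail D f t)) ^ n)
      * indicator {0..} t \<partial>lborel) + of_nat n * top_revenue D \<le> second_price D M"
proof -
  let ?q = "tail D" and ?s = "virtual_tail D f"
  have M2: "2 \<le> M" using nm by (simp add: M_def)
  define X where "X = (\<integral>\<^sup>+ t. ennreal (1 - (1 - ?q t + (1 - ?q t) ^ (m - 1) * (?q t - ?s t)) ^ n) * indicator {0..} t \<partial>lborel)"
  define Y where "Y = (\<integral>\<^sup>+ t. ennreal ((real M - 1) * (?q t)\<^sup>2 * (1 - ?q t) ^ (M - 2)) * indicator {0..} t \<partial>lborel)"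
  define W where "W = (\<integral>\<^sup>+ t. ennreal (?s t *
      ((1 - ?q t) ^ (M - 1) + (real M - 1) * ?q t * (1 - ?q t) ^ (M - 2))) * indicator {0..} t \<partial>lborel)"
  have WY: "top_revenue D + W \<le> Y" unfolding W_def Y_def by (rule virtual_surplus_average[OF M2])
  show ?thesis
  proof (cases "(\<integral>\<^sup>+ t. ennreal ((?q t)\<^sup>2) * indicator {0..} t \<partial>lborel) = \<top>")
    case True
    have "(\<integral>\<^sup>+ t. ennreal ((?q t)\<^sup>2) * indicator {0..} t \<partial>lborel) \<le> second_price D M"
      unfolding second_price_def using at_least_two_ge[OF tail_nonneg tail_le_1 M2]
      by (intro nn_integral_mono mult_right_mono ennreal_leI) auto
    then show ?thesis using True by (simp add: top_unique)
  next
    case False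
    have "Y \<le> (\<integral>\<^sup>+ t. ennreal (real M - 1) * (ennreal ((?q t)\<^sup>2) * indicator {0..} t) \<partial>lborel)"
      unfolding Y_def
    proof (intro nn_integral_mono)
      fix t
      have "(real M - 1) * (?q t)\<^sup>2 * (1 - ?q t) ^ (M - 2) \<le> (real M - 1) * (?q t)\<^sup>2 * 1"
        using M2 tail_nonneg[of t] tail_le_1[of t] by (intro mult_left_mono power_le_one) auto
      then show "ennreal ((real M - 1) * (?q t)\<^sup>2 * (1 - ?q t) ^ (M - 2)) * indicator {0..} t
          \<le> ennreal (real M - 1) * (ennreal ((?q t)\<^sup>2) * indicator {0..} t)"
        using M2 by (auto split: split_indicator intro!: ennreal_leI simp flip: ennreal_mult')
    qed
    also have "\<dots> = ennreal (real M - 1) * (\<integral>\<^sup>+ t. ennreal ((?q t)\<^sup>2) * indicator {0..} t \<partial>lborel)"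
      by (rule nn_integral_cmult) simp
    also have "\<dots> < \<top>" using False by (auto simp: ennreal_mult_less_top less_top)
    finally have Yfin: "Y < \<top>" .
    have "W \<le> top_revenue D + W" by simp
    then have Wfin: "W < \<top>" using WY Yfin by (meson le_less_trans)
    have "X + of_nat n * Y \<le> second_price D M + of_nat n * W"
    proof -
      have "X + of_nat n * Y = (\<integral>\<^sup>+ t. ennreal (1 - (1 - ?q t + (1 - ?q t) ^ (m - 1) * (?q t - ?s t)) ^ n) * indicator {0..} t
          + of_nat n * (ennreal ((real M - 1) * (?q t)\<^sup>2 * (1 - ?q t) ^ (M - 2)) * indicator {0..} t) \<partial>lborel)"
        unfolding X_def Y_def by (simp add: nn_integral_add nn_integral_cmult)
      also have "\<dots> \<le> (\<integral>\<^sup>+ t. ennreal (1 - (1 - ?q t) ^ M - M * ?q t * (1 - ?q t) ^ (M - 1)) * indicator {0..} t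
          + of_nat n * (ennreal (?s t * ((1 - ?q t) ^ (M - 1) + (real M - 1) * ?q t * (1 - ?q t) ^ (M - 2))) * indicator {0..} t) \<partial>lborel)"
      proof (intro nn_integral_mono)
        fix t
        let ?x = "1 - (1 - ?q t + (1 - ?q t) ^ (m - 1) * (?q t - ?s t)) ^ n"
        let ?y = "(real M - 1) * (?q t)\<^sup>2 * (1 - ?q t) ^ (M - 2)"
        let ?z = "1 - (1 - ?q t) ^ M - M * ?q t * (1 - ?q t) ^ (M - 1)"
        let ?w = "?s t * ((1 - ?q t) ^ (M - 1) + (real M - 1) * ?q t * (1 - ?q t) ^ (M - 2))"
        have q: "0 \<le> ?q t" "?q t \<le> 1" "0 \<le> ?s t" "?s t \<le> ?q t"
          using tail_nonneg tail_le_1 virtual_tail_nonneg virtual_tail_le by auto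
        have "?x + n * ?y \<le> ?z + n * ?w"
          using benchmark_polynomial[of "?s t" "?q t" n m M] q nm by (simp add: M_def)
        moreover have "0 \<le> ?x"
        proof -
          have "(1 - ?q t) ^ (m - 1) * (?q t - ?s t) \<le> 1 * ?q t"
            using q by (intro mult_mono power_le_one) auto
          then show ?thesis using q by (auto intro!: power_le_one)
        qed
        moreover have "0 \<le> ?y" "0 \<le> ?w" using q M2 by auto
        moreover have "0 \<le> ?z" using at_least_two_ge[OF q(1,2) M2] zero_le_power2[of "?q t"] by linarith
        ultimately have "ennreal ?x + of_nat n * ennreal ?y \<le> ennreal ?z + of_nat n * ennreal ?w"
          by (simp add: ennreal_of_nat_eq_real_of_nat flip: ennreal_mult' ennreal_plus)
        then show "ennreal ?x * indicator {0..} t + of_nat n * (ennreal ?y * indicator {0..} t)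
            \<le> ennreal ?z * indicator {0..} t + of_nat n * (ennreal ?w * indicator {0..} t)"
          by (auto split: split_indicator)
      qed
      also have "\<dots> = second_price D M + of_nat n * W"
        unfolding second_price_def W_def by (simp add: nn_integral_add nn_integral_cmult)
      finally show ?thesis .
    qed
    moreover have "of_nat n * (top_revenue D + W) \<le> of_nat n * Y"
      using WY by (intro mult_left_mono) auto
    ultimately have "(X + of_nat n * top_revenue D) + of_nat n * W \<le> second_price D M + of_nat n * W"
      by (metis (no_types, lifting) add.assoc add_left_mono distrib_left order_trans)
    moreover have "of_nat n * W \<noteq> \<top>" using Wfin by (simp add: ennreal_mult_eq_top_iff)
    ultimately show ?thesis
      unfolding X_def[symmetric]
      by (simp add: ennreal_add_left_cancel_le add.commute[of _ "of_nat n * W"])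
  qed
qed

end

section \<open>Revenue and virtual values in one dimension\<close>

text \<open>One half of the envelope formula, with no regularity of \<open>u\<close>. The
  subgradient inequalities make \<open>h\<close> monotone and bound its lower sums by u d - u c. On
  a grid of mesh \<open>\<delta>\<close> the upper sum exceeds the lower sum by a telescoping
  \<delta> * (h d - h c), which is at most \<open>\<delta>\<close>.\<close>

lemma monotone_subgradient_integral:
  fixes u h :: "real \<Rightarrow> real"
  assumes cd: "c \<le> d" and [measurable]: "h \<in> borel_measurable borel"
    and h: "\<And>x. 0 \<le> h x" "\<And>x. h x \<le> 1"
    and sub: "\<And>x y. x \<in> {c..d} \<Longrightarrow> y \<in> {c..d} \<Longrightarrow> u y \<ge> u x + (y - x) * h x"
  shows "(LINT x|lborel. h x * indicator {c..d} x) \<le> u d - u c"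
proof -
  have mono: "h x \<le> h y" if "x \<in> {c..d}" "y \<in> {c..d}" "x \<le> y" for x y
  proof (cases "x = y")
    case False
    have "(y - x) * h x \<le> (y - x) * h y"
      using sub[OF that(1,2)] sub[OF that(2,1)] by (simp add: algebra_simps)
    then show ?thesis using False that by simp
  qed simp
  have int: "integrable lborel (\<lambda>x. h x * indicator {a..b} x)" for a b
  proof (rule Bochner_Integration.integrable_bound)
    show "integrable lborel (indicator {a..b} :: real \<Rightarrow> real)"
      by (intro integrable_real_indicator) (auto simp: emeasure_lborel_Icc_eq)
  qed (auto simp: h split: split_indicator)
  have bound: "(LINT x|lborel. h x * indicator {a..b} x) \<le> (b - a) * h b"
    if "a \<in> {c..d}" "b \<in> {c..d}" "a \<le> b" for a b
  proof -
    have "(LINT x|lborel. h x * indicator {a..b} x) \<le> (LINT x|lborel. h b * indicator {a..b} x)"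
      using that mono
      by (intro integral_mono int integrable_mult_right integrable_real_indicator)
         (auto simp: emeasure_lborel_Icc_eq split: split_indicator)
    then show ?thesis using that by (simp add: mult.commute)
  qed
  have "(LINT x|lborel. h x * indicator {c..d} x) \<le> u d - u c + (d - c) / real (Suc n)" for n
  proof -
    define \<delta> where "\<delta> = (d - c) / real (Suc n)"
    define p where "p k = c + real k * \<delta>" for k
    have \<delta>: "0 \<le> \<delta>" using cd by (simp add: \<delta>_def)
    have pd: "p (Suc n) = d" by (simp add: p_def \<delta>_def)
    have pin: "p k \<in> {c..d}" if "k \<le> Suc n" for k
    proof -
      have "real k * \<delta> \<le> real (Suc n) * \<delta>" using that \<delta> by (intro mult_right_mono) auto
      then show ?thesis using \<delta> pd by (simp add: p_def)
    qed
    have "(LINT x|lborel. h x * indicator {c..p k} x) \<le> u (p k) - u c + \<delta> * (h (p k) - h c)"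
      if "k \<le> Suc n" for k
      using that
    proof (induction k)
      case 0
      have "(LINT x|lborel. h x * indicator {c..c} x) \<le> 0" using bound[of c c] cd by simp
      then show ?case by (simp add: p_def)
    next
      case (Suc k)
      have in1: "p k \<in> {c..d}" and in2: "p (Suc k) \<in> {c..d}" and le: "p k \<le> p (Suc k)"
        using pin[of k] pin[of "Suc k"] Suc.prems \<delta> by (auto simp: p_def algebra_simps)
      have "(LINT x|lborel. h x * indicator {c..p (Suc k)} x)
          \<le> (LINT x|lborel. h x * indicator {c..p k} x + h x * indicator {p k..p (Suc k)} x)"
        by (intro integral_mono int Bochner_Integration.integrable_add) (use h in1 le in \<open>auto split: split_indicator\<close>)
      also have "\<dots> = (LINT x|lborel. h x * indicator {c..p k} x)
          + (LINT x|lborel. h x * indicator {p k..p (Suc k)} x)"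
        by (intro Bochner_Integration.integral_add int)
      also have "\<dots> \<le> u (p k) - u c + \<delta> * (h (p k) - h c) + \<delta> * h (p (Suc k))"
        using Suc bound[OF in1 in2 le] by (intro add_mono) (auto simp: p_def algebra_simps)
      also have "\<dots> \<le> u (p (Suc k)) - u c + \<delta> * (h (p (Suc k)) - h c)"
        using sub[OF in1 in2] by (simp add: p_def algebra_simps)
      finally show ?case .
    qed
    from this[of "Suc n"] have "(LINT x|lborel. h x * indicator {c..d} x) \<le> u d - u c + \<delta> * (h d - h c)"
      by (simp add: pd)
    also have "\<delta> * (h d - h c) \<le> \<delta> * 1" using \<delta> h(1)[of c] h(2)[of d] by (intro mult_left_mono) auto
    finally show ?thesis by (simp add: \<delta>_def)
  qed
  moreover have "(\<lambda>n. u d - u c + (d - c) / real (Suc n)) \<longlonglongrightarrow> u d - u c + 0"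
    by (intro tendsto_intros LIMSEQ_Suc lim_const_over_n)
  ultimately show ?thesis by (intro LIMSEQ_le_const[of _ "u d - u c"]) auto
qed

context regular_item
begin

text \<open>The area under \<open>h\<close> is what incentive compatibility leaves to a bidder of type \<open>s\<close>; only
  types in \<open>R\<close> are charged for it.\<close>

lemma revenue_le_virtual_surplus:
  assumes [measurable]: "h \<in> borel_measurable borel" "R \<in> sets borel"
    and h: "\<And>x. 0 \<le> h x" "\<And>x. h x \<le> 1"
    and mono: "\<And>x y. x \<in> I \<Longrightarrow> y \<in> I \<Longrightarrow> x \<le> y \<Longrightarrow> h x \<le> h y"
    and R: "\<And>x y. x \<in> R \<Longrightarrow> x \<le> y \<Longrightarrow> y \<in> R" and T: "0 \<le> T"
  shows "(\<integral>\<^sup>+ s. ennreal (s * h s - (if s \<in> R then LINT z|lborel. (if z \<in> I \<and> z \<in> R \<and> z < s then h z else 0) else 0))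
       * indicator {..<T} s \<partial>D)
    \<le> (\<integral>\<^sup>+ s. ennreal (h s * (if s \<in> R then \<phi> s else s)) \<partial>D) + ennreal (T * tail D T)"
proof -
  define g where "g s = (LINT z|lborel. (if z \<in> I \<and> z \<in> R \<and> z < s then h z else 0))" for s
  have [measurable]: "g \<in> borel_measurable borel" unfolding g_def[abs_def] by measurable
  define E where "E = I \<inter> R \<inter> {..<T}"
  have [measurable]: "E \<in> sets borel" by (simp add: E_def)
  \<comment> \<open>On the types of \<open>R\<close> below \<open>T\<close>, \<open>A\<close> is the
    value sold, \<open>dbl\<close> the area left to the bidder and \<open>G\<close> the rest, while
    \<open>B\<close> is the gap between value and virtual value. The proof combines G + dbl = A, A
    \<le> C + B and B \<le> dbl + T * tail T.\<close>
  define A where "A = (\<integral>\<^sup>+ s. ennreal (s * h s) * indicator E s \<partial>D)"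
  define B where "B = (\<integral>\<^sup>+ z. ennreal (tail D z) * (ennreal (h z) * indicator E z) * indicator I z \<partial>lborel)"
  define C where "C = (\<integral>\<^sup>+ s. ennreal (h s * \<phi> s) * indicator R s \<partial>D)"
  define G where "G = (\<integral>\<^sup>+ s. ennreal (s * h s - g s) * indicator E s \<partial>D)"
  define dbl where "dbl = (\<integral>\<^sup>+ s. (\<integral>\<^sup>+ z. ennreal (h z) * indicator E z * indicator E s * (if z < s then 1 else 0) \<partial>lborel) \<partial>D)"
  have E_int: "(\<integral>\<^sup>+ z. ennreal (h z) * indicator E z \<partial>lborel) \<le> ennreal T"
  proof -
    have "(\<integral>\<^sup>+ z. ennreal (h z) * indicator E z \<partial>lborel) \<le> (\<integral>\<^sup>+ z. indicator {0..T} z \<partial>lborel)"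
      using I_nonneg h(2) by (intro nn_integral_mono) (auto simp: E_def split: split_indicator intro!: ennreal_le_1[THEN iffD2])
    then show ?thesis using T by simp
  qed
  have g_nn: "ennreal (g s) = (\<integral>\<^sup>+ z. ennreal (h z) * indicator E z * (if z < s then 1 else 0) \<partial>lborel)"
    and g_le: "0 \<le> g s" "g s \<le> s * h s" if s: "s \<in> E" for s
  proof -
    have int: "integrable lborel (\<lambda>z. if z \<in> I \<and> z \<in> R \<and> z < s then h z else 0)"
    proof (rule Bochner_Integration.integrable_bound)
      show "integrable lborel (indicator {0..s} :: real \<Rightarrow> real)"
        by (intro integrable_real_indicator) (auto simp: emeasure_lborel_Icc_eq)
    qed (use I_nonneg h in \<open>auto split: split_indicator\<close>)
    have "ennreal (g s) = (\<integral>\<^sup>+ z. ennreal (if z \<in> I \<and> z \<in> R \<and> z < s then h z else 0) \<partial>lborel)"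
      unfolding g_def by (intro nn_integral_eq_integral[symmetric] int AE_I2) (auto simp: h)
    also have "\<dots> = (\<integral>\<^sup>+ z. ennreal (h z) * indicator E z * (if z < s then 1 else 0) \<partial>lborel)"
      using s by (intro nn_integral_cong) (auto simp: E_def split: split_indicator)
    finally show "ennreal (g s) = \<dots>" .
    show "0 \<le> g s" unfolding g_def by (intro integral_nonneg_AE AE_I2) (auto simp: h)
    have "g s \<le> (LINT z|lborel. h s * indicator {0..s} z)"
      unfolding g_def using s I_nonneg mono h
      by (intro integral_mono int integrable_mult_right integrable_real_indicator)
         (auto simp: emeasure_lborel_Icc_eq E_def split: split_indicator)
    then show "g s \<le> s * h s" using s I_nonneg by (auto simp: E_def mult.commute)
  qed
  have GA: "G + dbl = A"
  proof -
    have "dbl = (\<integral>\<^sup>+ s. ennreal (g s) * indicator E s \<partial>D)"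
      unfolding dbl_def
    proof (intro nn_integral_cong)
      fix s
      show "(\<integral>\<^sup>+ z. ennreal (h z) * indicator E z * indicator E s * (if z < s then 1 else 0) \<partial>lborel)
        = ennreal (g s) * indicator E s"
        using g_nn[of s] by (cases "s \<in> E") auto
    qed
    then have "G + dbl = (\<integral>\<^sup>+ s. ennreal (s * h s - g s) * indicator E s + ennreal (g s) * indicator E s \<partial>D)"
      unfolding G_def by (simp add: nn_integral_add)
    also have "\<dots> = A"
      unfolding A_def using g_le by (intro nn_integral_cong) (auto simp flip: ennreal_plus split: split_indicator)
    finally show ?thesis .
  qed
  have AC: "A \<le> C + B"
  proof -
    have "A \<le> (\<integral>\<^sup>+ s. ennreal (h s * \<phi> s) * indicator R s + ennreal (tail D s / f s) * (ennreal (h s) * indicator E s) \<partial>D)"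
      unfolding A_def
    proof (intro nn_integral_mono)
      fix s
      have "ennreal (s * h s) \<le> ennreal (h s * \<phi> s) + ennreal (tail D s / f s) * ennreal (h s)"
      proof -
        have "s * h s = h s * \<phi> s + tail D s / f s * h s" by (simp add: virtual_eq algebra_simps)
        moreover have p: "0 \<le> tail D s / f s * h s" using h tail_nonneg f_nonneg by simp
        ultimately have "ennreal (s * h s) \<le> ennreal (max 0 (h s * \<phi> s) + tail D s / f s * h s)"
          by (intro ennreal_leI) simp
        also have "\<dots> = ennreal (max 0 (h s * \<phi> s)) + ennreal (tail D s / f s * h s)"
          using p by (intro ennreal_plus) auto
        also have "ennreal (tail D s / f s * h s) = ennreal (tail D s / f s) * ennreal (h s)"
          using h by (intro ennreal_mult'') auto
        finally show ?thesis by simp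
      qed
      then show "ennreal (s * h s) * indicator E s
        \<le> ennreal (h s * \<phi> s) * indicator R s + ennreal (tail D s / f s) * (ennreal (h s) * indicator E s)"
        by (auto simp: E_def split: split_indicator)
    qed
    also have "\<dots> = C + B"
      unfolding C_def B_def by (subst nn_integral_add) (auto simp: nn_integral_hazard)
    finally show ?thesis .
  qed
  \<comment> \<open>Exchanging the order of integration, \<open>dbl\<close> weighs h z with the mass
    of the types between z and \<open>T\<close>, whereas \<open>B\<close> weighs it with all types
    above z. The difference is tail T times the area under \<open>h\<close>, which is at most
    \<open>T\<close>.\<close>
  have Bdbl: "B \<le> dbl + ennreal (T * tail D T)"
  proof -
    interpret pair_sigma_finite lborel D ..
    have "dbl = (\<integral>\<^sup>+ z. (\<integral>\<^sup>+ s. ennreal (h z) * indicator E z * indicator E s * (if z < s then 1 else 0) \<partial>D) \<partial>lborel)"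
      unfolding dbl_def by (rule Fubini') measurable
    also have "\<dots> = (\<integral>\<^sup>+ z. ennreal (h z) * indicator E z * emeasure D {z<..<T} \<partial>lborel)"
    proof (intro nn_integral_cong)
      fix z
      \<comment> \<open>A type s of \<open>I\<close> with z < s < T belongs to \<open>E\<close> as
        soon as z does, because \<open>R\<close> is upward closed.\<close>
      have "(\<integral>\<^sup>+ s. ennreal (h z) * indicator E z * indicator E s * (if z < s then 1 else 0) \<partial>D)
          = (\<integral>\<^sup>+ s. ennreal (h z) * indicator E z * indicator {z<..<T} s \<partial>D)"
        using AE_in_I by (intro nn_integral_cong_AE, eventually_elim) (use R in \<open>auto simp: E_def split: split_indicator intro: less_imp_le\<close>)
      then show "(\<integral>\<^sup>+ s. ennreal (h z) * indicator E z * indicator E s * (if z < s then 1 else 0) \<partial>D)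
          = ennreal (h z) * indicator E z * emeasure D {z<..<T}"
        by (simp add: nn_integral_cmult)
    qed
    finally have dbl: "dbl = (\<integral>\<^sup>+ z. ennreal (h z) * indicator E z * emeasure D {z<..<T} \<partial>lborel)" .
    have "B \<le> (\<integral>\<^sup>+ z. ennreal (h z) * indicator E z * emeasure D {z<..<T} + ennreal (tail D T) * (ennreal (h z) * indicator E z) \<partial>lborel)"
      unfolding B_def
    proof (intro nn_integral_mono)
      fix z
      have "ennreal (tail D z) = emeasure D {z<..<T} + emeasure D {T..}" if "z < T"
        unfolding emeasure_tail[symmetric] using that
        by (subst plus_emeasure) (auto intro!: arg_cong[where f="emeasure D"])
      then show "ennreal (tail D z) * (ennreal (h z) * indicator E z) * indicator I z
        \<le> ennreal (h z) * indicator E z * emeasure D {z<..<T} + ennreal (tail D T) * (ennreal (h z) * indicator E z)"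
        by (auto simp: E_def emeasure_Ici algebra_simps split: split_indicator)
    qed
    also have "\<dots> = dbl + ennreal (tail D T) * (\<integral>\<^sup>+ z. ennreal (h z) * indicator E z \<partial>lborel)"
    proof -
      have "(\<lambda>z. emeasure D {z<..<T}) \<in> borel_measurable borel"
      proof -
        have "(\<lambda>z. emeasure D {z<..<T}) = (\<lambda>z. \<integral>\<^sup>+ s. (if z < s \<and> s < T then 1 else 0) \<partial>D)"
        proof
          fix z
          have "emeasure D {z<..<T} = (\<integral>\<^sup>+ s. indicator {z<..<T} s \<partial>D)" by simp
          also have "\<dots> = (\<integral>\<^sup>+ s. (if z < s \<and> s < T then 1 else 0) \<partial>D)"
            by (intro nn_integral_cong) (auto split: split_indicator)
          finally show "emeasure D {z<..<T} = \<dots>" .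
        qed
        also have "\<dots> \<in> borel_measurable borel" by measurable
        finally show ?thesis .
      qed
      then show ?thesis unfolding dbl by (subst nn_integral_add) (auto simp: nn_integral_cmult)
    qed
    also have "\<dots> \<le> dbl + ennreal (tail D T) * ennreal T"
      using E_int by (intro add_mono mult_left_mono) auto
    finally show ?thesis using T by (simp add: ennreal_mult' mult.commute tail_nonneg)
  qed
  \<comment> \<open>The truncation at \<open>T\<close> makes \<open>dbl\<close> finite, which
    permits its cancellation.\<close>
  have dblT: "dbl \<le> ennreal T"
  proof -
    have "dbl \<le> (\<integral>\<^sup>+ s. ennreal T \<partial>D)"
      unfolding dbl_def
    proof (rule nn_integral_mono)
      fix s
      have "(\<integral>\<^sup>+ z. ennreal (h z) * indicator E z * indicator E s * (if z < s then 1 else 0) \<partial>lborel)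
          \<le> (\<integral>\<^sup>+ z. ennreal (h z) * indicator E z \<partial>lborel)"
        by (intro nn_integral_mono) (auto split: split_indicator)
      then show "(\<integral>\<^sup>+ z. ennreal (h z) * indicator E z * indicator E s * (if z < s then 1 else 0) \<partial>lborel) \<le> ennreal T"
        using E_int by (rule order_trans)
    qed
    then show ?thesis using emeasure_space_1 by simp
  qed
  have "G + dbl \<le> C + ennreal (T * tail D T) + dbl"
    using GA AC Bdbl by (metis (no_types, lifting) add.assoc add.commute add_left_mono order_trans)
  then have GC: "G \<le> C + ennreal (T * tail D T)"
    using dblT by (subst (asm) (1 2) add.commute[of _ dbl]) (auto simp: ennreal_add_left_cancel_le top_unique)
  have "(\<integral>\<^sup>+ s. ennreal (s * h s - (if s \<in> R then g s else 0)) * indicator {..<T} s \<partial>D)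
      \<le> (\<integral>\<^sup>+ s. ennreal (s * h s - g s) * indicator E s + ennreal (h s * s) * indicator (- R) s \<partial>D)"
    using AE_in_I by (intro nn_integral_mono_AE, eventually_elim) (auto simp: E_def mult.commute split: split_indicator)
  also have "\<dots> = G + (\<integral>\<^sup>+ s. ennreal (h s * s) * indicator (- R) s \<partial>D)"
    unfolding G_def by (intro nn_integral_add) auto
  also have "\<dots> \<le> C + ennreal (T * tail D T) + (\<integral>\<^sup>+ s. ennreal (h s * s) * indicator (- R) s \<partial>D)"
    using GC by (rule add_right_mono)
  also have "\<dots> = (C + (\<integral>\<^sup>+ s. ennreal (h s * s) * indicator (- R) s \<partial>D)) + ennreal (T * tail D T)"
    by (simp add: ac_simps)
  also have "C + (\<integral>\<^sup>+ s. ennreal (h s * s) * indicator (- R) s \<partial>D)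
      = (\<integral>\<^sup>+ s. ennreal (h s * (if s \<in> R then \<phi> s else s)) \<partial>D)"
    unfolding C_def by (subst nn_integral_add[symmetric]) (auto intro!: nn_integral_cong split: split_indicator)
  finally show ?thesis unfolding g_def .
qed

end

section \<open>The benchmark in the product space\<close>

context regular_item
begin

text \<open>Incentive constraints are imposed on the support, whereas the density arguments live on
  \<open>I\<close>. Without atoms \<open>I\<close> is not a single point, so every neighbourhood of
  x in \<open>I\<close> contains a nondegenerate piece of \<open>I\<close>, on which the density is
  positive.\<close>

lemma I_subset_support: "I \<subseteq> support D"
proof
  fix x assume x: "x \<in> I"
  have "0 < emeasure D U" if U: "open U" "x \<in> U" for U
  proof (rule ccontr)
    assume "\<not> 0 < emeasure D U"
    then have null: "emeasure D U = 0" by simp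
    obtain e where e: "0 < e" "ball x e \<subseteq> U" using U by (meson openE)
    define J where "J = I \<inter> ball x e"
    have J: "is_interval J" unfolding J_def by (intro is_interval_Int I_interval is_interval_ball_real)
    obtain y where y: "y \<in> I" "y \<noteq> x"
    proof (cases "\<exists>y\<in>I. y \<noteq> x")
      case False
      have "AE y in D. y = x" using AE_in_I by eventually_elim (use False in auto)
      then have "AE y in D. y \<in> {x}" by simp
      then have "prob {x} = 1" by (subst (asm) AE_in_set_eq_1) auto
      then show thesis using emeasure_point[of x] by (simp add: emeasure_eq_measure)
    qed auto
    define z where "z = (if x < y then min y (x + e / 2) else max y (x - e / 2))"
    have zJ: "z \<in> I" "z \<in> ball x e" "z \<noteq> x"
      using x y e I_between[of x y z] I_between[of y x z]
      by (auto simp: z_def dist_real_def min_def max_def split: if_splits)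
    define a b where "a = min x z" and "b = max x z"
    have ab: "a < b" "{a..b} \<subseteq> I" "{a..b} \<subseteq> U"
    proof -
      show "a < b" using zJ by (auto simp: a_def b_def)
      have "a \<in> I" "b \<in> I" using x zJ by (auto simp: a_def b_def min_def max_def)
      then show "{a..b} \<subseteq> I" using I_between[of a b] by auto
      have "s \<in> ball x e" if "s \<in> {a..b}" for s
      proof -
        have "\<bar>x - z\<bar> < e" "min x z \<le> s" "s \<le> max x z"
          using zJ(2) that by (simp_all add: a_def b_def dist_real_def)
        then have "\<bar>x - s\<bar> < e" by linarith
        then show ?thesis by (simp add: dist_real_def)
      qed
      then show "{a..b} \<subseteq> U" using e(2) by blast
    qed
    have "emeasure D {a..b} = 0"
      using emeasure_mono[of "{a..b}" U D] null ab(3) borel_open[OF U(1)] by simp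
    then have "(\<integral>\<^sup>+ s. ennreal (f s) * indicator {a..b} s \<partial>lborel) = 0"
      by (subst (asm) D_eq) (simp add: emeasure_density)
    then have "AE s in lborel. ennreal (f s) * indicator {a..b} s = 0"
      by (subst (asm) nn_integral_0_iff_AE) auto
    then have "AE s in lborel. s \<notin> {a..b}"
    proof (rule AE_mp, intro AE_I2 impI notI)
      fix s assume "ennreal (f s) * indicator {a..b} s = 0" "s \<in> {a..b}"
      then have "f s \<le> 0" by (simp add: ennreal_eq_0_iff)
      then show False using f_pos[of s] ab(2) \<open>s \<in> {a..b}\<close> by auto
    qed
    then have "emeasure lborel {a..b} = 0" by (subst (asm) AE_iff_measurable[of "{a..b}"]) auto
    then show False using ab(1) by simp
  qed
  then show "x \<in> support D" by (auto simp: support_def)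
qed

text \<open>The lower end of a set of lucky types may fall outside \<open>I\<close>. It is still a
  legitimate type, being a limit of points of the support.\<close>

lemma Inf_in_support:
  assumes Z: "Z \<subseteq> I" "Z \<noteq> {}"
  shows "Inf Z \<in> support D"
  unfolding support_def
proof (intro CollectI allI impI, elim conjE)
  fix U assume U: "open U" "Inf Z \<in> U"
  then obtain e where e: "0 < e" "ball (Inf Z) e \<subseteq> U" by (meson openE)
  have "bdd_below Z" using Z I_nonneg by (auto intro!: bdd_belowI[of _ 0])
  then obtain z where z: "z \<in> Z" "z < Inf Z + e" using e cInf_lessD[OF Z(2), of "Inf Z + e"] by auto
  moreover have "Inf Z \<le> z" using z \<open>bdd_below Z\<close> by (auto intro: cInf_lower)
  ultimately have "z \<in> U" using e by (auto simp: dist_real_def subset_eq)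
  then show "0 < emeasure D U" using z Z I_subset_support U by (auto simp: support_def)
qed

text \<open>Together with \<open>prob_cdf_ge\<close>: the quantile is uniformly distributed. By
  continuity the sublevel set of the cdf is closed, so it contains its supremum and lies below
  it.\<close>

lemma prob_cdf_le: "prob {x. cdf D x \<le> a} \<le> a" if "0 \<le> a"
proof (cases "a < 1 \<and> {x. cdf D x \<le> a} \<noteq> {}")
  case True
  let ?S = "{x. cdf D x \<le> a}"
  have "eventually (\<lambda>x. a < cdf D x) at_top"
    using True by (intro order_tendstoD(1)[OF cdf_lim_at_top_prob]) auto
  then obtain N where N: "\<And>x. x \<ge> N \<Longrightarrow> a < cdf D x" by (auto simp: eventually_at_top_linorder)
  have bdd: "bdd_above ?S" using N by (intro bdd_aboveI[of _ N]) (metis linorder_le_cases mem_Collect_eq not_le)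
  have "closed ?S"
    by (intro closed_Collect_le continuous_at_imp_continuous_on) (auto simp: isCont_cdf_D)
  then have "Sup ?S \<in> ?S" using True bdd by (intro closed_contains_Sup) auto
  moreover have "prob ?S \<le> prob {..Sup ?S}" using bdd
    by (intro finite_measure_mono) (auto intro: cSup_upper)
  ultimately show ?thesis by (simp add: cdf_def)
next
  case False
  then consider "1 \<le> a" | "{x. cdf D x \<le> a} = {}" by force
  then show ?thesis
  proof cases
    case 1
    then show ?thesis using prob_le_1 by (rule order_trans[rotated])
  qed (use that in simp)
qed

lemma prob_cdf_ge: "a \<le> 1 \<Longrightarrow> a \<le> prob {x. cdf D x \<le> a}"
proof -
  assume a: "a \<le> 1"
  show ?thesis
  proof (cases "0 < a \<and> a < 1")
    case True
    then obtain t where t: "tail D t = 1 - a" using tail_surj[of "1 - a"] by auto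
    then have "cdf D t = a" by (simp add: tail_def)
    moreover have "prob {..t} \<le> prob {x. cdf D x \<le> cdf D t}"
      by (intro finite_measure_mono) (auto intro: cdf_nondecreasing)
    ultimately show ?thesis by (simp add: cdf_def)
  next
    case False
    then consider "a \<le> 0" | "a = 1" using a by force
    then show ?thesis
    proof cases
      case 2
      then have "{x. cdf D x \<le> a} = space D" using cdf_bounded_prob by auto
      then show ?thesis using 2 prob_space by simp
    qed (meson measure_nonneg order_trans)
  qed
qed

text \<open>Requiring a strictly larger quantile removes only a null set, on which the cdf is flat.
  The strictness is what later makes the bidder lucky when all other quantiles are at most that of
  t.\<close>

lemma prob_between:
  "prob {x. t < x \<and> \<phi> x \<le> t \<and> cdf D t < cdf D x} = tail D t - virtual_tail D f t"
proof -
  have "prob {x. t < x \<and> cdf D x \<le> cdf D t} = 0"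
  proof -
    have "{x. cdf D x \<le> cdf D t} = {..t} \<union> {x. t < x \<and> cdf D x \<le> cdf D t}"
      by (auto intro: cdf_nondecreasing)
    then have "prob {x. cdf D x \<le> cdf D t} = prob {..t} + prob {x. t < x \<and> cdf D x \<le> cdf D t}"
      by (subst finite_measure_Union[symmetric]) auto
    then have "prob {x. t < x \<and> cdf D x \<le> cdf D t} \<le> 0"
      using prob_cdf_le[of "cdf D t"] cdf_nonneg[of t] by (simp add: cdf_def)
    then show ?thesis using measure_nonneg by (rule antisym)
  qed
  then have "AE x in D. \<not> (t < x \<and> cdf D x \<le> cdf D t)"
    by (subst AE_iff_measurable[OF _ refl]) (auto simp: emeasure_eq_measure)
  then have "prob {x. t < x \<and> \<phi> x \<le> t \<and> cdf D t < cdf D x} = prob ({t<..} - {x. t < \<phi> x})"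
    by (intro finite_measure_eq_AE) auto
  also have "\<dots> = tail D t - virtual_tail D f t"
    unfolding tail_eq virtual_tail_def using virtual_le
    by (intro finite_measure_Diff) (auto intro: less_le_trans)
  finally show ?thesis .
qed

end

section \<open>Independent items and the score of a bidder\<close>

locale regular_items =
  fixes m :: nat and D :: "nat \<Rightarrow> real measure" and f :: "nat \<Rightarrow> real \<Rightarrow> real" and I :: "nat \<Rightarrow> real set"
  assumes items: "\<And>j. regular_item (D j) (f j) (I j)"
begin

sublocale item: regular_item "D j" "f j" "I j" for j
  by (rule items)

sublocale items: product_sigma_finite D
  by standard

abbreviation "V \<equiv> valuation_dist m D"

sublocale val: prob_space V
  unfolding valuation_dist_def by (rule prob_space_PiM) (rule item.prob_space_axioms)

sublocale bidders: product_sigma_finite "\<lambda>_ :: nat. V"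
  by standard

lemma prob_space_profile_dist: "prob_space (profile_dist m D N)"
  unfolding profile_dist_def by (rule prob_space_PiM) (rule val.prob_space_axioms)

lemma space_V: "space V = {..<m} \<rightarrow>\<^sub>E UNIV"
  by (simp add: valuation_dist_def space_PiM)

lemma component_measurable [measurable (raw)]:
  "g \<in> measurable N V \<Longrightarrow> j < m \<Longrightarrow> (\<lambda>x. g x j) \<in> borel_measurable N"
proof -
  assume g: "g \<in> measurable N V" and "j < m"
  then have "(\<lambda>w. w j) \<in> measurable V (D j)"
    unfolding valuation_dist_def by (intro measurable_component_singleton) simp
  from measurable_compose[OF g this] show ?thesis
    by (simp add: measurable_cong_sets[OF refl item.events_eq_borel])
qed

lemma AE_in_I: "AE w in V. \<forall>j<m. w j \<in> I j"
proof -
  have "AE w in V. \<forall>j\<in>{..<m}. w j \<in> I j"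
    unfolding valuation_dist_def
    by (intro AE_finite_allI AE_PiM_component[where P="\<lambda>x. x \<in> I _"] item.prob_space_axioms item.AE_in_I) auto
  then show ?thesis by eventually_elim auto
qed

text \<open>Strict, so that at most one item below \<open>m\<close> beats all others and only one
  area is subtracted from the payment. At ties no item does, and the score is then the value itself,
  which is never smaller than the virtual value.\<close>

definition beats :: "nat \<Rightarrow> valuation \<Rightarrow> bool" where
  "beats j w \<longleftrightarrow> (\<forall>k\<in>{..<m} - {j}. cdf (D k) (w k) < cdf (D j) (w j))"

text \<open>A bidder contributes her virtual value only for the item in which she is luckiest, in the
  sense of quantiles.\<close>

definition score :: "nat \<Rightarrow> valuation \<Rightarrow> real" where
  "score j w = (if beats j w then virtual_value (D j) (f j) (w j) else w j)"

lemma beats_unique: "beats j w \<Longrightarrow> beats k w \<Longrightarrow> j < m \<Longrightarrow> k < m \<Longrightarrow> j = k"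
  unfolding beats_def by (metis DiffI insertE empty_iff lessThan_iff less_asym)

lemma score_le: "score j w \<le> w j"
  using item.virtual_le by (auto simp: score_def)

lemma beats_measurable [measurable]: "j < m \<Longrightarrow> Measurable.pred V (beats j)"
  unfolding beats_def[abs_def] by measurable

lemma score_measurable [measurable]: "j < m \<Longrightarrow> score j \<in> borel_measurable V"
  unfolding score_def[abs_def] by measurable

text \<open>There are two disjoint ways to score at most t. In \<open>A\<close> the value is at most
  t. In \<open>B\<close> the value exceeds t but the virtual value does not, and every other
  quantile is at most that of t, so the bidder is lucky. Each of the m - 1 other items satisfies
  this with probability at least cdf (D j) t, independently.\<close>

lemma prob_score_le:
  assumes j: "j < m"
  defines "q \<equiv> tail (D j)" and "s \<equiv> virtual_tail (D j) (f j)"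
  shows "1 - q t + (1 - q t) ^ (m - 1) * (q t - s t) \<le> val.prob {w \<in> space V. score j w \<le> t}"
proof -
  let ?a = "cdf (D j) t"
  define A where "A = Pi\<^sub>E {..<m} (\<lambda>k. if k = j then {..t} else UNIV)"
  define S where "S k = (if k = j then {x. t < x \<and> virtual_value (D j) (f j) x \<le> t \<and> ?a < cdf (D j) x}
     else {x. cdf (D k) x \<le> ?a})" for k
  define B where "B = Pi\<^sub>E {..<m} S"
  have S [measurable]: "S k \<in> sets borel" for k by (auto simp: S_def)
  have sA: "A \<in> sets V" and sB: "B \<in> sets V"
    unfolding A_def B_def valuation_dist_def by (intro sets_PiM_I_finite; simp)+
  have "emeasure V A = (\<Prod>k<m. emeasure (D k) (if k = j then {..t} else UNIV))"
    unfolding A_def valuation_dist_def by (rule items.emeasure_PiM) auto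
  also have "\<dots> = (\<Prod>k<m. if k = j then ennreal ?a else 1)"
    using item.emeasure_space_1 by (intro prod.cong) (auto simp: cdf_def item.emeasure_eq_measure)
  also have "\<dots> = ennreal ?a" using j by simp
  finally have eA: "val.prob A = ?a" by (simp add: val.emeasure_eq_measure item.cdf_nonneg)
  have "emeasure V B = (\<Prod>k<m. emeasure (D k) (S k))"
    unfolding B_def valuation_dist_def by (rule items.emeasure_PiM) auto
  also have "\<dots> = emeasure (D j) (S j) * (\<Prod>k\<in>{..<m} - {j}. emeasure (D k) (S k))"
    using j by (intro prod.remove) auto
  finally have B_prod: "emeasure V B = \<dots>" .
  have "ennreal (q t - s t) \<le> emeasure (D j) (S j)"
    using item.prob_between[of j t] by (simp add: item.emeasure_eq_measure q_def s_def S_def)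
  moreover have "(\<Prod>k\<in>{..<m} - {j}. ennreal ?a) \<le> (\<Prod>k\<in>{..<m} - {j}. emeasure (D k) (S k))"
  proof -
    have "?a \<le> measure (D k) (S k)" if "k \<in> {..<m} - {j}" for k
      using that item.prob_cdf_ge[of ?a k] item.cdf_bounded_prob by (auto simp: S_def)
    then have "(\<Prod>k\<in>{..<m} - {j}. ?a) \<le> (\<Prod>k\<in>{..<m} - {j}. measure (D k) (S k))"
      by (intro prod_mono) (auto simp: item.cdf_nonneg)
    then show ?thesis
      unfolding item.emeasure_eq_measure
      by (subst (1 2) prod_ennreal) (auto simp: item.cdf_nonneg intro: ennreal_leI)
  qed
  ultimately have "ennreal (q t - s t) * (\<Prod>k\<in>{..<m} - {j}. ennreal ?a) \<le> emeasure V B"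
    unfolding B_prod by (rule mult_mono) auto
  then have "ennreal ((q t - s t) * ?a ^ (m - 1)) \<le> emeasure V B"
    using j item.virtual_tail_le item.cdf_nonneg
    by (simp add: q_def s_def ennreal_mult' ennreal_power)
  then have eB: "(q t - s t) * ?a ^ (m - 1) \<le> val.prob B"
    by (simp add: val.emeasure_eq_measure)
  have "A \<inter> B = {}" using j by (force simp: A_def B_def S_def PiE_iff)
  then have "val.prob A + val.prob B = val.prob (A \<union> B)"
    using sA sB by (simp add: val.finite_measure_Union)
  also have "\<dots> \<le> val.prob {w \<in> space V. score j w \<le> t}"
  proof (rule val.finite_measure_mono)
    show "A \<union> B \<subseteq> {w \<in> space V. score j w \<le> t}"
    proof
      fix w assume w: "w \<in> A \<union> B"
      then have "w \<in> space V" using sets.sets_into_space[OF sA] sets.sets_into_space[OF sB] by auto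
      moreover have "score j w \<le> t"
      proof (cases "w \<in> A")
        case True
        then have "w j \<le> t" using j by (auto simp: A_def PiE_iff split: if_splits)
        then show ?thesis using score_le[of j w] by simp
      next
        case False
        then have wB: "w k \<in> S k" if "k < m" for k using w that by (auto simp: B_def PiE_iff)
        have "cdf (D k) (w k) < cdf (D j) (w j)" if "k < m" "k \<noteq> j" for k
          using wB[OF j] wB[OF that(1)] that(2) by (auto simp: S_def)
        then have "beats j w" by (auto simp: beats_def)
        then show ?thesis using wB[OF j] by (auto simp: score_def S_def)
      qed
      ultimately show "w \<in> {w \<in> space V. score j w \<le> t}" by simp
    qed
  qed (use j in measurable)
  finally show ?thesis using eA eB by (simp add: q_def s_def tail_def mult.commute)
qed

lemma nn_integral_max_score:
  assumes j: "j < m" and n: "1 \<le> n"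
  shows "(\<integral>\<^sup>+ b. ennreal (Max ((\<lambda>i. score j (b i)) ` {..<n})) \<partial>profile_dist m D {..<n})
    + of_nat n * top_revenue (D j) \<le> second_price (D j) (2 * n + 2 * m - 2)"
proof -
  let ?P = "profile_dist m D {..<n}"
  let ?g = "\<lambda>b :: profile. Max ((\<lambda>i. score j (b i)) ` {..<n})"
  interpret P: prob_space ?P by (rule prob_space_profile_dist)
  have g [measurable]: "?g \<in> borel_measurable ?P"
    unfolding profile_dist_def by (use j in measurable)
  have "(\<integral>\<^sup>+ b. ennreal (?g b) \<partial>?P) = (\<integral>\<^sup>+ t. emeasure ?P {b \<in> space ?P. t < ?g b} * indicator {0..} t \<partial>lborel)"
    using nn_integral_layer_cake[OF P.sigma_finite_measure_axioms g, of 0] by simp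
  also have "\<dots> \<le> (\<integral>\<^sup>+ t. ennreal (1 - (1 - tail (D j) t + (1 - tail (D j) t) ^ (m - 1)
      * (tail (D j) t - virtual_tail (D j) (f j) t)) ^ n) * indicator {0..} t \<partial>lborel)"
  proof (intro nn_integral_mono mult_right_mono)
    fix t
    let ?x = "1 - tail (D j) t + (1 - tail (D j) t) ^ (m - 1) * (tail (D j) t - virtual_tail (D j) (f j) t)"
    define L where "L = {w \<in> space V. score j w \<le> t}"
    have L: "L \<in> sets V" unfolding L_def by (use j in measurable)
    have x: "0 \<le> ?x" "?x \<le> val.prob L"
      using prob_score_le[OF j, of t] item.tail_le_1[of j t] item.virtual_tail_le[of j t] by (auto simp: L_def)
    have LP: "Pi\<^sub>E {..<n} (\<lambda>_. L) \<in> sets ?P"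
      unfolding profile_dist_def using L by (intro sets_PiM_I_finite) auto
    have "emeasure ?P (Pi\<^sub>E {..<n} (\<lambda>_. L)) = (\<Prod>i<n. emeasure V L)"
      unfolding profile_dist_def using L by (intro bidders.emeasure_PiM) auto
    then have "P.prob (Pi\<^sub>E {..<n} (\<lambda>_. L)) = val.prob L ^ n"
      by (simp add: P.emeasure_eq_measure val.emeasure_eq_measure ennreal_power)
    moreover have "{b \<in> space ?P. t < ?g b} = space ?P - Pi\<^sub>E {..<n} (\<lambda>_. L)"
    proof -
      have e1: "t < ?g b \<longleftrightarrow> (\<exists>i<n. t < score j (b i))" for b :: profile
        using n by (subst Max_gr_iff) (auto simp: lessThan_empty_iff)
      have e2: "b \<in> Pi\<^sub>E {..<n} (\<lambda>_. L) \<longleftrightarrow> (\<forall>i<n. score j (b i) \<le> t)" if "b \<in> space ?P" for b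
        using that by (auto simp: profile_dist_def space_PiM L_def PiE_iff)
      show ?thesis
      proof (rule set_eqI)
        fix b
        show "b \<in> {b \<in> space ?P. t < ?g b} \<longleftrightarrow> b \<in> space ?P - Pi\<^sub>E {..<n} (\<lambda>_. L)"
          using e1[of b] e2[of b] by (cases "b \<in> space ?P") (simp_all add: not_le)
      qed
    qed
    ultimately have "P.prob {b \<in> space ?P. t < ?g b} = 1 - val.prob L ^ n"
      using P.prob_compl[OF LP] by simp
    also have "\<dots> \<le> 1 - ?x ^ n" using x by (intro diff_left_mono power_mono) auto
    finally show "emeasure ?P {b \<in> space ?P. t < ?g b} \<le> ennreal (1 - ?x ^ n)"
      by (simp add: P.emeasure_eq_measure ennreal_leI)
  qed auto
  finally show ?thesis
    using order_trans[OF add_right_mono item.benchmark_le_second_price[of n m j]] n j by simp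
qed

end

section \<open>Revenue of incentive compatible mechanisms\<close>

locale auction = regular_items +
  fixes n :: nat and M :: mechanism
  assumes mech: "is_mechanism m D n M" and bic: "BIC m D n M" and bir: "BIR m D n M"
begin

abbreviation "S \<equiv> seed M"
abbreviation "P \<equiv> profile_dist m D {..<n}"
abbreviation "P' i \<equiv> profile_dist m D ({..<n} - {i})"

sublocale S: real_distribution S
  using mech by (simp add: is_mechanism_def)

sublocale P: prob_space P
  by (rule prob_space_profile_dist)

sublocale P': prob_space "P' i" for i
  by (rule prob_space_profile_dist)

sublocale SP: pair_prob_space S P ..

sublocale SP': pair_prob_space S "P' i" for i ..

lemma upd_measurable:
  "i < n \<Longrightarrow> (\<lambda>p. (fst (snd p), (snd (snd p))(i := fst p))) \<in> measurable (V \<Otimes>\<^sub>M (S \<Otimes>\<^sub>M P' i)) (S \<Otimes>\<^sub>M P)"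
proof (rule measurable_Pair)
  assume i: "i < n"
  have "(\<lambda>(f, y). f(i := y)) \<in> measurable (P' i \<Otimes>\<^sub>M V) (Pi\<^sub>M (insert i ({..<n} - {i})) (\<lambda>_. V))"
    unfolding profile_dist_def by (rule measurable_add_dim)
  moreover have "insert i ({..<n} - {i}) = {..<n}" using i by auto
  ultimately have "(\<lambda>(f, y). f(i := y)) \<in> measurable (P' i \<Otimes>\<^sub>M V) P"
    by (simp add: profile_dist_def)
  then have "(\<lambda>p. (\<lambda>(f, y). f(i := y)) (snd (snd p), fst p)) \<in> measurable (V \<Otimes>\<^sub>M (S \<Otimes>\<^sub>M P' i)) P"
    by (rule measurable_compose[rotated]) measurable
  then show "(\<lambda>p. (snd (snd p))(i := fst p)) \<in> measurable (V \<Otimes>\<^sub>M (S \<Otimes>\<^sub>M P' i)) P" by simp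
qed measurable

lemma upd_measurable_fixed:
  assumes "i < n" "w \<in> space V"
  shows "(\<lambda>x. (fst x, (snd x)(i := w))) \<in> measurable (S \<Otimes>\<^sub>M P' i) (S \<Otimes>\<^sub>M P)"
  using measurable_compose[OF measurable_Pair1'[OF assms(2)] upd_measurable[OF assms(1)]] by simp

lemma upd_space: "i < n \<Longrightarrow> w \<in> space V \<Longrightarrow> b \<in> space (P' i) \<Longrightarrow> b(i := w) \<in> space P"
  by (auto simp: profile_dist_def space_PiM PiE_iff extensional_def)

lemma nn_integral_split_bidder:
  assumes i: "i < n" and G [measurable]: "G \<in> borel_measurable (S \<Otimes>\<^sub>M P)"
  shows "(\<integral>\<^sup>+ x. G x \<partial>(S \<Otimes>\<^sub>M P)) = (\<integral>\<^sup>+ w. (\<integral>\<^sup>+ x. G (fst x, (snd x)(i := w)) \<partial>(S \<Otimes>\<^sub>M P' i)) \<partial>V)"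
proof -
  note upd_measurable[OF i, measurable]
  interpret SV: pair_sigma_finite S V ..
  have ins: "insert i ({..<n} - {i}) = {..<n}" using i by auto
  have "(\<integral>\<^sup>+ x. G x \<partial>(S \<Otimes>\<^sub>M P)) = (\<integral>\<^sup>+ r. (\<integral>\<^sup>+ b. G (r, b) \<partial>P) \<partial>S)"
    by (rule P.nn_integral_fst[symmetric]) (rule G)
  also have "\<dots> = (\<integral>\<^sup>+ r. (\<integral>\<^sup>+ w. (\<integral>\<^sup>+ b. G (r, b(i := w)) \<partial>P' i) \<partial>V) \<partial>S)"
  proof (intro nn_integral_cong)
    fix r assume "r \<in> space S"
    then have "(\<lambda>b. G (r, b)) \<in> borel_measurable P" by measurable
    then show "(\<integral>\<^sup>+ b. G (r, b) \<partial>P) = (\<integral>\<^sup>+ w. (\<integral>\<^sup>+ b. G (r, b(i := w)) \<partial>P' i) \<partial>V)"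
      using bidders.product_nn_integral_insert_rev[of "{..<n} - {i}" i "\<lambda>b. G (r, b)"]
      unfolding profile_dist_def ins by simp
  qed
  also have "\<dots> = (\<integral>\<^sup>+ w. (\<integral>\<^sup>+ r. (\<integral>\<^sup>+ b. G (r, b(i := w)) \<partial>P' i) \<partial>S) \<partial>V)"
  proof (rule SV.Fubini'[symmetric])
    have "(\<lambda>q. G ((\<lambda>p. (fst (snd p), (snd (snd p))(i := fst p))) (snd (fst q), (fst (fst q), snd q))))
        \<in> borel_measurable ((S \<Otimes>\<^sub>M V) \<Otimes>\<^sub>M P' i)" by measurable
    then show "(\<lambda>(r, w). \<integral>\<^sup>+ b. G (r, b(i := w)) \<partial>P' i) \<in> borel_measurable (S \<Otimes>\<^sub>M V)"
      by (auto simp: case_prod_beta' intro!: P'.borel_measurable_nn_integral)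
  qed
  also have "\<dots> = (\<integral>\<^sup>+ w. (\<integral>\<^sup>+ x. G (fst x, (snd x)(i := w)) \<partial>(S \<Otimes>\<^sub>M P' i)) \<partial>V)"
  proof (intro nn_integral_cong)
    fix w assume "w \<in> space V"
    then have "(\<lambda>x. G (fst x, (snd x)(i := w))) \<in> borel_measurable (S \<Otimes>\<^sub>M P' i)"
      using measurable_compose[OF upd_measurable_fixed[OF i] G] by simp
    then show "(\<integral>\<^sup>+ r. (\<integral>\<^sup>+ b. G (r, b(i := w)) \<partial>P' i) \<partial>S)
        = (\<integral>\<^sup>+ x. G (fst x, (snd x)(i := w)) \<partial>(S \<Otimes>\<^sub>M P' i))"
      using P'.nn_integral_fst[of "\<lambda>x. G (fst x, (snd x)(i := w))" S i] by simp
  qed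
  finally show ?thesis .
qed

lemma bidder_measurable: "i < n \<Longrightarrow> (\<lambda>b. b i) \<in> measurable P V"
  unfolding profile_dist_def by (intro measurable_component_singleton) simp

definition won :: "nat \<Rightarrow> nat \<Rightarrow> (real \<times> profile) set" where
  "won i j = {x \<in> space (S \<Otimes>\<^sub>M P). j \<in> alloc M (fst x) (snd x) i}"

definition win :: "nat \<Rightarrow> nat \<Rightarrow> valuation \<Rightarrow> real" where
  "win i j w = enn2real (\<integral>\<^sup>+ x. indicator (won i j) (fst x, (snd x)(i := w)) \<partial>(S \<Otimes>\<^sub>M P' i))"

definition paid :: "nat \<Rightarrow> valuation \<Rightarrow> real" where
  "paid i w = (LINT x|(S \<Otimes>\<^sub>M P' i). pay M (fst x) ((snd x)(i := w)) i)"

lemma won_sets [measurable]: "i < n \<Longrightarrow> j < m \<Longrightarrow> won i j \<in> sets (S \<Otimes>\<^sub>M P)"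
  using mech by (auto simp: is_mechanism_def won_def case_prod_beta' split_beta')

lemma pay_measurable: "i < n \<Longrightarrow> (\<lambda>x. pay M (fst x) (snd x) i) \<in> borel_measurable (S \<Otimes>\<^sub>M P)"
  using mech by (auto simp: is_mechanism_def case_prod_beta')

lemma alloc_allocations: "b \<in> space P \<Longrightarrow> alloc M r b \<in> allocations m {..<n}"
  using mech by (auto simp: is_mechanism_def)

lemma win_nonneg: "0 \<le> win i j w"
  by (simp add: win_def)

lemma win_nn: "ennreal (win i j w) = (\<integral>\<^sup>+ x. indicator (won i j) (fst x, (snd x)(i := w)) \<partial>(S \<Otimes>\<^sub>M P' i))"
  and win_le_1: "win i j w \<le> 1"
proof -
  have le: "(\<integral>\<^sup>+ x. indicator (won i j) (fst x, (snd x)(i := w)) \<partial>(S \<Otimes>\<^sub>M P' i)) \<le> 1"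
  proof -
    have "(\<integral>\<^sup>+ x. indicator (won i j) (fst x, (snd x)(i := w)) \<partial>(S \<Otimes>\<^sub>M P' i)) \<le> (\<integral>\<^sup>+ x. 1 \<partial>(S \<Otimes>\<^sub>M P' i))"
      by (intro nn_integral_mono) (auto split: split_indicator)
    then show ?thesis by (simp add: SP'.emeasure_space_1)
  qed
  then show "ennreal (win i j w) = (\<integral>\<^sup>+ x. indicator (won i j) (fst x, (snd x)(i := w)) \<partial>(S \<Otimes>\<^sub>M P' i))"
    unfolding win_def by (intro ennreal_enn2real) (auto simp: le_less_trans)
  then show "win i j w \<le> 1" using le by (metis ennreal_le_1)
qed

lemma win_measurable [measurable]: "i < n \<Longrightarrow> j < m \<Longrightarrow> win i j \<in> borel_measurable V"
proof -
  assume ij: "i < n" "j < m"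
  note upd_measurable[OF ij(1), measurable] won_sets[OF ij, measurable]
  have "(\<lambda>p. indicator (won i j) ((\<lambda>p. (fst (snd p), (snd (snd p))(i := fst p))) p) :: ennreal)
      \<in> borel_measurable (V \<Otimes>\<^sub>M (S \<Otimes>\<^sub>M P' i))" by measurable
  then show ?thesis unfolding win_def[abs_def]
    by (intro borel_measurable_enn2real SP'.borel_measurable_nn_integral) (simp add: case_prod_beta')
qed

lemma types_space: "w \<in> types m D \<Longrightarrow> w \<in> space V"
  by (auto simp: types_def space_V PiE_iff)

lemma types_upd: "w \<in> types m D \<Longrightarrow> j < m \<Longrightarrow> s \<in> support (D j) \<Longrightarrow> w(j := s) \<in> types m D"
  by (auto simp: types_def PiE_iff extensional_def)

lemma AE_types: "AE w in V. w \<in> types m D"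
  using AE_in_I AE_space
  by eventually_elim (use item.I_subset_support in \<open>auto simp: types_def space_V PiE_iff\<close>)

lemma expected_utility_eq:
  assumes i: "i < n" and w: "w \<in> types m D"
  shows "expected_utility m D n M i v w = (\<Sum>j<m. v j * win i j w) - paid i w"
proof -
  note w' = types_space[OF w]
  have ip: "integrable (S \<Otimes>\<^sub>M P' i) (\<lambda>x. pay M (fst x) ((snd x)(i := w)) i)"
    using mech i w by (auto simp: is_mechanism_def case_prod_beta')
  have iw: "integrable (S \<Otimes>\<^sub>M P' i) (\<lambda>x. indicator (won i j) (fst x, (snd x)(i := w)) :: real)" if "j < m" for j
    using that measurable_compose[OF upd_measurable_fixed[OF i w'] borel_measurable_indicator[OF won_sets[OF i]]]
    by (intro SP'.integrable_const_bound[where B=1]) (auto split: split_indicator)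
  have win: "(LINT x|(S \<Otimes>\<^sub>M P' i). indicator (won i j) (fst x, (snd x)(i := w))) = win i j w" if "j < m" for j
    using iw[OF that] unfolding win_def
    by (subst integral_eq_nn_integral) (auto intro!: arg_cong[where f=enn2real] nn_integral_cong split: split_indicator)
  have "expected_utility m D n M i v w = (LINT x|(S \<Otimes>\<^sub>M P' i).
      (\<Sum>j<m. v j * indicator (won i j) (fst x, (snd x)(i := w))) - pay M (fst x) ((snd x)(i := w)) i)"
    unfolding expected_utility_def
  proof (rule Bochner_Integration.integral_cong[OF refl])
    fix x assume "x \<in> space (S \<Otimes>\<^sub>M P' i)"
    moreover obtain r b where rb: "x = (r, b)" by (cases x)
    ultimately have x: "(r, b) \<in> space (S \<Otimes>\<^sub>M P' i)" by simp
    then have b: "b(i := w) \<in> space P" using upd_space[OF i w'] by (auto simp: space_pair_measure)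
    then have sub: "alloc M r (b(i := w)) i \<subseteq> {..<m}"
      using alloc_allocations[OF b, of r] i by (auto simp: allocations_def PiE_iff)
    have "value_of v (alloc M r (b(i := w)) i) = (\<Sum>j<m. if j \<in> alloc M r (b(i := w)) i then v j else 0)"
      unfolding value_of_def using sub by (subst sum.inter_restrict[symmetric]) (auto simp: Int_absorb1)
    also have "\<dots> = (\<Sum>j<m. v j * indicator (won i j) (r, b(i := w)))"
      using b by (intro sum.cong) (auto simp: won_def space_pair_measure split: split_indicator)
    finally show "(case x of (r, b) \<Rightarrow> value_of v (alloc M r (b(i := w)) i) - pay M r (b(i := w)) i)
        = (\<Sum>j<m. v j * indicator (won i j) (fst x, (snd x)(i := w))) - pay M (fst x) ((snd x)(i := w)) i"
      by (simp add: rb)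
  qed
  also have "\<dots> = (LINT x|(S \<Otimes>\<^sub>M P' i). (\<Sum>j<m. v j * indicator (won i j) (fst x, (snd x)(i := w)))) - paid i w"
    unfolding paid_def
    by (intro Bochner_Integration.integral_diff ip Bochner_Integration.integrable_sum integrable_mult_right iw) simp
  also have "(LINT x|(S \<Otimes>\<^sub>M P' i). (\<Sum>j<m. v j * indicator (won i j) (fst x, (snd x)(i := w)))) = (\<Sum>j<m. v j * win i j w)"
    using iw win by (subst Bochner_Integration.integral_sum) auto
  finally show ?thesis .
qed

section \<open>Rents forced by incentive compatibility\<close>

definition utility :: "nat \<Rightarrow> valuation \<Rightarrow> real" where
  "utility i w = (\<Sum>j<m. w j * win i j w) - paid i w"

lemma utility_nonneg: "i < n \<Longrightarrow> w \<in> types m D \<Longrightarrow> 0 \<le> utility i w"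
  using bir expected_utility_eq[of i w w] unfolding BIR_def utility_def by metis

text \<open>The report w(j := x) offers the type w(j := y) a utility that is affine in y with slope
  \<open>win\<close>; truth-telling is at least as good.\<close>

lemma utility_subgradient:
  assumes i: "i < n" and j: "j < m" and w: "w(j := x) \<in> types m D" "w(j := y) \<in> types m D"
  shows "utility i (w(j := x)) + (y - x) * win i j (w(j := x)) \<le> utility i (w(j := y))"
proof -
  let ?x = "w(j := x)" and ?y = "w(j := y)"
  have "(\<Sum>k<m. ?y k * win i k ?x) = (\<Sum>k<m. ?x k * win i k ?x + (if k = j then (y - x) * win i j ?x else 0))"
    by (intro sum.cong) (auto simp: algebra_simps)
  also have "\<dots> = (\<Sum>k<m. ?x k * win i k ?x) + (y - x) * win i j ?x"
    using j by (simp add: sum.distrib)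
  finally show ?thesis
    using bic i w expected_utility_eq[OF i w(1), of ?y] expected_utility_eq[OF i w(2), of ?y]
    by (force simp: BIC_def utility_def)
qed

text \<open>The rent collected on the way up to w through the lucky types that differ from w only in
  item j.\<close>

definition area :: "nat \<Rightarrow> nat \<Rightarrow> valuation \<Rightarrow> real" where
  "area i j w = (LINT z|lborel. (if z \<in> I j \<and> beats j (w(j := z)) \<and> z < w j then win i j (w(j := z)) else 0))"

text \<open>The share of item j in an upper bound on the payment. The utility is bounded below along
  one coordinate direction only, so just the lucky item deducts its area.\<close>

definition charge :: "nat \<Rightarrow> nat \<Rightarrow> valuation \<Rightarrow> real" where
  "charge i j w = w j * win i j w - (if beats j w then area i j w else 0)"

lemma upd_item_measurable: "j < m \<Longrightarrow> (\<lambda>p. (fst p)(j := snd p)) \<in> measurable (V \<Otimes>\<^sub>M borel) V"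
proof -
  assume j: "j < m"
  have ins: "insert j {..<m} = {..<m}" using j by auto
  have "(\<lambda>(f, y). f(j := y)) \<in> measurable (V \<Otimes>\<^sub>M D j) (Pi\<^sub>M (insert j {..<m}) D)"
    unfolding valuation_dist_def by (rule measurable_add_dim)
  then have "(\<lambda>(f, y). f(j := y)) \<in> measurable (V \<Otimes>\<^sub>M D j) V"
    unfolding ins valuation_dist_def .
  then show ?thesis
    by (simp add: case_prod_beta' measurable_cong_sets[OF sets_pair_measure_cong[OF refl item.events_eq_borel] refl])
qed

lemma upd_item_measurable_fixed:
  assumes "j < m" "w \<in> space V"
  shows "(\<lambda>s. w(j := s)) \<in> measurable borel V"
  using measurable_compose[OF measurable_Pair1'[OF assms(2)] upd_item_measurable[OF assms(1)]] by simp

lemma charge_measurable [measurable]: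
  assumes i: "i < n" and j: "j < m"
  shows "charge i j \<in> borel_measurable V"
proof -
  note upd_item_measurable[OF j, measurable] win_measurable[OF i j, measurable] beats_measurable[OF j, measurable]
  note [measurable] = j
  have 1: "(\<lambda>p. win i j ((fst p)(j := snd p))) \<in> borel_measurable (V \<Otimes>\<^sub>M borel)" by measurable
  have 2: "Measurable.pred (V \<Otimes>\<^sub>M borel) (\<lambda>p. beats j ((fst p)(j := snd p)))" by measurable
  have 3: "Measurable.pred (V \<Otimes>\<^sub>M borel) (\<lambda>p. snd p < fst p j)" using j by measurable
  have 4: "Measurable.pred (V \<Otimes>\<^sub>M borel) (\<lambda>p. snd p \<in> I j)" by measurable
  have "(\<lambda>p. if snd p \<in> I j \<and> beats j ((fst p)(j := snd p)) \<and> snd p < fst p j then win i j ((fst p)(j := snd p)) else 0)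
      \<in> borel_measurable (V \<Otimes>\<^sub>M borel)"
    using 1 2 3 4 by (intro measurable_If pred_intros_logic) auto
  then have "(\<lambda>p. if snd p \<in> I j \<and> beats j ((fst p)(j := snd p)) \<and> snd p < fst p j then win i j ((fst p)(j := snd p)) else 0)
      \<in> borel_measurable (V \<Otimes>\<^sub>M lborel)"
    by (simp add: measurable_cong_sets[OF sets_pair_measure_cong[OF refl sets_lborel] refl])
  then have "area i j \<in> borel_measurable V"
    unfolding area_def[abs_def] by (intro lborel.borel_measurable_lebesgue_integral) (simp add: case_prod_beta')
  then show ?thesis unfolding charge_def[abs_def] by measurable
qed

lemma win_mono:
  assumes i: "i < n" and j: "j < m" and w: "w(j := x) \<in> types m D" "w(j := y) \<in> types m D" and xy: "x \<le> y"
  shows "win i j (w(j := x)) \<le> win i j (w(j := y))"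
proof (cases "x = y")
  case False
  have "(y - x) * win i j (w(j := x)) \<le> (y - x) * win i j (w(j := y))"
    using utility_subgradient[OF i j w] utility_subgradient[OF i j w(2,1)] by (simp add: algebra_simps)
  then show ?thesis using False xy by simp
qed simp

text \<open>The envelope inequality is applied from c, the infimum of the lucky types below w j, up
  to w j. All points of this segment lie in the support, c included, so incentive constraints hold
  along it, and individual rationality makes the utility at c nonnegative.\<close>

lemma area_le_utility:
  assumes i: "i < n" and j: "j < m" and w: "w \<in> types m D" "w j \<in> I j"
  shows "area i j w \<le> utility i w"
proof -
  define Z where "Z = {z \<in> I j. beats j (w(j := z)) \<and> z < w j}"
  have w': "w \<in> space V" using w types_space by auto
  note m1 = upd_item_measurable_fixed[OF j w']
  have p: "Measurable.pred borel (\<lambda>z. beats j (w(j := z)))"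
    by (rule measurable_compose[OF m1 beats_measurable[OF j]])
  have "Measurable.pred borel (\<lambda>z. z \<in> I j \<and> beats j (w(j := z)) \<and> z < w j)"
    by (intro pred_intros_logic p) auto
  then have mm: "(\<lambda>z. if z \<in> I j \<and> beats j (w(j := z)) \<and> z < w j then win i j (w(j := z)) else 0) \<in> borel_measurable borel"
    by (intro measurable_If measurable_compose[OF m1 win_measurable[OF i j]]) (auto simp: pred_def)
  show ?thesis
  proof (cases "Z = {}")
    case True
    then have "(\<lambda>z. if z \<in> I j \<and> beats j (w(j := z)) \<and> z < w j then win i j (w(j := z)) else 0) = (\<lambda>z. 0)"
      by (auto simp: Z_def fun_eq_iff)
    then have "area i j w = 0" unfolding area_def by simp
    then show ?thesis using utility_nonneg[OF i w(1)] by simp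
  next
    case False
    define c where "c = Inf Z"
    have ZI: "Z \<subseteq> I j" by (auto simp: Z_def)
    have bdd: "bdd_below Z" using ZI item.I_nonneg by (auto intro!: bdd_belowI[of _ 0])
    have cs: "c \<in> support (D j)" unfolding c_def by (rule item.Inf_in_support[OF ZI False])
    have cw: "c \<le> w j"
    proof -
      obtain z where "z \<in> Z" using False by auto
      then have "Inf Z \<le> z" "z < w j" using bdd by (auto intro: cInf_lower simp: Z_def)
      then show ?thesis by (simp add: c_def)
    qed
    have sup: "x \<in> support (D j)" if x: "x \<in> {c..w j}" for x
    proof (cases "x = c")
      case False
      then obtain z where "z \<in> Z" "z < x"
        using x cInf_lessD[OF \<open>Z \<noteq> {}\<close>, of x] by (auto simp: c_def)
      then have "x \<in> I j" using x w item.I_between[of z j "w j" x] by (auto simp: Z_def)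
      then show ?thesis using item.I_subset_support by auto
    qed (simp add: cs)
    have ty: "w(j := x) \<in> types m D" if "x \<in> {c..w j}" for x
      by (rule types_upd[OF w(1) j sup[OF that]])
    have "area i j w \<le> (LINT x|lborel. win i j (w(j := x)) * indicator {c..w j} x)"
      unfolding area_def
    proof (rule integral_mono_AE)
      have "integrable lborel (indicator {c..w j} :: real \<Rightarrow> real)"
        by (intro integrable_real_indicator) (auto simp: emeasure_lborel_Icc_eq)
      then show "integrable lborel (\<lambda>x. win i j (w(j := x)) * indicator {c..w j} x)"
      proof (rule Bochner_Integration.integrable_bound)
        have "(\<lambda>x. win i j (w(j := x)) * indicator {c..w j} x) \<in> borel_measurable borel"
          by (intro borel_measurable_times measurable_compose[OF m1 win_measurable[OF i j]]) simp
        then show "(\<lambda>x. win i j (w(j := x)) * indicator {c..w j} x) \<in> borel_measurable lborel" by simp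
      qed (auto simp: win_nonneg win_le_1 split: split_indicator)
      show "AE z in lborel. (if z \<in> I j \<and> beats j (w(j := z)) \<and> z < w j then win i j (w(j := z)) else 0)
          \<le> win i j (w(j := z)) * indicator {c..w j} z"
      proof (intro AE_I2)
        fix z
        have "c \<le> z" if "z \<in> Z" using that bdd by (auto simp: c_def intro: cInf_lower)
        then show "(if z \<in> I j \<and> beats j (w(j := z)) \<and> z < w j then win i j (w(j := z)) else 0)
          \<le> win i j (w(j := z)) * indicator {c..w j} z"
          by (auto simp: Z_def win_nonneg split: split_indicator)
      qed
      show "integrable lborel (\<lambda>z. if z \<in> I j \<and> beats j (w(j := z)) \<and> z < w j then win i j (w(j := z)) else 0)"
      proof (rule Bochner_Integration.integrable_bound)
        show "integrable lborel (indicator {0..w j} :: real \<Rightarrow> real)"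
          by (intro integrable_real_indicator) (auto simp: emeasure_lborel_Icc_eq)
        show "AE z in lborel. norm (if z \<in> I j \<and> beats j (w(j := z)) \<and> z < w j then win i j (w(j := z)) else 0)
            \<le> norm (indicator {0..w j} z :: real)"
          by (intro AE_I2) (auto simp: win_nonneg win_le_1 item.I_nonneg split: split_indicator)
      qed (simp add: mm)
    qed
    also have "\<dots> \<le> utility i (w(j := w j)) - utility i (w(j := c))"
    proof (rule monotone_subgradient_integral[OF cw])
      show "(\<lambda>x. win i j (w(j := x))) \<in> borel_measurable borel"
        by (rule measurable_compose[OF m1 win_measurable[OF i j]])
      show "utility i (w(j := x)) + (y - x) * win i j (w(j := x)) \<le> utility i (w(j := y))"
        if "x \<in> {c..w j}" "y \<in> {c..w j}" for x y
        using that by (intro utility_subgradient i j ty)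
    qed (auto simp: win_nonneg win_le_1)
    also have "\<dots> \<le> utility i w" using utility_nonneg[OF i ty[of c]] cw by simp
    finally show ?thesis .
  qed
qed

lemma paid_le_charge:
  assumes i: "i < n" and w: "w \<in> types m D" "\<forall>j<m. w j \<in> I j"
  shows "paid i w \<le> (\<Sum>j<m. charge i j w)"
proof -
  have "(\<Sum>j<m. if beats j w then area i j w else 0) \<le> utility i w"
  proof (cases "\<exists>j<m. beats j w")
    case True
    then obtain j where j: "j < m" "beats j w" by auto
    have "(\<Sum>k<m. if beats k w then area i k w else 0) = (\<Sum>k<m. if k = j then area i j w else 0)"
      using j beats_unique by (intro sum.cong) auto
    then show ?thesis using j area_le_utility[OF i j(1) w(1)] w(2) by simp
  next
    case False
    then have "(\<Sum>j<m. if beats j w then area i j w else 0) = 0" by (intro sum.neutral) auto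
    then show ?thesis using utility_nonneg[OF i w(1)] by simp
  qed
  then show ?thesis by (simp add: charge_def utility_def sum_subtractf)
qed

text \<open>The values of the other items are fixed and the one-dimensional bound is applied along
  the line in direction j. Luck for j is upward closed there, because raising w j can only raise its
  quantile.\<close>

lemma nn_integral_charge_truncated:
  assumes i: "i < n" and j: "j < m" and T: "0 \<le> T"
  shows "(\<integral>\<^sup>+ w. ennreal (charge i j w) * indicator {..<T} (w j) \<partial>V)
    \<le> (\<integral>\<^sup>+ w. ennreal (win i j w * score j w) \<partial>V) + ennreal (T * tail (D j) T)"
proof -
  let ?W = "Pi\<^sub>M ({..<m} - {j}) D"
  interpret W: prob_space ?W by (rule prob_space_PiM) (rule item.prob_space_axioms)
  note [measurable] = charge_measurable[OF i j] win_measurable[OF i j] score_measurable[OF j] j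
  have ins: "insert j ({..<m} - {j}) = {..<m}" using j by auto
  have split: "(\<integral>\<^sup>+ w. G w \<partial>V) = (\<integral>\<^sup>+ w. (\<integral>\<^sup>+ s. G (w(j := s)) \<partial>D j) \<partial>?W)"
    if "G \<in> borel_measurable V" for G
    using items.product_nn_integral_insert[of "{..<m} - {j}" j G] that
    unfolding ins valuation_dist_def by simp
  have AE: "AE w in ?W. \<forall>k\<in>{..<m} - {j}. w k \<in> I k"
    by (intro AE_finite_allI AE_PiM_component[where P="\<lambda>x. x \<in> I _"] item.prob_space_axioms item.AE_in_I) auto
  have line: "(\<integral>\<^sup>+ s. ennreal (charge i j (w(j := s))) * indicator {..<T} s \<partial>D j)
      \<le> (\<integral>\<^sup>+ s. ennreal (win i j (w(j := s)) * score j (w(j := s))) \<partial>D j) + ennreal (T * tail (D j) T)"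
    if w: "w \<in> space ?W" "\<forall>k\<in>{..<m} - {j}. w k \<in> I k" for w
  proof -
    have wV: "w(j := 0) \<in> space V"
      using w(1) j by (auto simp: space_V space_PiM PiE_iff extensional_def)
    have [measurable]: "(\<lambda>s. w(j := s)) \<in> measurable borel V"
      using upd_item_measurable_fixed[OF j wV] by simp
    have ty: "w(j := x) \<in> types m D" if "x \<in> I j" for x
      using w wV that j item.I_subset_support by (auto simp: types_def space_V PiE_iff extensional_def)
    define R where "R = {s. beats j (w(j := s))}"
    have "Measurable.pred borel (\<lambda>s. beats j (w(j := s)))"
      using beats_measurable[OF j] by measurable
    then have R: "R \<in> sets borel" unfolding R_def by (simp add: pred_def)
    have "(\<integral>\<^sup>+ s. ennreal (s * win i j (w(j := s)) - (if s \<in> R then LINT z|lborel.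
          (if z \<in> I j \<and> z \<in> R \<and> z < s then win i j (w(j := z)) else 0) else 0)) * indicator {..<T} s \<partial>D j)
      \<le> (\<integral>\<^sup>+ s. ennreal (win i j (w(j := s)) * (if s \<in> R then virtual_value (D j) (f j) s else s)) \<partial>D j)
        + ennreal (T * tail (D j) T)"
    proof (rule item.revenue_le_virtual_surplus)
      show "(\<lambda>s. win i j (w(j := s))) \<in> borel_measurable borel" by measurable
      show "win i j (w(j := x)) \<le> win i j (w(j := y))" if "x \<in> I j" "y \<in> I j" "x \<le> y" for x y
        using that by (intro win_mono i j ty)
      show "y \<in> R" if "x \<in> R" "x \<le> y" for x y
        using that item.cdf_nondecreasing[OF that(2), of j]
        by (auto simp: R_def beats_def intro: less_le_trans)
    qed (use R T win_nonneg win_le_1 in auto)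
    then show ?thesis
      unfolding charge_def area_def score_def R_def mem_Collect_eq fun_upd_same fun_upd_upd .
  qed
  have "(\<integral>\<^sup>+ w. ennreal (charge i j w) * indicator {..<T} (w j) \<partial>V)
      = (\<integral>\<^sup>+ w. (\<integral>\<^sup>+ s. ennreal (charge i j (w(j := s))) * indicator {..<T} s \<partial>D j) \<partial>?W)"
    by (subst split) auto
  also have "\<dots> \<le> (\<integral>\<^sup>+ w. (\<integral>\<^sup>+ s. ennreal (win i j (w(j := s)) * score j (w(j := s))) \<partial>D j) + ennreal (T * tail (D j) T) \<partial>?W)"
    using AE AE_space by (intro nn_integral_mono_AE, eventually_elim) (rule line)
  also have "\<dots> = (\<integral>\<^sup>+ w. (\<integral>\<^sup>+ s. ennreal (win i j (w(j := s)) * score j (w(j := s))) \<partial>D j) \<partial>?W) + ennreal (T * tail (D j) T)"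
  proof (subst nn_integral_add)
    have "(\<lambda>(f, y). f(j := y)) \<in> measurable (?W \<Otimes>\<^sub>M D j) V"
      using measurable_add_dim[of j "{..<m} - {j}" D] unfolding ins valuation_dist_def .
    then have [measurable]: "(\<lambda>p. (fst p)(j := snd p)) \<in> measurable (?W \<Otimes>\<^sub>M D j) V"
      by (simp add: case_prod_beta')
    have "(\<lambda>p. ennreal (win i j ((fst p)(j := snd p)) * score j ((fst p)(j := snd p)))) \<in> borel_measurable (?W \<Otimes>\<^sub>M D j)"
      by measurable
    then show "(\<lambda>w. \<integral>\<^sup>+ s. ennreal (win i j (w(j := s)) * score j (w(j := s))) \<partial>D j) \<in> borel_measurable ?W"
      by (intro item.borel_measurable_nn_integral) (simp add: case_prod_beta')
  qed (auto simp: W.emeasure_space_1)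
  also have "(\<integral>\<^sup>+ w. (\<integral>\<^sup>+ s. ennreal (win i j (w(j := s)) * score j (w(j := s))) \<partial>D j) \<partial>?W)
      = (\<integral>\<^sup>+ w. ennreal (win i j w * score j w) \<partial>V)"
    by (subst split) auto
  finally show ?thesis .
qed

text \<open>The integral truncated at k is bounded by the bounds for all l \<ge> k, so the infimum
  over l may be taken before the supremum over k. This produces the liminf
  \<open>top_revenue\<close>.\<close>

lemma nn_integral_charge:
  assumes i: "i < n" and j: "j < m"
  shows "(\<integral>\<^sup>+ w. ennreal (charge i j w) \<partial>V) \<le> (\<integral>\<^sup>+ w. ennreal (win i j w * score j w) \<partial>V) + top_revenue (D j)"
proof -
  note [measurable] = charge_measurable[OF i j] j
  let ?C = "\<integral>\<^sup>+ w. ennreal (win i j w * score j w) \<partial>V"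
  let ?h = "\<lambda>k w. ennreal (charge i j w) * indicator {..<real k} (w j)"
  have inc: "incseq ?h" by (auto simp: incseq_def le_fun_def split: split_indicator)
  have "(\<integral>\<^sup>+ w. ennreal (charge i j w) \<partial>V) = (\<integral>\<^sup>+ w. (SUP k. ?h k w) \<partial>V)"
  proof (intro nn_integral_cong antisym)
    fix w
    show "(SUP k. ?h k w) \<le> ennreal (charge i j w)" by (intro SUP_least) (auto split: split_indicator)
    obtain k where "w j < real k" using reals_Archimedean2 by auto
    then show "ennreal (charge i j w) \<le> (SUP k. ?h k w)" by (intro SUP_upper2[of k]) auto
  qed
  also have "\<dots> = (SUP k. \<integral>\<^sup>+ w. ?h k w \<partial>V)"
    by (intro nn_integral_monotone_convergence_SUP inc) measurable
  also have "\<dots> \<le> (SUP k. INF l\<in>{k..}. ?C + ennreal (real l * tail (D j) (real l)))"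
  proof (intro SUP_mono bexI[where x=k for k] INF_greatest)
    fix k l :: nat assume "l \<in> {k..}"
    then have "(\<integral>\<^sup>+ w. ?h k w \<partial>V) \<le> (\<integral>\<^sup>+ w. ?h l w \<partial>V)"
      using inc by (intro nn_integral_mono) (auto simp: incseq_def le_fun_def)
    also have "\<dots> \<le> ?C + ennreal (real l * tail (D j) (real l))"
      by (rule nn_integral_charge_truncated[OF i j]) simp
    finally show "(\<integral>\<^sup>+ w. ?h k w \<partial>V) \<le> ?C + ennreal (real l * tail (D j) (real l))" .
  qed simp
  also have "\<dots> = (SUP k. ?C + (INF l\<in>{k..}. ennreal (real l * tail (D j) (real l))))"
  proof -
    have "(INF l\<in>{k..}. g l) = (INF l. g (l + k))" for g :: "nat \<Rightarrow> ennreal" and k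
    proof -
      have "{k..} = range (\<lambda>l. l + k)"
        by (auto simp: image_iff) (metis add.commute le_iff_add)
      then show ?thesis by (simp add: image_image)
    qed
    then show ?thesis by (simp add: INF_ennreal_const_add)
  qed
  also have "\<dots> = ?C + top_revenue (D j)"
    unfolding top_revenue_def liminf_SUP_INF by (subst ennreal_SUP_add_right) auto
  finally show ?thesis .
qed

text \<open>The charges bound interim payments, which are differences of positive and negative
  parts. The negative part is moved to the right so that the statement keeps its meaning when
  integrals are infinite.\<close>

lemma nn_integral_pay:
  assumes i: "i < n"
  shows "(\<integral>\<^sup>+ x. ennreal (pay M (fst x) (snd x) i) \<partial>(S \<Otimes>\<^sub>M P))
    \<le> (\<Sum>j<m. (\<integral>\<^sup>+ w. ennreal (win i j w * score j w) \<partial>V) + top_revenue (D j))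
      + (\<integral>\<^sup>+ x. ennreal (- pay M (fst x) (snd x) i) \<partial>(S \<Otimes>\<^sub>M P))"
proof -
  note pm = pay_measurable[OF i]
  let ?p = "\<lambda>w. \<integral>\<^sup>+ x. ennreal (pay M (fst x) ((snd x)(i := w)) i) \<partial>(S \<Otimes>\<^sub>M P' i)"
  let ?l = "\<lambda>w. \<integral>\<^sup>+ x. ennreal (- pay M (fst x) ((snd x)(i := w)) i) \<partial>(S \<Otimes>\<^sub>M P' i)"
  have l_meas: "?l \<in> borel_measurable V"
  proof -
    have "(\<lambda>p. ennreal (- pay M (fst (snd p)) ((snd (snd p))(i := fst p)) i)) \<in> borel_measurable (V \<Otimes>\<^sub>M (S \<Otimes>\<^sub>M P' i))"
      using measurable_compose[OF upd_measurable[OF i] pm] by simp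
    then show ?thesis by (intro SP'.borel_measurable_nn_integral) (simp add: case_prod_beta')
  qed
  have "(\<integral>\<^sup>+ x. ennreal (pay M (fst x) (snd x) i) \<partial>(S \<Otimes>\<^sub>M P)) = (\<integral>\<^sup>+ w. ?p w \<partial>V)"
    using pm by (subst nn_integral_split_bidder[OF i]) auto
  also have "\<dots> \<le> (\<integral>\<^sup>+ w. (\<Sum>j<m. ennreal (charge i j w)) + ?l w \<partial>V)"
  proof (intro nn_integral_mono_AE)
    show "AE w in V. ?p w \<le> (\<Sum>j<m. ennreal (charge i j w)) + ?l w"
      using AE_types AE_in_I
    proof eventually_elim
      fix w assume w: "w \<in> types m D" "\<forall>j<m. w j \<in> I j"
      have ip: "integrable (S \<Otimes>\<^sub>M P' i) (\<lambda>x. pay M (fst x) ((snd x)(i := w)) i)"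
        using mech i w by (auto simp: is_mechanism_def case_prod_beta')
      have fin: "?p w < \<top>" "?l w < \<top>"
        using ip unfolding real_integrable_def by (auto simp: less_top)
      have "paid i w = enn2real (?p w) - enn2real (?l w)"
        unfolding paid_def by (rule real_lebesgue_integral_def[OF ip])
      then have "enn2real (?p w) \<le> (\<Sum>j<m. charge i j w) + enn2real (?l w)"
        using paid_le_charge[OF i w] by simp
      also have "\<dots> \<le> (\<Sum>j<m. max 0 (charge i j w)) + enn2real (?l w)"
        by (intro add_mono sum_mono) auto
      finally have "ennreal (enn2real (?p w)) \<le> ennreal ((\<Sum>j<m. max 0 (charge i j w)) + enn2real (?l w))"
        by (rule ennreal_leI)
      also have "\<dots> = (\<Sum>j<m. ennreal (max 0 (charge i j w))) + ennreal (enn2real (?l w))"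
        by (subst ennreal_plus) (auto intro: sum_nonneg simp: sum_ennreal[symmetric] simp del: sum_ennreal)
      finally show "?p w \<le> (\<Sum>j<m. ennreal (charge i j w)) + ?l w"
        using fin by simp
    qed
  qed
  also have "\<dots> = (\<Sum>j<m. \<integral>\<^sup>+ w. ennreal (charge i j w) \<partial>V) + (\<integral>\<^sup>+ w. ?l w \<partial>V)"
    using charge_measurable[OF i] l_meas
    by (subst nn_integral_add) (auto intro!: nn_integral_sum borel_measurable_sum)
  also have "(\<integral>\<^sup>+ w. ?l w \<partial>V) = (\<integral>\<^sup>+ x. ennreal (- pay M (fst x) (snd x) i) \<partial>(S \<Otimes>\<^sub>M P))"
    using pm by (subst nn_integral_split_bidder[OF i]) auto
  also have "(\<Sum>j<m. \<integral>\<^sup>+ w. ennreal (charge i j w) \<partial>V)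
      \<le> (\<Sum>j<m. (\<integral>\<^sup>+ w. ennreal (win i j w * score j w) \<partial>V) + top_revenue (D j))"
    by (intro sum_mono nn_integral_charge i) auto
  finally show ?thesis by (simp add: add_right_mono)
qed

lemma nn_integral_win_score:
  assumes i: "i < n" and j: "j < m"
  shows "(\<integral>\<^sup>+ w. ennreal (win i j w * score j w) \<partial>V)
    = (\<integral>\<^sup>+ x. indicator (won i j) x * ennreal (score j (snd x i)) \<partial>(S \<Otimes>\<^sub>M P))"
proof -
  have sm: "(\<lambda>x. score j (snd x i)) \<in> borel_measurable (S \<Otimes>\<^sub>M P)"
  proof -
    have "(\<lambda>x. snd x i) \<in> measurable (S \<Otimes>\<^sub>M P) V"
      using measurable_compose[OF measurable_snd bidder_measurable[OF i]] .
    then show ?thesis using measurable_compose[OF _ score_measurable[OF j]] by blast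
  qed
  have "(\<integral>\<^sup>+ x. indicator (won i j) x * ennreal (score j (snd x i)) \<partial>(S \<Otimes>\<^sub>M P))
      = (\<integral>\<^sup>+ w. (\<integral>\<^sup>+ x. indicator (won i j) (fst x, (snd x)(i := w)) * ennreal (score j w) \<partial>(S \<Otimes>\<^sub>M P' i)) \<partial>V)"
    using sm won_sets[OF i j] by (subst nn_integral_split_bidder[OF i]) auto
  also have "\<dots> = (\<integral>\<^sup>+ w. ennreal (win i j w * score j w) \<partial>V)"
  proof (intro nn_integral_cong)
    fix w assume w: "w \<in> space V"
    have "(\<lambda>x. indicator (won i j) (fst x, (snd x)(i := w)) :: ennreal) \<in> borel_measurable (S \<Otimes>\<^sub>M P' i)"
      using measurable_compose[OF upd_measurable_fixed[OF i w] borel_measurable_indicator[OF won_sets[OF i j]]] .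
    then show "(\<integral>\<^sup>+ x. indicator (won i j) (fst x, (snd x)(i := w)) * ennreal (score j w) \<partial>(S \<Otimes>\<^sub>M P' i))
        = ennreal (win i j w * score j w)"
      by (subst nn_integral_multc) (auto simp: win_nn ennreal_mult' win_nonneg)
  qed
  finally show ?thesis by simp
qed

text \<open>For each realization at most one bidder receives item j, so the sum of the scores of
  winners has at most one nonzero term.\<close>

lemma sum_win_score_le:
  assumes j: "j < m" and n: "1 \<le> n"
  shows "(\<Sum>i<n. \<integral>\<^sup>+ w. ennreal (win i j w * score j w) \<partial>V)
    \<le> (\<integral>\<^sup>+ b. ennreal (Max ((\<lambda>i. score j (b i)) ` {..<n})) \<partial>P)"
proof -
  let ?g = "\<lambda>b :: profile. ennreal (Max ((\<lambda>i. score j (b i)) ` {..<n}))"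
  have comp: "(\<lambda>b. score j (b i)) \<in> borel_measurable P" if "i < n" for i
    using measurable_compose[OF bidder_measurable[OF that] score_measurable[OF j]] .
  have g: "?g \<in> borel_measurable P"
    using comp by (intro measurable_compose[OF borel_measurable_Max measurable_ennreal]) auto
  have "(\<Sum>i<n. \<integral>\<^sup>+ w. ennreal (win i j w * score j w) \<partial>V)
      = (\<Sum>i<n. \<integral>\<^sup>+ x. indicator (won i j) x * ennreal (score j (snd x i)) \<partial>(S \<Otimes>\<^sub>M P))"
    by (intro sum.cong nn_integral_win_score j) auto
  also have "\<dots> = (\<integral>\<^sup>+ x. (\<Sum>i<n. indicator (won i j) x * ennreal (score j (snd x i))) \<partial>(S \<Otimes>\<^sub>M P))"
  proof (rule nn_integral_sum[symmetric])
    fix i assume "i \<in> {..<n}"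
    then have i: "i < n" by simp
    note [measurable] = won_sets[OF i j] measurable_compose[OF measurable_snd comp[OF i]]
    show "(\<lambda>x. indicator (won i j) x * ennreal (score j (snd x i))) \<in> borel_measurable (S \<Otimes>\<^sub>M P)"
      by measurable
  qed
  also have "\<dots> \<le> (\<integral>\<^sup>+ x. ?g (snd x) \<partial>(S \<Otimes>\<^sub>M P))"
  proof (intro nn_integral_mono)
    fix x assume x: "x \<in> space (S \<Otimes>\<^sub>M P)"
    have disj: "i = i'" if "x \<in> won i j" "x \<in> won i' j" "i < n" "i' < n" for i i'
    proof (rule ccontr)
      assume "i \<noteq> i'"
      moreover have "disjoint_family_on (alloc M (fst x) (snd x)) {..<n}"
        using alloc_allocations[of "snd x" "fst x"] x by (auto simp: space_pair_measure allocations_def)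
      ultimately have "alloc M (fst x) (snd x) i \<inter> alloc M (fst x) (snd x) i' = {}"
        using that by (intro disjoint_family_onD) auto
      then show False using that by (auto simp: won_def)
    qed
    show "(\<Sum>i<n. indicator (won i j) x * ennreal (score j (snd x i))) \<le> ?g (snd x)"
    proof (cases "\<exists>i<n. x \<in> won i j")
      case True
      then obtain i where i: "i < n" "x \<in> won i j" by auto
      have "(\<Sum>k<n. indicator (won k j) x * ennreal (score j (snd x k)))
          = (\<Sum>k<n. if k = i then ennreal (score j (snd x i)) else 0)"
        using i disj by (intro sum.cong) (auto split: split_indicator)
      also have "\<dots> = ennreal (score j (snd x i))" using i by simp
      also have "\<dots> \<le> ?g (snd x)" using i by (intro ennreal_leI Max_ge) auto
      finally show ?thesis .
    next
      case False
      then have "(\<Sum>i<n. indicator (won i j) x * ennreal (score j (snd x i))) = 0"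
        by (intro sum.neutral) auto
      then show ?thesis by simp
    qed
  qed
  also have "\<dots> = (\<integral>\<^sup>+ b. ?g b \<partial>P)"
    using P.nn_integral_fst[of "\<lambda>x. ?g (snd x)" S] S.emeasure_space_1
    by (simp add: measurable_compose[OF measurable_snd g])
  finally show ?thesis .
qed

text \<open>The revenue is X - Y, formed from the positive and negative part of the total payment,
  whereas the bounds concern the bidders separately and add up to A \<le> B + L with B the sum of
  the second prices. By the definition of a mechanism L is finite, and Y \<le> L.\<close>

lemma Rev_le_second_price:
  assumes n: "1 \<le> n"
  shows "Rev m D n M \<le> enn2ereal (\<Sum>j<m. second_price (D j) (2 * n + 2 * m - 2))"
proof -
  let ?Q = "S \<Otimes>\<^sub>M P"
  let ?p = "\<lambda>i x. pay M (fst x) (snd x) i"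
  let ?B = "\<Sum>j<m. second_price (D j) (2 * n + 2 * m - 2)"
  define X where "X = (\<integral>\<^sup>+ x. ennreal (\<Sum>i<n. ?p i x) \<partial>?Q)"
  define Y where "Y = (\<integral>\<^sup>+ x. ennreal (- (\<Sum>i<n. ?p i x)) \<partial>?Q)"
  define A where "A = (\<Sum>i<n. \<integral>\<^sup>+ x. ennreal (?p i x) \<partial>?Q)"
  define L where "L = (\<Sum>i<n. \<integral>\<^sup>+ x. ennreal (- ?p i x) \<partial>?Q)"
  have Lfin: "L < \<top>"
    unfolding L_def using mech by (subst ennreal_sum_less_top) (auto simp: is_mechanism_def case_prod_beta')
  have "A \<le> (\<Sum>i<n. (\<Sum>j<m. (\<integral>\<^sup>+ w. ennreal (win i j w * score j w) \<partial>V) + top_revenue (D j))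
      + (\<integral>\<^sup>+ x. ennreal (- ?p i x) \<partial>?Q))"
    unfolding A_def by (intro sum_mono nn_integral_pay) auto
  also have "\<dots> = (\<Sum>j<m. (\<Sum>i<n. \<integral>\<^sup>+ w. ennreal (win i j w * score j w) \<partial>V) + of_nat n * top_revenue (D j)) + L"
    unfolding L_def sum.distrib by (subst sum.swap) (simp add: sum_distrib_left)
  also have "\<dots> \<le> ?B + L"
  proof (intro add_right_mono sum_mono)
    fix j assume "j \<in> {..<m}"
    then have j: "j < m" by simp
    show "(\<Sum>i<n. \<integral>\<^sup>+ w. ennreal (win i j w * score j w) \<partial>V) + of_nat n * top_revenue (D j)
        \<le> second_price (D j) (2 * n + 2 * m - 2)"
      using add_right_mono[OF sum_win_score_le[OF j n]] nn_integral_max_score[OF j n] by (rule order_trans)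
  qed
  finally have A: "A \<le> ?B + L" .
  \<comment> \<open>Pointwise both sides agree, since a real number is the difference of its parts;
    adding instead of subtracting keeps this valid in \<open>ennreal\<close>.\<close>
  have XAY: "X + L \<le> A + Y"
  proof -
    have "X + L = (\<integral>\<^sup>+ x. ennreal (\<Sum>i<n. ?p i x) + (\<Sum>i<n. ennreal (- ?p i x)) \<partial>?Q)"
      unfolding X_def L_def using pay_measurable
      by (subst nn_integral_sum[symmetric]) (auto simp: nn_integral_add)
    also have "\<dots> \<le> (\<integral>\<^sup>+ x. (\<Sum>i<n. ennreal (?p i x)) + ennreal (- (\<Sum>i<n. ?p i x)) \<partial>?Q)"
    proof (intro nn_integral_mono)
      fix x
      let ?s = "\<Sum>i<n. ?p i x"
      have p: "(\<Sum>i<n. ennreal (g i)) = ennreal (\<Sum>i<n. max 0 (g i))" for g :: "nat \<Rightarrow> real"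
        by (subst sum_ennreal[symmetric]) auto
      have "?s = (\<Sum>i<n. max 0 (?p i x) - max 0 (- ?p i x))" by (intro sum.cong) auto
      then have s: "?s = (\<Sum>i<n. max 0 (?p i x)) - (\<Sum>i<n. max 0 (- ?p i x))" by (simp add: sum_subtractf)
      have nn: "0 \<le> (\<Sum>i<n. max 0 (?p i x))" "0 \<le> (\<Sum>i<n. max 0 (- ?p i x))" by (auto intro: sum_nonneg)
      have "ennreal (max 0 ?s) + ennreal (\<Sum>i<n. max 0 (- ?p i x))
          \<le> ennreal (\<Sum>i<n. max 0 (?p i x)) + ennreal (max 0 (- ?s))"
      proof -
        have "ennreal (max 0 (a - b)) + ennreal b \<le> ennreal a + ennreal (max 0 (b - a))"
          if "0 \<le> a" "0 \<le> b" for a b :: real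
          using that by (cases "b \<le> a") (simp_all add: max_def flip: ennreal_plus)
        from this[OF nn] show ?thesis unfolding s by simp
      qed
      then show "ennreal ?s + (\<Sum>i<n. ennreal (- ?p i x)) \<le> (\<Sum>i<n. ennreal (?p i x)) + ennreal (- ?s)"
        unfolding p by simp
    qed
    also have "\<dots> = A + Y"
      unfolding A_def Y_def using pay_measurable
      by (subst nn_integral_sum[symmetric]) (auto simp: nn_integral_add)
    finally show ?thesis .
  qed
  have "Y \<le> (\<integral>\<^sup>+ x. (\<Sum>i<n. ennreal (- ?p i x)) \<partial>?Q)"
    unfolding Y_def
  proof (intro nn_integral_mono)
    fix x
    have "ennreal (- (\<Sum>i<n. ?p i x)) \<le> ennreal (\<Sum>i<n. max 0 (- ?p i x))"
      unfolding sum_negf[symmetric] by (intro ennreal_leI sum_mono) auto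
    then show "ennreal (- (\<Sum>i<n. ?p i x)) \<le> (\<Sum>i<n. ennreal (- ?p i x))"
      by (subst (asm) sum_ennreal[symmetric]) auto
  qed
  also have "\<dots> = L"
    unfolding L_def using pay_measurable by (intro nn_integral_sum) auto
  finally have "Y \<le> L" .
  then have Yfin: "Y < \<top>" using Lfin by simp
  have "X + L \<le> (?B + Y) + L" using XAY A by (metis (no_types, lifting) add.assoc add.commute add_right_mono order_trans)
  then have "X \<le> ?B + Y" using Lfin
    by (subst (asm) (1 2) add.commute[of _ L]) (auto simp: ennreal_add_left_cancel_le)
  then have "enn2ereal X \<le> enn2ereal ?B + enn2ereal Y" by (simp add: less_eq_ennreal.rep_eq plus_ennreal.rep_eq)
  moreover have "\<bar>enn2ereal Y\<bar> \<noteq> \<infinity>" using Yfin by (cases Y) auto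
  ultimately have "enn2ereal X - enn2ereal Y \<le> enn2ereal ?B"
    by (subst ereal_minus_le) auto
  then show ?thesis
    by (simp add: Rev_def ext_expectation_def X_def Y_def case_prod_beta')
qed

end

section \<open>Revenue of VCG\<close>

text \<open>The value 0 for no bidders is the welfare that remains when a sole bidder is
  removed.\<close>

definition top_value :: "nat set \<Rightarrow> (nat \<Rightarrow> real) \<Rightarrow> real" where
  "top_value N x = (if N = {} then 0 else Max (x ` N))"

text \<open>Total VCG payment for one item, in the form in which the externalities add up: the top
  value is subtracted k - 1 times because the chosen welfare of the winner counts against every
  bidder but herself. It is the second highest value, and 0 for k = 1.\<close>

definition second_value :: "nat \<Rightarrow> (nat \<Rightarrow> real) \<Rightarrow> real" where
  "second_value k x = (\<Sum>i<k. top_value ({..<k} - {i}) x) - (real k - 1) * top_value {..<k} x"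

text \<open>Removing any bidder other than i leaves the top value x i, and these k - 1 terms
  cancel.\<close>

lemma second_value_eq:
  assumes i: "i < k" "\<And>i'. i' < k \<Longrightarrow> x i' \<le> x i"
  shows "second_value k x = top_value ({..<k} - {i}) x"
proof -
  have top: "top_value N x = x i" if "i \<in> N" "N \<subseteq> {..<k}" for N
    unfolding top_value_def using that i finite_subset[OF that(2)]
    by (auto intro!: Max_eqI)
  have "(\<Sum>i'<k. top_value ({..<k} - {i'}) x)
      = top_value ({..<k} - {i}) x + (\<Sum>i'\<in>{..<k} - {i}. top_value ({..<k} - {i'}) x)"
    using i by (intro sum.remove) auto
  also have "(\<Sum>i'\<in>{..<k} - {i}. top_value ({..<k} - {i'}) x) = (\<Sum>i'\<in>{..<k} - {i}. x i)"
    using i by (intro sum.cong refl top) auto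
  also have "\<dots> = (real k - 1) * x i" using i by (simp add: of_nat_diff)
  finally show ?thesis using top[of "{..<k}"] i by (simp add: second_value_def)
qed

lemma ex_top_bidder:
  fixes x :: "nat \<Rightarrow> real"
  assumes "1 \<le> k"
  obtains i where "i < k" "\<And>i'. i' < k \<Longrightarrow> x i' \<le> x i"
proof -
  have "Max (x ` {..<k}) \<in> x ` {..<k}" using assms by (intro Max_in) (auto simp: lessThan_empty_iff)
  then obtain i where i: "i < k" "Max (x ` {..<k}) = x i" by auto
  have "x i' \<le> x i" if "i' < k" for i' unfolding i(2)[symmetric] using that by (intro Max_ge) auto
  then show thesis using that i(1) by blast
qed

lemma less_second_value_iff:
  assumes k: "1 \<le> k" and t: "0 \<le> t"
  shows "t < second_value k x \<longleftrightarrow> (\<exists>i<k. \<exists>i'<k. i \<noteq> i' \<and> t < x i \<and> t < x i')"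
proof -
  obtain i where i: "i < k" and max: "\<And>i'. i' < k \<Longrightarrow> x i' \<le> x i"
    using ex_top_bidder[OF k, of x] by blast
  have "t < top_value ({..<k} - {i}) x \<longleftrightarrow> (\<exists>i'\<in>{..<k} - {i}. t < x i')"
    using t by (auto simp: top_value_def Max_gr_iff)
  also have "\<dots> \<longleftrightarrow> (\<exists>i<k. \<exists>i'<k. i \<noteq> i' \<and> t < x i \<and> t < x i')"
  proof
    assume "\<exists>i'\<in>{..<k} - {i}. t < x i'"
    then obtain i' where "i' < k" "i' \<noteq> i" "t < x i'" by auto
    then show "\<exists>i<k. \<exists>i'<k. i \<noteq> i' \<and> t < x i \<and> t < x i'" using i max[of i'] by force
  next
    assume "\<exists>i<k. \<exists>i'<k. i \<noteq> i' \<and> t < x i \<and> t < x i'"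
    then obtain a b where "a < k" "b < k" "a \<noteq> b" "t < x a" "t < x b" by auto
    then show "\<exists>i'\<in>{..<k} - {i}. t < x i'" by (cases "a = i") auto
  qed
  finally show ?thesis using second_value_eq[of i k x] i max by simp
qed

lemma second_value_nonneg:
  assumes k: "1 \<le> k" and x: "\<And>i. i < k \<Longrightarrow> 0 \<le> x i"
  shows "0 \<le> second_value k x"
proof -
  obtain i where "i < k" "\<And>i'. i' < k \<Longrightarrow> x i' \<le> x i"
    using ex_top_bidder[OF k, of x] by blast
  then have "second_value k x = top_value ({..<k} - {i}) x" by (rule second_value_eq)
  then show ?thesis
    using x by (auto simp: top_value_def Max_ge_iff ex_in_conv[symmetric] simp del: ex_in_conv)
qed

section \<open>Welfare maximization item by item\<close>

lemma finite_allocations: "finite N \<Longrightarrow> finite (allocations m N)"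
  by (rule finite_subset[of _ "N \<rightarrow>\<^sub>E Pow {..<m}"]) (auto simp: allocations_def intro: finite_PiE)

lemma welfare_items:
  assumes "A \<in> allocations m N" "finite N"
  shows "welfare N b A = (\<Sum>j<m. \<Sum>i\<in>N. if j \<in> A i then b i j else 0)"
proof -
  have "welfare N b A = (\<Sum>i\<in>N. \<Sum>j<m. if j \<in> A i then b i j else 0)"
    unfolding welfare_def value_of_def
  proof (rule sum.cong[OF refl])
    fix i assume "i \<in> N"
    then have "A i \<subseteq> {..<m}" using assms by (auto simp: allocations_def PiE_iff)
    then show "(\<Sum>j\<in>A i. b i j) = (\<Sum>j<m. if j \<in> A i then b i j else 0)"
      by (subst sum.inter_restrict[symmetric]) (auto simp: Int_absorb1)
  qed
  then show ?thesis by (simp add: sum.swap[of _ N])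
qed

text \<open>An item contributes the value of its single recipient, or 0 if it stays unsold, which
  for nonnegative values is no better. Giving every item to a bidder who values it most attains the
  bound.\<close>

lemma max_welfare_eq:
  assumes N: "finite N" and nonneg: "\<And>i j. i \<in> N \<Longrightarrow> j < m \<Longrightarrow> 0 \<le> b i j"
  shows "max_welfare m N b = (\<Sum>j<m. top_value N (\<lambda>i. b i j))"
  unfolding max_welfare_def
proof (rule Max_eqI)
  show "finite (welfare N b ` allocations m N)" using finite_allocations[OF N] by simp
next
  fix y assume "y \<in> welfare N b ` allocations m N"
  then obtain A where A: "A \<in> allocations m N" "y = welfare N b A" by auto
  show "y \<le> (\<Sum>j<m. top_value N (\<lambda>i. b i j))"
    unfolding A(2) welfare_items[OF A(1) N]
  proof (intro sum_mono)
    fix j assume j: "j \<in> {..<m}"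
    show "(\<Sum>i\<in>N. if j \<in> A i then b i j else 0) \<le> top_value N (\<lambda>i. b i j)"
    proof (cases "\<exists>i\<in>N. j \<in> A i")
      case True
      then obtain i where i: "i \<in> N" "j \<in> A i" by auto
      have unique: "i' = i" if "i' \<in> N" "j \<in> A i'" for i'
        using A(1) i that disjoint_family_onD[of A N i' i] by (auto simp: allocations_def)
      have "(\<Sum>i'\<in>N. if j \<in> A i' then b i' j else 0) = (\<Sum>i'\<in>N. if i' = i then b i j else 0)"
      proof (rule sum.cong[OF refl])
        fix i' assume i': "i' \<in> N"
        have "j \<in> A i' \<longleftrightarrow> i' = i" using i unique[OF i'] by blast
        then show "(if j \<in> A i' then b i' j else 0) = (if i' = i then b i j else 0)" by simp
      qed
      also have "\<dots> = b i j" using i N by simp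
      also have "\<dots> \<le> top_value N (\<lambda>i. b i j)" using i N by (auto simp: top_value_def)
      finally show ?thesis .
    next
      case False
      then have "(\<Sum>i\<in>N. if j \<in> A i then b i j else 0) = 0" by (intro sum.neutral) auto
      moreover have "0 \<le> top_value N (\<lambda>i. b i j)"
        using N nonneg j by (auto simp: top_value_def Max_ge_iff ex_in_conv[symmetric])
      ultimately show ?thesis by simp
    qed
  qed
next
  show "(\<Sum>j<m. top_value N (\<lambda>i. b i j)) \<in> welfare N b ` allocations m N"
  proof (cases "N = {}")
    case True
    then show ?thesis by (auto simp: top_value_def welfare_def allocations_def disjoint_family_on_def)
  next
    case False
    have "\<exists>i\<in>N. b i j = Max ((\<lambda>i. b i j) ` N)" for j
    proof -
      have "Max ((\<lambda>i. b i j) ` N) \<in> (\<lambda>i. b i j) ` N" using N False by (intro Max_in) auto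
      then show ?thesis by (elim imageE) auto
    qed
    then obtain c where c: "\<And>j. c j \<in> N" "\<And>j. b (c j) j = Max ((\<lambda>i. b i j) ` N)" by metis
    define A where "A = (\<lambda>i\<in>N. {j\<in>{..<m}. c j = i})"
    have A: "A \<in> allocations m N"
      by (auto simp: A_def allocations_def disjoint_family_on_def)
    have "welfare N b A = (\<Sum>j<m. \<Sum>i\<in>N. if i = c j then b (c j) j else 0)"
      unfolding welfare_items[OF A N] by (intro sum.cong) (auto simp: A_def)
    also have "\<dots> = (\<Sum>j<m. top_value N (\<lambda>i. b i j))"
      using N c False by (intro sum.cong) (auto simp: top_value_def)
    finally show ?thesis using A by force
  qed
qed

lemma vcg_alloc_optimal:
  "vcg_alloc m k b \<in> allocations m {..<k}" "welfare {..<k} b (vcg_alloc m k b) = max_welfare m {..<k} b"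
proof -
  let ?A = "allocations m {..<k}"
  have fin: "finite (welfare {..<k} b ` ?A)" using finite_allocations[of "{..<k}"] by simp
  have "(\<lambda>i\<in>{..<k}. {}) \<in> ?A" by (auto simp: allocations_def disjoint_family_on_def)
  then have ne: "welfare {..<k} b ` ?A \<noteq> {}" by auto
  obtain A where A: "A \<in> ?A" "welfare {..<k} b A = max_welfare m {..<k} b"
    using Max_in[OF fin ne] unfolding max_welfare_def by auto
  have le: "welfare {..<k} b A' \<le> max_welfare m {..<k} b" if "A' \<in> ?A" for A'
    unfolding max_welfare_def using fin that by (intro Max_ge) auto
  have "is_arg_max (welfare {..<k} b) (\<lambda>A. A \<in> ?A) A"
    using A le by (auto simp: is_arg_max_def not_less)
  then have "is_arg_max (welfare {..<k} b) (\<lambda>A. A \<in> ?A) (vcg_alloc m k b)"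
    unfolding vcg_alloc_def arg_max_on_def arg_max_def
    by (rule someI[of "is_arg_max (welfare {..<k} b) (\<lambda>A. A \<in> ?A)"])
  then have *: "vcg_alloc m k b \<in> ?A" "\<And>A'. A' \<in> ?A \<Longrightarrow> welfare {..<k} b A' \<le> welfare {..<k} b (vcg_alloc m k b)"
    by (auto simp: is_arg_max_def not_less)
  show "vcg_alloc m k b \<in> ?A" by fact
  show "welfare {..<k} b (vcg_alloc m k b) = max_welfare m {..<k} b"
    using *(2)[OF A(1)] le[OF *(1)] A(2) by simp
qed

text \<open>The total payment depends on the chosen allocation only through its welfare, which is
  the maximum; hence the breaking of ties does not matter.\<close>

lemma sum_vcg_pay:
  assumes "\<And>i j. i < k \<Longrightarrow> j < m \<Longrightarrow> 0 \<le> b i j"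
  shows "(\<Sum>i<k. vcg_pay m k b i) = (\<Sum>j<m. second_value k (\<lambda>i. b i j))"
proof -
  let ?A = "vcg_alloc m k b"
  have "(\<Sum>i<k. welfare ({..<k} - {i}) b ?A) = (\<Sum>i<k. welfare {..<k} b ?A - value_of (b i) (?A i))"
    by (intro sum.cong refl) (auto simp: welfare_def sum_diff1)
  also have "\<dots> = (real k - 1) * welfare {..<k} b ?A"
    by (simp add: sum_subtractf welfare_def algebra_simps)
  finally have others: "(\<Sum>i<k. welfare ({..<k} - {i}) b ?A) = (real k - 1) * max_welfare m {..<k} b"
    by (simp add: vcg_alloc_optimal)
  have "(\<Sum>i<k. max_welfare m ({..<k} - {i}) b) = (\<Sum>i<k. \<Sum>j<m. top_value ({..<k} - {i}) (\<lambda>i. b i j))"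
    using assms by (intro sum.cong refl max_welfare_eq) auto
  also have "\<dots> = (\<Sum>j<m. \<Sum>i<k. top_value ({..<k} - {i}) (\<lambda>i. b i j))" by (rule sum.swap)
  finally have top: "(\<Sum>i<k. max_welfare m ({..<k} - {i}) b) = \<dots>" .
  have "max_welfare m {..<k} b = (\<Sum>j<m. top_value {..<k} (\<lambda>i. b i j))"
    using assms by (intro max_welfare_eq) auto
  then show ?thesis
    using others top
    by (simp add: vcg_pay_def sum_subtractf second_value_def sum_distrib_left)
qed

section \<open>Expected VCG revenue\<close>

context regular_items
begin

lemma emeasure_item:
  assumes j: "j < m" and X: "X \<in> sets borel"
  shows "emeasure V {w \<in> space V. w j \<in> X} = emeasure (D j) X"
proof -
  have "{w \<in> space V. w j \<in> X} = Pi\<^sub>E {..<m} (\<lambda>l. if l = j then X else UNIV)"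
  proof (intro equalityI subsetI)
    fix w assume "w \<in> Pi\<^sub>E {..<m} (\<lambda>l. if l = j then X else UNIV)"
    then have "w \<in> extensional {..<m}" "w j \<in> (if j = j then X else UNIV)"
      using j by (blast dest: PiE_mem PiE_iff[THEN iffD1])+
    then show "w \<in> {w \<in> space V. w j \<in> X}" by (simp add: space_V PiE_iff)
  qed (simp add: space_V PiE_iff)
  also have "emeasure V \<dots> = (\<Prod>l<m. emeasure (D l) (if l = j then X else UNIV))"
    unfolding valuation_dist_def using X by (intro items.emeasure_PiM) auto
  also have "\<dots> = (\<Prod>l<m. if l = j then emeasure (D j) X else 1)"
    using item.emeasure_space_1 by (intro prod.cong) auto
  finally show ?thesis using j by simp
qed

text \<open>The complement splits into \<open>C\<close>, where no value exceeds t, and the disjoint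
  events \<open>B i\<close>, where bidder i alone exceeds t.\<close>

lemma prob_two_exceed:
  assumes j: "j < m"
  defines "q \<equiv> tail (D j)"
  shows "emeasure (profile_dist m D {..<k}) {b \<in> space (profile_dist m D {..<k}). \<exists>i<k. \<exists>i'<k. i \<noteq> i' \<and> t < b i j \<and> t < b i' j}
    = ennreal (1 - (1 - q t) ^ k - k * q t * (1 - q t) ^ (k - 1))"
proof -
  let ?P = "profile_dist m D {..<k}"
  interpret P: prob_space ?P by (rule prob_space_profile_dist)
  define H where "H = {w \<in> space V. w j \<in> {t<..}}"
  define L where "L = {w \<in> space V. w j \<in> {..t}}"
  have HL [measurable]: "H \<in> sets V" "L \<in> sets V"
    unfolding H_def L_def using j by measurable
  have eH: "emeasure V H = ennreal (q t)" unfolding H_def q_def using emeasure_item[OF j, of "{t<..}"] by (simp add: item.emeasure_tail)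
  have eL: "emeasure V L = ennreal (1 - q t)"
    unfolding L_def q_def using emeasure_item[OF j, of "{..t}"] by (simp add: tail_def cdf_def item.emeasure_eq_measure)
  have q: "0 \<le> q t" "0 \<le> 1 - q t" using item.tail_nonneg item.tail_le_1 by (auto simp: q_def)
  define B where "B i = Pi\<^sub>E {..<k} (\<lambda>i'. if i' = i then H else L)" for i
  define C where "C = Pi\<^sub>E {..<k} (\<lambda>_. L)"
  have B: "B i \<in> sets ?P" for i
    unfolding B_def profile_dist_def by (intro sets_PiM_I_finite) auto
  have C: "C \<in> sets ?P"
    unfolding C_def profile_dist_def by (intro sets_PiM_I_finite) auto
  have pB: "P.prob (B i) = q t * (1 - q t) ^ (k - 1)" if "i < k" for i
  proof -
    have "emeasure ?P (B i) = (\<Prod>i'<k. emeasure V (if i' = i then H else L))"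
      unfolding B_def profile_dist_def by (intro bidders.emeasure_PiM) auto
    also have "\<dots> = emeasure V H * (\<Prod>i'\<in>{..<k} - {i}. emeasure V (if i' = i then H else L))"
      using that by (subst prod.remove[of _ i]) auto
    also have "(\<Prod>i'\<in>{..<k} - {i}. emeasure V (if i' = i then H else L)) = (\<Prod>i'\<in>{..<k} - {i}. emeasure V L)"
      by (intro prod.cong) auto
    finally have "emeasure ?P (B i) = ennreal (q t * (1 - q t) ^ (k - 1))"
      using that q by (simp add: eH eL ennreal_mult' ennreal_power)
    then show ?thesis using q by (simp add: measure_def)
  qed
  have pC: "P.prob C = (1 - q t) ^ k"
  proof -
    have "emeasure ?P C = (\<Prod>i'<k. emeasure V L)"
      unfolding C_def profile_dist_def by (intro bidders.emeasure_PiM) auto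
    then have "emeasure ?P C = ennreal ((1 - q t) ^ k)"
      using q by (simp add: eL ennreal_power)
    then show ?thesis using q by (simp add: measure_def)
  qed
  have dB: "disjoint_family_on B {..<k}"
    unfolding disjoint_family_on_def
  proof (intro ballI impI)
    fix i i' assume i: "i \<in> {..<k}" "i' \<in> {..<k}" "i \<noteq> i'"
    show "B i \<inter> B i' = {}"
    proof (rule ccontr)
      assume "B i \<inter> B i' \<noteq> {}"
      then obtain b where "b \<in> B i" "b \<in> B i'" by auto
      then have "b i \<in> H" "b i \<in> L" using i by (auto simp: B_def PiE_iff split: if_splits)
      then show False by (auto simp: H_def L_def)
    qed
  qed
  have dC: "(\<Union>i<k. B i) \<inter> C = {}"
  proof (rule ccontr)
    assume "(\<Union>i<k. B i) \<inter> C \<noteq> {}"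
    then obtain b i where "i < k" "b \<in> B i" "b \<in> C" by auto
    then have "b i \<in> H" "b i \<in> L" by (auto simp: B_def C_def PiE_iff split: if_splits)
    then show False by (auto simp: H_def L_def)
  qed
  have "P.prob ((\<Union>i<k. B i) \<union> C) = P.prob (\<Union>i<k. B i) + P.prob C"
    using B C dC by (intro P.finite_measure_Union) auto
  also have "P.prob (\<Union>i<k. B i) = (\<Sum>i<k. P.prob (B i))"
    using B dB by (intro P.finite_measure_finite_Union) auto
  also have "\<dots> = k * (q t * (1 - q t) ^ (k - 1))" using pB by simp
  finally have p: "P.prob ((\<Union>i<k. B i) \<union> C) = k * (q t * (1 - q t) ^ (k - 1)) + (1 - q t) ^ k"
    by (simp add: pC)
  have "{b \<in> space ?P. \<exists>i<k. \<exists>i'<k. i \<noteq> i' \<and> t < b i j \<and> t < b i' j} = space ?P - ((\<Union>i<k. B i) \<union> C)"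
  proof (rule set_eqI)
    fix b
    show "b \<in> {b \<in> space ?P. \<exists>i<k. \<exists>i'<k. i \<noteq> i' \<and> t < b i j \<and> t < b i' j}
        \<longleftrightarrow> b \<in> space ?P - ((\<Union>i<k. B i) \<union> C)"
    proof (cases "b \<in> space ?P")
      case True
      then have bV: "b \<in> extensional {..<k}" "\<And>i. i < k \<Longrightarrow> b i \<in> space V"
        by (auto simp: profile_dist_def space_PiM PiE_iff)
      have bC: "b \<in> C \<longleftrightarrow> (\<forall>i<k. b i j \<le> t)" using bV by (auto simp: C_def PiE_iff L_def)
      have bB: "b \<in> B i \<longleftrightarrow> t < b i j \<and> (\<forall>i'<k. i' \<noteq> i \<longrightarrow> b i' j \<le> t)" if "i < k" for i
        using bV that by (auto simp: B_def PiE_iff L_def H_def split: if_splits)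
      have "(\<exists>i<k. \<exists>i'<k. i \<noteq> i' \<and> t < b i j \<and> t < b i' j) \<longleftrightarrow> \<not> (b \<in> C \<or> (\<exists>i<k. b \<in> B i))"
      proof
        assume "\<exists>i<k. \<exists>i'<k. i \<noteq> i' \<and> t < b i j \<and> t < b i' j"
        then obtain a a' where a: "a < k" "a' < k" "a \<noteq> a'" "t < b a j" "t < b a' j" by blast
        have "b \<notin> B i" if "i < k" for i
          using bB[OF that] a by (metis not_le)
        moreover have "b \<notin> C" using bC a by (metis not_le)
        ultimately show "\<not> (b \<in> C \<or> (\<exists>i<k. b \<in> B i))" by blast
      next
        assume n: "\<not> (b \<in> C \<or> (\<exists>i<k. b \<in> B i))"
        then obtain a where a: "a < k" "t < b a j" using bC by (metis not_le)
        then have "b \<notin> B a" using n by blast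
        then obtain a' where "a' < k" "a' \<noteq> a" "t < b a' j" using bB[OF a(1)] a(2) by (metis not_le)
        then show "\<exists>i<k. \<exists>i'<k. i \<noteq> i' \<and> t < b i j \<and> t < b i' j" using a by metis
      qed
      then show ?thesis using True by simp blast
    qed simp
  qed
  then have "P.prob {b \<in> space ?P. \<exists>i<k. \<exists>i'<k. i \<noteq> i' \<and> t < b i j \<and> t < b i' j} = 1 - P.prob ((\<Union>i<k. B i) \<union> C)"
    using P.prob_compl[of "(\<Union>i<k. B i) \<union> C"] B C by (simp add: sets.finite_UN)
  then have "P.prob {b \<in> space ?P. \<exists>i<k. \<exists>i'<k. i \<noteq> i' \<and> t < b i j \<and> t < b i' j}
      = 1 - (1 - q t) ^ k - k * q t * (1 - q t) ^ (k - 1)"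
    using p by simp
  then show ?thesis by (simp only: P.emeasure_eq_measure)
qed

text \<open>Single payments involve an arbitrary choice among optimal allocations, and their
  measurability is never claimed. Only the total payment enters, and where all values are
  nonnegative, hence almost everywhere, it equals a measurable function.\<close>

lemma Rev_VCG:
  assumes k: "1 \<le> k"
  shows "Rev m D k (VCG m k) = enn2ereal (\<Sum>j<m. second_price (D j) k)"
proof -
  let ?P = "profile_dist m D {..<k}"
  let ?S = "return borel (0 :: real)"
  let ?s = "\<lambda>j b. second_value k (\<lambda>i. b i j)"
  interpret P: prob_space ?P by (rule prob_space_profile_dist)
  interpret S: prob_space ?S by (rule prob_space_return) simp
  interpret SP: pair_prob_space ?S ?P ..
  have comp: "(\<lambda>b. b i j) \<in> borel_measurable ?P" if "i < k" "j < m" for i j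
  proof -
    have "(\<lambda>b. b i) \<in> measurable ?P V"
      unfolding profile_dist_def using that by (intro measurable_component_singleton) simp
    then show ?thesis using that(2) by (rule component_measurable)
  qed
  have top: "(\<lambda>b. top_value N (\<lambda>i. b i j)) \<in> borel_measurable ?P" if "N \<subseteq> {..<k}" "j < m" for N j
    using comp that finite_subset[OF that(1)]
    by (cases "N = {}") (auto simp: top_value_def intro!: borel_measurable_Max)
  have sm: "?s j \<in> borel_measurable ?P" if "j < m" for j
    unfolding second_value_def
    by (intro borel_measurable_diff borel_measurable_sum borel_measurable_times measurable_const top that) auto
  have nonneg: "AE x in ?S \<Otimes>\<^sub>M ?P. \<forall>i<k. \<forall>j<m. 0 \<le> snd x i j"
  proof (rule SP.AE_pair_measure)
    have "{x \<in> space (?S \<Otimes>\<^sub>M ?P). \<forall>i\<in>{..<k}. \<forall>j\<in>{..<m}. 0 \<le> snd x i j} \<in> sets (?S \<Otimes>\<^sub>M ?P)"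
      using measurable_compose[OF measurable_snd comp]
      by (intro sets.sets_Collect_finite_All borel_measurable_le) auto
    then show "{x \<in> space (?S \<Otimes>\<^sub>M ?P). \<forall>i<k. \<forall>j<m. 0 \<le> snd x i j} \<in> sets (?S \<Otimes>\<^sub>M ?P)"
      by (simp only: Ball_def lessThan_iff)
    have "AE b in ?P. \<forall>i\<in>{..<k}. \<forall>j<m. b i j \<in> I j"
      unfolding profile_dist_def
      by (intro AE_finite_allI AE_PiM_component[where P="\<lambda>w. \<forall>j<m. w j \<in> I j"] val.prob_space_axioms AE_in_I) auto
    then have "AE b in ?P. \<forall>i<k. \<forall>j<m. 0 \<le> b i j"
      by eventually_elim (auto intro: item.I_nonneg)
    then show "AE r in ?S. AE b in ?P. \<forall>i<k. \<forall>j<m. 0 \<le> snd (r, b) i j" by simp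
  qed
  have pay: "(\<Sum>i<k. vcg_pay m k b i) = (\<Sum>j<m. ?s j b)" "\<forall>j<m. 0 \<le> ?s j b"
    if "\<forall>i<k. \<forall>j<m. 0 \<le> b i j" for b
    using that by (auto intro!: sum_vcg_pay second_value_nonneg k)
  have "(\<integral>\<^sup>+ x. ennreal (\<Sum>i<k. vcg_pay m k (snd x) i) \<partial>(?S \<Otimes>\<^sub>M ?P))
      = (\<integral>\<^sup>+ x. (\<Sum>j<m. ennreal (?s j (snd x))) \<partial>(?S \<Otimes>\<^sub>M ?P))"
  proof (rule nn_integral_cong_AE)
    show "AE x in ?S \<Otimes>\<^sub>M ?P. ennreal (\<Sum>i<k. vcg_pay m k (snd x) i) = (\<Sum>j<m. ennreal (?s j (snd x)))"
      using nonneg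
    proof eventually_elim
      fix x :: "real \<times> profile" assume "\<forall>i<k. \<forall>j<m. 0 \<le> snd x i j"
      note p = pay[OF this]
      show "ennreal (\<Sum>i<k. vcg_pay m k (snd x) i) = (\<Sum>j<m. ennreal (?s j (snd x)))"
        unfolding p(1) using p(2) by (subst sum_ennreal) auto
    qed
  qed
  also have "\<dots> = (\<Sum>j<m. \<integral>\<^sup>+ x. ennreal (?s j (snd x)) \<partial>(?S \<Otimes>\<^sub>M ?P))"
    using measurable_compose[OF measurable_compose[OF measurable_snd sm] measurable_ennreal]
    by (intro nn_integral_sum) auto
  also have "\<dots> = (\<Sum>j<m. second_price (D j) k)"
  proof (intro sum.cong refl)
    fix j assume "j \<in> {..<m}"
    then have j: "j < m" by simp
    have "(\<lambda>x. ennreal (?s j (snd x))) \<in> borel_measurable (?S \<Otimes>\<^sub>M ?P)"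
      using measurable_compose[OF measurable_compose[OF measurable_snd sm[OF j]] measurable_ennreal] .
    from P.nn_integral_fst[OF this]
    have "(\<integral>\<^sup>+ x. ennreal (?s j (snd x)) \<partial>(?S \<Otimes>\<^sub>M ?P)) = (\<integral>\<^sup>+ b. ennreal (?s j b) \<partial>?P)"
      using S.emeasure_space_1 by simp
    also have "\<dots> = (\<integral>\<^sup>+ t. emeasure ?P {b \<in> space ?P. t < ?s j b} * indicator {0..} t \<partial>lborel)"
      using nn_integral_layer_cake[OF P.sigma_finite_measure_axioms sm[OF j], of 0] by simp
    also have "\<dots> = second_price (D j) k"
      unfolding second_price_def
    proof (intro nn_integral_cong)
      fix t :: real
      show "emeasure ?P {b \<in> space ?P. t < ?s j b} * indicator {0..} t
          = ennreal (1 - (1 - tail (D j) t) ^ k - k * tail (D j) t * (1 - tail (D j) t) ^ (k - 1)) * indicator {0..} t"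
      proof (cases "0 \<le> t")
        case True
        show ?thesis
          unfolding less_second_value_iff[OF k True] prob_two_exceed[OF j] ..
      qed simp
    qed
    finally show "(\<integral>\<^sup>+ x. ennreal (?s j (snd x)) \<partial>(?S \<Otimes>\<^sub>M ?P)) = second_price (D j) k" .
  qed
  finally have pos: "(\<integral>\<^sup>+ x. ennreal (\<Sum>i<k. vcg_pay m k (snd x) i) \<partial>(?S \<Otimes>\<^sub>M ?P)) = (\<Sum>j<m. second_price (D j) k)" .
  have "(\<integral>\<^sup>+ x. ennreal (- (\<Sum>i<k. vcg_pay m k (snd x) i)) \<partial>(?S \<Otimes>\<^sub>M ?P)) = (\<integral>\<^sup>+ x. 0 \<partial>(?S \<Otimes>\<^sub>M ?P))"
  proof (rule nn_integral_cong_AE)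
    show "AE x in ?S \<Otimes>\<^sub>M ?P. ennreal (- (\<Sum>i<k. vcg_pay m k (snd x) i)) = 0"
      using nonneg
    proof eventually_elim
      fix x :: "real \<times> profile" assume "\<forall>i<k. \<forall>j<m. 0 \<le> snd x i j"
      note p = pay[OF this]
      have "0 \<le> (\<Sum>j<m. ?s j (snd x))" using p(2) by (intro sum_nonneg) auto
      then show "ennreal (- (\<Sum>i<k. vcg_pay m k (snd x) i)) = 0"
        unfolding p(1) by (intro ennreal_neg) simp
    qed
  qed
  then show ?thesis
    using pos by (simp add: Rev_def VCG_def ext_expectation_def case_prod_beta' zero_ennreal.rep_eq)
qed

end

section \<open>The equal-revenue distribution\<close>

definition er_density :: "real \<Rightarrow> real" where
  "er_density x = (if 1 \<le> x then 1 / x\<^sup>2 else 0)"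

definition equal_revenue :: "real measure" where
  "equal_revenue = density lborel (\<lambda>x. ennreal (er_density x))"

lemma er_density_measurable [measurable]: "er_density \<in> borel_measurable borel"
  unfolding er_density_def[abs_def] by measurable

lemma emeasure_equal_revenue:
  assumes "1 \<le> x"
  shows "emeasure equal_revenue {x..} = ennreal (1 / x)"
proof -
  have "emeasure equal_revenue {x..} = (\<integral>\<^sup>+ y. ennreal (er_density y) * indicator {x..} y \<partial>lborel)"
    unfolding equal_revenue_def by (rule emeasure_density) auto
  also have "\<dots> = (\<integral>\<^sup>+ y. ennreal (1 / y\<^sup>2) * indicator {x..} y \<partial>lborel)"
    using assms by (intro nn_integral_cong) (auto simp: er_density_def split: split_indicator)
  also have "\<dots> = ennreal (0 - (- (1 / x)))"
  proof (rule nn_integral_FTC_atLeast)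
    show "((\<lambda>y. - (1 / y)) has_real_derivative 1 / y\<^sup>2) (at y)" if "x \<le> y" for y
      using that assms by (auto intro!: derivative_eq_intros simp: power2_eq_square)
    have "((\<lambda>y :: real. - inverse y) \<longlongrightarrow> - 0) at_top"
      by (intro tendsto_minus tendsto_inverse_0_at_top filterlim_ident)
    then show "((\<lambda>y :: real. - (1 / y)) \<longlongrightarrow> 0) at_top" by (simp add: inverse_eq_divide)
  qed auto
  finally show ?thesis by simp
qed

lemma emeasure_equal_revenue_below: "emeasure equal_revenue {..<1} = 0"
proof -
  have "emeasure equal_revenue {..<1} = (\<integral>\<^sup>+ y. ennreal (er_density y) * indicator {..<1} y \<partial>lborel)"
    unfolding equal_revenue_def by (rule emeasure_density) auto
  also have "\<dots> = (\<integral>\<^sup>+ y. 0 \<partial>(lborel :: real measure))"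
    by (intro nn_integral_cong) (auto simp: er_density_def split: split_indicator)
  finally show ?thesis by simp
qed

lemma real_distribution_equal_revenue: "real_distribution equal_revenue"
proof -
  have "space equal_revenue = {..<1} \<union> {1..}" by (auto simp: equal_revenue_def)
  moreover have "emeasure equal_revenue ({..<1} \<union> {1..}) = emeasure equal_revenue {..<1} + emeasure equal_revenue {1..}"
    by (subst plus_emeasure) (auto simp: equal_revenue_def)
  ultimately have "emeasure equal_revenue (space equal_revenue) = 1"
    by (simp add: emeasure_equal_revenue emeasure_equal_revenue_below)
  then have "prob_space equal_revenue" by (rule prob_spaceI)
  then show ?thesis
    by (simp add: real_distribution_def real_distribution_axioms_def equal_revenue_def)
qed

interpretation er: real_distribution equal_revenue
  by (rule real_distribution_equal_revenue)

lemma cdf_equal_revenue: "cdf equal_revenue x = (if 1 \<le> x then 1 - 1 / x else 0)"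
proof (cases "1 \<le> x")
  case True
  have "emeasure equal_revenue {x} = 0"
    unfolding equal_revenue_def by (subst emeasure_density) (auto simp: nn_integral_cong_AE[of _ "\<lambda>_. 0"])
  moreover have "emeasure equal_revenue {x..} = emeasure equal_revenue {x} + emeasure equal_revenue {x<..}"
    by (subst plus_emeasure) (auto intro!: arg_cong[where f="emeasure equal_revenue"])
  ultimately have "emeasure equal_revenue {x<..} = ennreal (1 / x)"
    using emeasure_equal_revenue[OF True] by simp
  then have "tail equal_revenue x = 1 / x"
    using True er.tail_nonneg[of x] by (simp add: er.emeasure_tail)
  then show ?thesis using True by (simp add: tail_def)
next
  case False
  have "emeasure equal_revenue {..x} \<le> emeasure equal_revenue {..<1}"
    using False by (intro emeasure_mono) auto
  then show ?thesis
    using False emeasure_equal_revenue_below by (simp add: cdf_def measure_def)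
qed

lemma tail_equal_revenue: "tail equal_revenue x = (if 1 \<le> x then 1 / x else 1)"
  by (simp add: tail_def cdf_equal_revenue)

lemma regular_item_equal_revenue: "regular_item equal_revenue er_density {1..}"
proof (rule regular_item.intro)
  show "real_distribution equal_revenue" by (rule real_distribution_equal_revenue)
  show "has_density_on equal_revenue er_density {1..}"
    by (auto simp: has_density_on_def er_density_def equal_revenue_def is_interval_ci)
  have "virtual_value equal_revenue er_density x = 0" if "1 \<le> x" for x
    using that by (simp add: virtual_value_def cdf_equal_revenue er_density_def power2_eq_square)
  then show "mono_on {1..} (virtual_value equal_revenue er_density)" by (auto intro!: mono_onI)
qed

lemma regular_equal_revenue: "regular_distribution equal_revenue"
  using regular_item_equal_revenue by (auto simp: regular_distribution_def regular_item_def)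

text \<open>Levels up to 1 contribute at most 1, those above at most k - 1. The bound is linear in
  k, although single values have infinite mean.\<close>

lemma second_price_equal_revenue:
  assumes k: "1 \<le> k"
  shows "second_price equal_revenue k \<le> of_nat k"
proof -
  let ?g = "\<lambda>t. 1 - (1 - tail equal_revenue t) ^ k - k * tail equal_revenue t * (1 - tail equal_revenue t) ^ (k - 1)"
  let ?h = "\<lambda>t :: real. 1 - (1 - 1 / t) ^ k - k * (1 / t) * (1 - 1 / t) ^ (k - 1)"
  have [measurable]: "tail equal_revenue \<in> borel_measurable borel" by (rule er.borel_measurable_tail)
  have piece: "(\<integral>\<^sup>+ t. ennreal (?h t) * indicator {1..T} t \<partial>lborel) \<le> ennreal (real k - 1)" if T: "1 \<le> T" for T
  proof -
    have h0: "0 \<le> ?h t" if t: "1 \<le> t" for t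
    proof (cases "2 \<le> k")
      case True
      then show ?thesis using order_trans[OF zero_le_power2 at_least_two_ge[of "1 / t" k]] t by simp
    next
      case False
      then have "k = 1" using k by simp
      then show ?thesis by simp
    qed
    \<comment> \<open>An antiderivative of the integrand with F 1 = 1; by the Bernoulli inequality
      it never exceeds k.\<close>
    define F where "F t = t - t * (1 - 1 / t) ^ k" for t :: real
    have deriv: "(F has_real_derivative ?h t) (at t)" if "1 \<le> t" for t
      unfolding F_def[abs_def] using that
      by (auto intro!: derivative_eq_intros simp: power2_eq_square field_simps)
    have "(\<integral>\<^sup>+ t. ennreal (?h t) * indicator {1..T} t \<partial>lborel) = ennreal (F T - F 1)"
      using T h0 deriv by (intro nn_integral_FTC_Icc) auto
    also have "\<dots> \<le> ennreal (real k - 1)"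
    proof (rule ennreal_leI)
      have "1 + real k * (- (1 / T)) \<le> (1 + - (1 / T)) ^ k"
        using T by (intro Bernoulli_inequality) simp
      then have "T * (1 - real k / T) \<le> T * (1 - 1 / T) ^ k"
        using T by (intro mult_left_mono) auto
      then show "F T - F 1 \<le> real k - 1"
        using T k by (simp add: F_def algebra_simps power_0_left)
    qed
    finally show ?thesis .
  qed
  have "second_price equal_revenue k
      \<le> (\<integral>\<^sup>+ t. indicator {0..1} t + ennreal (?h t) * indicator {1..} t \<partial>lborel)"
    unfolding second_price_def
  proof (intro nn_integral_mono)
    fix t :: real
    show "ennreal (?g t) * indicator {0..} t \<le> indicator {0..1} t + ennreal (?h t) * indicator {1..} t"
      by (cases "1 \<le> t") (auto simp: tail_equal_revenue power_0_left split: split_indicator intro!: ennreal_le_1[THEN iffD2])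
  qed
  also have "\<dots> = (\<integral>\<^sup>+ t. indicator {0..1 :: real} t \<partial>lborel) + (\<integral>\<^sup>+ t. ennreal (?h t) * indicator {1..} t \<partial>lborel)"
    by (intro nn_integral_add) auto
  also have "(\<integral>\<^sup>+ t. ennreal (?h t) * indicator {1..} t \<partial>lborel)
      = (\<integral>\<^sup>+ t. (SUP l. ennreal (?h t) * indicator {1..real (Suc l)} t) \<partial>lborel)"
  proof (intro nn_integral_cong antisym)
    fix t :: real
    obtain l where "t \<le> real l" using real_arch_simple by auto
    then show "ennreal (?h t) * indicator {1..} t \<le> (SUP l. ennreal (?h t) * indicator {1..real (Suc l)} t)"
      by (intro SUP_upper2[of l]) (auto split: split_indicator)
    show "(SUP l. ennreal (?h t) * indicator {1..real (Suc l)} t) \<le> ennreal (?h t) * indicator {1..} t"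
      by (intro SUP_least) (auto split: split_indicator)
  qed
  also have "\<dots> = (SUP l. \<integral>\<^sup>+ t. ennreal (?h t) * indicator {1..real (Suc l)} t \<partial>lborel)"
    by (intro nn_integral_monotone_convergence_SUP) (auto simp: incseq_def le_fun_def split: split_indicator)
  also have "\<dots> \<le> ennreal (real k - 1)"
    by (intro SUP_least piece) simp
  also have "(\<integral>\<^sup>+ t. indicator {0..1 :: real} t \<partial>lborel) + ennreal (real k - 1) = of_nat k"
    using k by (simp add: ennreal_of_nat_eq_real_of_nat flip: ennreal_1 ennreal_plus)
  finally show ?thesis by (simp add: add_left_mono)
qed

text \<open>For y = x / l in [0, 1], exp (- y) \<le> 1 / (1 + y) \<le> 1 - y / 2. Hence on {1..l}
  the integrand loses at least 1 / (2 l x) against the density, in total ln l / (2 l). The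
  exponential form of the result is convenient for multiplying m independent factors.\<close>

lemma nn_integral_exp_equal_revenue:
  fixes l :: real
  assumes l: "1 \<le> l"
  shows "(\<integral>\<^sup>+ x. ennreal (exp (- x / l)) \<partial>equal_revenue) \<le> ennreal (exp (- ln l / (2 * l)))"
proof -
  have "(\<integral>\<^sup>+ x. ennreal (exp (- x / l)) \<partial>equal_revenue) + ennreal (ln l / (2 * l)) \<le> 1"
  proof -
    have "(\<integral>\<^sup>+ x. ennreal (1 / (2 * l * x)) * indicator {1..l} x \<partial>lborel) = ennreal (ln l / (2 * l) - ln 1 / (2 * l))"
      using l by (intro nn_integral_FTC_Icc) (auto intro!: derivative_eq_intros simp: field_simps)
    then have "(\<integral>\<^sup>+ x. ennreal (exp (- x / l)) \<partial>equal_revenue) + ennreal (ln l / (2 * l))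
        = (\<integral>\<^sup>+ x. ennreal (er_density x) * ennreal (exp (- x / l)) + ennreal (1 / (2 * l * x)) * indicator {1..l} x \<partial>lborel)"
      unfolding equal_revenue_def by (simp add: nn_integral_density nn_integral_add)
    also have "\<dots> \<le> (\<integral>\<^sup>+ x. ennreal (er_density x) \<partial>lborel)"
    proof (intro nn_integral_mono)
      fix x :: real
      have e: "exp (- x / l) \<le> 1" if "1 \<le> x" using that l by simp
      have "er_density x * exp (- x / l) + 1 / (2 * l * x) \<le> er_density x" if x: "1 \<le> x" "x \<le> l"
      proof -
        define y where "y = x / l"
        have y: "0 \<le> y" "y \<le> 1" using x l by (auto simp: y_def)
        have "exp (- x / l) = 1 / exp y" by (simp add: y_def exp_minus inverse_eq_divide)
        also have "\<dots> \<le> 1 / (1 + y)" using y exp_ge_add_one_self[of y] by (intro divide_left_mono) auto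
        also have "\<dots> \<le> 1 - y / 2"
        proof -
          have "y * y \<le> y * 1" using y by (intro mult_left_mono)
          then have "1 \<le> (1 - y / 2) * (1 + y)" by (simp add: algebra_simps)
          then show ?thesis using y by (simp add: divide_le_eq)
        qed
        finally have "1 / x\<^sup>2 * exp (- x / l) \<le> 1 / x\<^sup>2 * (1 - y / 2)" by (intro mult_left_mono) auto
        also have "\<dots> = 1 / x\<^sup>2 - 1 / (2 * l * x)" using x l by (simp add: y_def field_simps power2_eq_square)
        finally show ?thesis using x by (simp add: er_density_def)
      qed
      then have 1: "ennreal (er_density x * exp (- x / l) + 1 / (2 * l * x)) \<le> ennreal (er_density x)"
        if "1 \<le> x" "x \<le> l" using that by (intro ennreal_leI)
      have 2: "ennreal (er_density x) * ennreal (exp (- x / l)) \<le> ennreal (er_density x)"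
        using e mult_left_mono[of "ennreal (exp (- x / l))" 1 "ennreal (er_density x)"]
        by (cases "1 \<le> x") (auto simp: er_density_def)
      show "ennreal (er_density x) * ennreal (exp (- x / l)) + ennreal (1 / (2 * l * x)) * indicator {1..l} x
          \<le> ennreal (er_density x)"
      proof (cases "x \<in> {1..l}")
        case True
        then have "ennreal (er_density x) * ennreal (exp (- x / l)) + ennreal (1 / (2 * l * x))
            = ennreal (er_density x * exp (- x / l) + 1 / (2 * l * x))"
          using l ennreal_plus[of "er_density x * exp (- x / l)" "1 / (2 * l * x)"]
            ennreal_mult[of "er_density x" "exp (- x / l)"]
          by (simp add: er_density_def)
        then show ?thesis using 1 True by simp
      qed (use 2 in simp)
    qed
    also have "\<dots> = 1"
    proof -
      have "(\<integral>\<^sup>+ x. ennreal (er_density x) \<partial>lborel) = emeasure equal_revenue (space equal_revenue)"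
        unfolding equal_revenue_def by (subst emeasure_density) auto
      then show ?thesis using er.emeasure_space_1 by simp
    qed
    finally show ?thesis .
  qed
  then have "(\<integral>\<^sup>+ x. ennreal (exp (- x / l)) \<partial>equal_revenue) \<le> 1 - ennreal (ln l / (2 * l))"
    by (metis ennreal_add_diff_cancel_right ennreal_minus_mono ennreal_neq_top infinity_ennreal_def order_refl)
  also have "\<dots> = ennreal (1 - ln l / (2 * l))"
    using l by (simp flip: ennreal_1 ennreal_minus)
  also have "\<dots> \<le> ennreal (exp (- ln l / (2 * l)))"
    using exp_ge_add_one_self[of "- ln l / (2 * l)"] by (intro ennreal_leI) simp
  finally show ?thesis .
qed

text \<open>The exponential Markov inequality with parameter 1 / m. The Laplace transform of the sum
  is at most exp (- ln m / 2), the price costs the factor exp (ln m / 4), and their product exp (-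
  ln m / 4) is at most 1 / 2 once ln m \<ge> 4.\<close>

lemma prob_bundle:
  assumes m: "4 \<le> ln (real m)"
  shows "1 / 2 \<le> measure (valuation_dist m (\<lambda>_. equal_revenue))
    {w \<in> space (valuation_dist m (\<lambda>_. equal_revenue)). real m * ln (real m) / 4 \<le> value_of w {..<m}}"
proof -
  interpret regular_items m "\<lambda>_. equal_revenue" "\<lambda>_. er_density" "\<lambda>_. {1..}"
    by (rule regular_items.intro) (rule regular_item_equal_revenue)
  let ?p = "real m * ln (real m) / 4"
  have m0: "0 < m" using m by (cases "m = 0") auto
  have m1: "1 \<le> real m" using m0 by simp
  have [measurable]: "(\<lambda>w. value_of w {..<m}) \<in> borel_measurable V"
    unfolding value_of_def by measurable
  define B where "B = {w \<in> space V. value_of w {..<m} < ?p}"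
  have B: "B \<in> sets V" unfolding B_def by measurable
  have "emeasure V B = (\<integral>\<^sup>+ w. indicator B w \<partial>V)" using B by simp
  also have "\<dots> \<le> (\<integral>\<^sup>+ w. ennreal (exp (ln (real m) / 4)) * (\<Prod>j<m. ennreal (exp (- w j / real m))) \<partial>V)"
  proof (intro nn_integral_mono)
    fix w
    have "(\<Prod>j<m. ennreal (exp (- w j / real m))) = ennreal (exp (- value_of w {..<m} / real m))"
      by (simp add: prod_ennreal value_of_def exp_sum[symmetric] sum_divide_distrib[symmetric] sum_negf)
    then have e: "ennreal (exp (ln (real m) / 4)) * (\<Prod>j<m. ennreal (exp (- w j / real m)))
        = ennreal (exp (ln (real m) / 4 - value_of w {..<m} / real m))"
      by (simp add: ennreal_mult'[symmetric] exp_add[symmetric])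
    have "1 \<le> exp (ln (real m) / 4 - value_of w {..<m} / real m)" if "w \<in> B"
    proof -
      have "value_of w {..<m} / real m \<le> ?p / real m" using that m0 by (intro divide_right_mono) (auto simp: B_def)
      then show ?thesis using m0 by simp
    qed
    then show "indicator B w \<le> ennreal (exp (ln (real m) / 4)) * (\<Prod>j<m. ennreal (exp (- w j / real m)))"
      unfolding e by (auto split: split_indicator)
  qed
  also have "\<dots> = ennreal (exp (ln (real m) / 4)) * (\<integral>\<^sup>+ w. (\<Prod>j<m. ennreal (exp (- w j / real m))) \<partial>V)"
    by (intro nn_integral_cmult borel_measurable_prod_ennreal) measurable
  also have "(\<integral>\<^sup>+ w. (\<Prod>j<m. ennreal (exp (- w j / real m))) \<partial>V)
      = (\<Prod>j<m. \<integral>\<^sup>+ x. ennreal (exp (- x / real m)) \<partial>equal_revenue)"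
    unfolding valuation_dist_def by (rule items.product_nn_integral_prod) auto
  also have "\<dots> \<le> ennreal (exp (- ln (real m) / (2 * real m))) ^ m"
    using nn_integral_exp_equal_revenue[OF m1] by (simp add: power_mono)
  also have "\<dots> = ennreal (exp (- ln (real m) / 2))"
    using m0 by (simp add: ennreal_power flip: exp_of_nat_mult)
  finally have "emeasure V B \<le> ennreal (exp (ln (real m) / 4)) * ennreal (exp (- ln (real m) / 2))"
    by (simp add: mult_left_mono)
  also have "\<dots> = ennreal (exp (- (ln (real m) / 4)))"
    by (simp add: ennreal_mult'[symmetric] exp_add[symmetric])
  also have "\<dots> \<le> ennreal (1 / 2)"
  proof (rule ennreal_leI)
    have "2 \<le> exp (ln (real m) / 4)" using exp_ge_add_one_self[of "ln (real m) / 4"] m by linarith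
    then show "exp (- (ln (real m) / 4)) \<le> 1 / 2" by (simp add: exp_minus inverse_eq_divide divide_le_eq)
  qed
  finally have "ennreal (val.prob B) \<le> ennreal (1 / 2)" by (simp only: val.emeasure_eq_measure)
  then have "val.prob B \<le> 1 / 2" by (subst (asm) ennreal_le_iff) auto
  moreover have "{w \<in> space V. ?p \<le> value_of w {..<m}} = space V - B" by (auto simp: B_def)
  ultimately show ?thesis using val.prob_compl[OF B] by simp
qed

text \<open>A take-it-or-leave-it offer of the grand bundle to bidder 0 alone. Ignoring the others
  is affordable because n is a constant in the lower bound.\<close>

definition bundle_sale :: "nat \<Rightarrow> nat \<Rightarrow> real \<Rightarrow> mechanism" where
  "bundle_sale m n p = \<lparr> seed = return borel 0,
     alloc = (\<lambda>_ b. \<lambda>i\<in>{..<n}. if i = 0 \<and> p \<le> value_of (b 0) {..<m} then {..<m} else {}),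
     pay = (\<lambda>_ b i. if i = 0 \<and> p \<le> value_of (b 0) {..<m} then p else 0) \<rparr>"

section \<open>Posting a price for the grand bundle\<close>

context regular_items
begin

lemma bundle_sale_utility:
  assumes i: "i < n"
  shows "expected_utility m D n (bundle_sale m n p) i v w
    = (if i = 0 \<and> p \<le> value_of w {..<m} then value_of v {..<m} - p else 0)"
proof -
  let ?Q = "seed (bundle_sale m n p) \<Otimes>\<^sub>M profile_dist m D ({..<n} - {i})"
  interpret S: prob_space "seed (bundle_sale m n p)" by (simp add: bundle_sale_def prob_space_return)
  interpret P': prob_space "profile_dist m D ({..<n} - {i})" by (rule prob_space_profile_dist)
  interpret Q: pair_prob_space "seed (bundle_sale m n p)" "profile_dist m D ({..<n} - {i})" ..
  have "(\<lambda>(r, b). value_of v (alloc (bundle_sale m n p) r (b(i := w)) i) - pay (bundle_sale m n p) r (b(i := w)) i)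
      = (\<lambda>_. if i = 0 \<and> p \<le> value_of w {..<m} then value_of v {..<m} - p else 0)"
    using i by (auto simp: fun_eq_iff bundle_sale_def value_of_def)
  then show ?thesis unfolding expected_utility_def by (simp add: Q.prob_space)
qed

lemma value_of_measurable: "(\<lambda>w. value_of w {..<m}) \<in> borel_measurable V"
  unfolding value_of_def by (intro borel_measurable_sum component_measurable[of "\<lambda>w. w"]) auto

lemma is_mechanism_bundle_sale:
  assumes n: "1 \<le> n" and p: "0 \<le> p"
  shows "is_mechanism m D n (bundle_sale m n p)"
proof -
  let ?S = "return borel (0 :: real)" and ?P = "profile_dist m D {..<n}"
  interpret S: prob_space ?S by (simp add: prob_space_return)
  have "(\<lambda>b. b 0) \<in> measurable ?P V"
    unfolding profile_dist_def using n by (intro measurable_component_singleton) simp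
  from measurable_compose[OF measurable_compose[OF measurable_snd this] value_of_measurable]
  have val: "(\<lambda>x. value_of (snd x 0) {..<m}) \<in> borel_measurable (?S \<Otimes>\<^sub>M ?P)" .
  then have win: "{x \<in> space (?S \<Otimes>\<^sub>M ?P). p \<le> value_of (snd x 0) {..<m}} \<in> sets (?S \<Otimes>\<^sub>M ?P)"
    by (intro borel_measurable_le) auto
  have int: "integrable (?S \<Otimes>\<^sub>M profile_dist m D ({..<n} - {i}))
      (\<lambda>(r, b). pay (bundle_sale m n p) r (b(i := w)) i)" if "i < n" for i w
  proof -
    interpret P': prob_space "profile_dist m D ({..<n} - {i})" by (rule prob_space_profile_dist)
    interpret Q: pair_prob_space ?S "profile_dist m D ({..<n} - {i})" ..
    have "(\<lambda>(r, b). pay (bundle_sale m n p) r (b(i := w)) i)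
        = (\<lambda>_. if i = 0 \<and> p \<le> value_of w {..<m} then p else 0)"
      by (auto simp: fun_eq_iff bundle_sale_def)
    then show ?thesis by simp
  qed
  show ?thesis
    unfolding is_mechanism_def
  proof (intro conjI allI impI ballI)
    show "real_distribution (seed (bundle_sale m n p))"
      using S.prob_space_axioms by (simp add: bundle_sale_def real_distribution_def real_distribution_axioms_def)
    show "alloc (bundle_sale m n p) r b \<in> allocations m {..<n}" for r b
      by (auto simp: bundle_sale_def allocations_def disjoint_family_on_def)
    show "{(r, b) \<in> space (seed (bundle_sale m n p) \<Otimes>\<^sub>M ?P). j \<in> alloc (bundle_sale m n p) r b i}
        \<in> sets (seed (bundle_sale m n p) \<Otimes>\<^sub>M ?P)" if "i < n" "j < m" for i j
    proof -
      have "{(r, b) \<in> space (seed (bundle_sale m n p) \<Otimes>\<^sub>M ?P). j \<in> alloc (bundle_sale m n p) r b i}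
          = (if i = 0 then {x \<in> space (?S \<Otimes>\<^sub>M ?P). p \<le> value_of (snd x 0) {..<m}} else {})"
        using that by (auto simp: bundle_sale_def)
      then show ?thesis using win by (simp add: bundle_sale_def)
    qed
    show "(\<lambda>(r, b). pay (bundle_sale m n p) r b i) \<in> borel_measurable (seed (bundle_sale m n p) \<Otimes>\<^sub>M ?P)" for i
    proof -
      have "(\<lambda>x. if p \<le> value_of (snd x 0) {..<m} then p else 0) \<in> borel_measurable (?S \<Otimes>\<^sub>M ?P)"
        using win by (intro measurable_If) auto
      then show ?thesis by (cases "i = 0") (auto simp: bundle_sale_def case_prod_beta')
    qed
    show "integrable (seed (bundle_sale m n p) \<Otimes>\<^sub>M profile_dist m D ({..<n} - {i}))
        (\<lambda>(r, b). pay (bundle_sale m n p) r (b(i := w)) i)" if "i < n" for i w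
      using int[OF that] by (simp add: bundle_sale_def)
    have "(\<integral>\<^sup>+ (r, b). ennreal (- pay (bundle_sale m n p) r b i) \<partial>(seed (bundle_sale m n p) \<Otimes>\<^sub>M ?P))
        = (\<integral>\<^sup>+ x. 0 \<partial>(seed (bundle_sale m n p) \<Otimes>\<^sub>M ?P))" for i
      using p by (intro nn_integral_cong) (auto simp: bundle_sale_def ennreal_neg)
    then show "(\<integral>\<^sup>+ (r, b). ennreal (- pay (bundle_sale m n p) r b i) \<partial>(seed (bundle_sale m n p) \<Otimes>\<^sub>M ?P)) < \<infinity>" for i
      by simp
  qed
qed

lemma Rev_bundle_sale:
  assumes n: "1 \<le> n" and p: "0 \<le> p"
  shows "Rev m D n (bundle_sale m n p) = ereal (p * val.prob {w \<in> space V. p \<le> value_of w {..<m}})"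
proof -
  let ?S = "return borel (0 :: real)" and ?P = "profile_dist m D {..<n}"
  interpret S: prob_space ?S by (simp add: prob_space_return)
  interpret P: prob_space ?P by (rule prob_space_profile_dist)
  define g where "g w = ennreal (if p \<le> value_of w {..<m} then p else 0)" for w :: valuation
  have A: "{w \<in> space V. p \<le> value_of w {..<m}} \<in> sets V"
    using value_of_measurable by (intro borel_measurable_le) auto
  have g: "g \<in> borel_measurable V"
    unfolding g_def[abs_def] using A by (intro measurable_compose[OF measurable_If measurable_ennreal]) auto
  have ins: "insert 0 ({..<n} - {0}) = {..<n}" using n by auto
  interpret P': prob_space "profile_dist m D ({..<n} - {0})" by (rule prob_space_profile_dist)
  have comp: "(\<lambda>b. b 0) \<in> measurable ?P V"
    unfolding profile_dist_def using n by (intro measurable_component_singleton) simp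
  have sum: "(\<Sum>i<n. pay (bundle_sale m n p) r b i) = (if p \<le> value_of (b 0) {..<m} then p else 0)" for r b
  proof -
    have "(\<Sum>i<n. pay (bundle_sale m n p) r b i)
        = (\<Sum>i<n. if i = 0 then (if p \<le> value_of (b 0) {..<m} then p else 0) else 0)"
      by (intro sum.cong) (auto simp: bundle_sale_def)
    then show ?thesis using n by simp
  qed
  have "(\<integral>\<^sup>+ x. g (snd x 0) \<partial>(?S \<Otimes>\<^sub>M ?P)) = (\<integral>\<^sup>+ b. g (b 0) \<partial>?P)"
    using P.nn_integral_fst[OF measurable_compose[OF measurable_compose[OF measurable_snd comp] g], of ?S] S.emeasure_space_1
    by simp
  also have "\<dots> = (\<integral>\<^sup>+ w. g w \<partial>V)"
    using bidders.product_nn_integral_insert_rev[of "{..<n} - {0}" 0 "\<lambda>b. g (b 0)"] measurable_compose[OF comp g]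
      P'.emeasure_space_1
    unfolding ins profile_dist_def by simp
  also have "\<dots> = (\<integral>\<^sup>+ w. ennreal p * indicator {w \<in> space V. p \<le> value_of w {..<m}} w \<partial>V)"
    by (intro nn_integral_cong) (auto simp: g_def split: split_indicator)
  also have "\<dots> = ennreal (p * val.prob {w \<in> space V. p \<le> value_of w {..<m}})"
    using A p by (simp add: nn_integral_cmult val.emeasure_eq_measure ennreal_mult')
  finally have pos: "(\<integral>\<^sup>+ x. g (snd x 0) \<partial>(?S \<Otimes>\<^sub>M ?P)) = \<dots>" .
  have neg: "ennreal (- (if c then p else 0)) = 0" for c using p by (simp add: ennreal_neg)
  show ?thesis
    using pos p unfolding Rev_def ext_expectation_def sum
    by (simp add: bundle_sale_def case_prod_beta' neg g_def[symmetric] zero_ennreal.rep_eq)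
qed

lemma OPT_ge_bundle:
  assumes n: "1 \<le> n" and p: "0 \<le> p"
  shows "ereal (p * val.prob {w \<in> space V. p \<le> value_of w {..<m}}) \<le> OPT m D n"
proof -
  have "BIC m D n (bundle_sale m n p)" "BIR m D n (bundle_sale m n p)"
    by (auto simp: BIC_def BIR_def bundle_sale_utility)
  then have "Rev m D n (bundle_sale m n p) \<le> OPT m D n"
    unfolding OPT_def using is_mechanism_bundle_sale[OF n p] by (intro SUP_upper) auto
  then show ?thesis by (simp add: Rev_bundle_sale[OF n p])
qed

lemma OPT_le_VCG:
  assumes "1 \<le> n" "1 \<le> m"
  shows "OPT m D n \<le> Rev m D (2 * n + 2 * m - 2) (VCG m (2 * n + 2 * m - 2))"
  unfolding OPT_def
proof (rule SUP_least)
  fix M assume "M \<in> {M. is_mechanism m D n M \<and> BIC m D n M \<and> BIR m D n M}"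
  then interpret auction m D f I n M by unfold_locales auto
  have "1 \<le> 2 * n + 2 * m - 2" using assms by simp
  then show "Rev m D n M \<le> Rev m D (2 * n + 2 * m - 2) (VCG m (2 * n + 2 * m - 2))"
    using Rev_le_second_price[OF assms(1)] Rev_VCG by simp
qed

end

section \<open>Competition complexity\<close>

lemma OPT_Rev_cong:
  assumes "\<And>j. j < m \<Longrightarrow> D j = D' j"
  shows "OPT m D n = OPT m D' n" and "Rev m D k M = Rev m D' k M"
proof -
  have V: "valuation_dist m D = valuation_dist m D'"
    unfolding valuation_dist_def using assms by (intro PiM_cong) auto
  have P: "profile_dist m D = profile_dist m D'"
    by (simp add: fun_eq_iff profile_dist_def V)
  have T: "types m D = types m D'"
    unfolding types_def using assms by (intro PiE_cong) auto
  show "Rev m D k M = Rev m D' k M" by (simp add: Rev_def P)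
  show "OPT m D n = OPT m D' n"
    by (simp add: OPT_def is_mechanism_def BIC_def BIR_def Rev_def expected_utility_def P T)
qed

lemma competition_complexity_upper:
  assumes nm: "1 \<le> n" "1 \<le> m"
  shows "competition_complexity n m \<le> enat (n + 2 * m - 2)"
  unfolding competition_complexity_def
proof (intro Inf_lower CollectI exI conjI allI impI refl)
  fix D assume reg: "\<forall>j<m. regular_distribution (D j)"
  \<comment> \<open>The locale asks for a regular item at every index, so indices from m on are
    filled with D 0, which is regular as m \<ge> 1. Neither \<open>OPT\<close> nor
    \<open>Rev\<close> sees them.\<close>
  define D' where "D' j = (if j < m then D j else D 0)" for j
  have "\<forall>j. \<exists>f I. regular_item (D' j) f I"
    using reg nm by (auto simp: D'_def regular_distribution_def regular_item_def)
  then obtain f I where "\<And>j. regular_item (D' j) (f j) (I j)" by metis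
  then interpret regular_items m D' f I by (rule regular_items.intro)
  have "n + (n + 2 * m - 2) = 2 * n + 2 * m - 2" using nm by simp
  then show "OPT m D n \<le> Rev m D (n + (n + 2 * m - 2)) (VCG m (n + (n + 2 * m - 2)))"
    using OPT_le_VCG[OF nm] OPT_Rev_cong[of m D D'] by (simp add: D'_def)
qed simp

text \<open>Selling the bundle earns at least half of its price m ln m / 4, whereas VCG with n + c
  bidders earns at most n + c on each of the m items.\<close>

lemma competition_bound:
  assumes n: "1 \<le> n" and m: "4 \<le> ln (real m)"
    and le: "OPT m (\<lambda>_. equal_revenue) n \<le> Rev m (\<lambda>_. equal_revenue) (n + c) (VCG m (n + c))"
  shows "ln (real m) / 8 \<le> real n + real c"
proof -
  interpret regular_items m "\<lambda>_. equal_revenue" "\<lambda>_. er_density" "\<lambda>_. {1..}"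
    by (rule regular_items.intro) (rule regular_item_equal_revenue)
  let ?p = "real m * ln (real m) / 4"
  have m0: "0 < real m" using m by (cases "m = 0") auto
  have "ereal (?p * (1 / 2)) \<le> ereal (?p * val.prob {w \<in> space V. ?p \<le> value_of w {..<m}})"
    using prob_bundle[OF m] m m0 by (simp only: ereal_less_eq) (intro mult_left_mono, auto)
  also have "\<dots> \<le> OPT m (\<lambda>_. equal_revenue) n" using m m0 by (intro OPT_ge_bundle n) auto
  also have "\<dots> \<le> enn2ereal (\<Sum>j<m. second_price equal_revenue (n + c))"
    using le n by (simp add: Rev_VCG)
  also have "\<dots> \<le> enn2ereal (\<Sum>j<m. of_nat (n + c))"
    unfolding less_eq_ennreal.rep_eq[symmetric] using n by (intro sum_mono second_price_equal_revenue) auto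
  also have "(\<Sum>j<m. of_nat (n + c) :: ennreal) = ennreal (real m * (real n + real c))"
    by (simp add: ennreal_of_nat_eq_real_of_nat flip: ennreal_mult' ennreal_plus)
  also have "enn2ereal \<dots> = ereal (real m * (real n + real c))" by simp
  finally have "real m * (ln (real m) / 8) \<le> real m * (real n + real c)" by simp
  then show ?thesis using m0 by simp
qed

text \<open>From ln m / 8 \<le> n + c, half of the left side is spent on n, which requires ln m
  \<ge> 16 n, and the other half bounds c.\<close>

lemma competition_complexity_lower:
  assumes n: "1 \<le> n" and m: "16 * real n \<le> ln (real m)"
  shows "ereal (1 / 16 * ln (real m)) \<le> ereal_of_enat (competition_complexity n m)"
proof -
  define X where "X = {enat c | c. \<forall>D. (\<forall>j<m. regular_distribution (D j)) \<longrightarrow>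
                        OPT m D n \<le> Rev m D (n + c) (VCG m (n + c))}"
  have CX: "competition_complexity n m = Inf X" by (simp add: competition_complexity_def X_def)
  show ?thesis
  proof (cases "X = {}")
    case True
    then show ?thesis unfolding CX by (simp add: Inf_enat_def)
  next
    case False
    then obtain x where "x \<in> X" by auto
    then have "(LEAST x. x \<in> X) \<in> X" by (rule LeastI)
    then have "Inf X \<in> X" using False by (simp add: Inf_enat_def)
    then obtain c where c: "Inf X = enat c"
      "OPT m (\<lambda>_. equal_revenue) n \<le> Rev m (\<lambda>_. equal_revenue) (n + c) (VCG m (n + c))"
      using regular_equal_revenue by (auto simp: X_def)
    have "4 \<le> ln (real m)" using n m by linarith
    from competition_bound[OF n this c(2)] have "1 / 16 * ln (real m) \<le> real c" using m by linarith
    then show ?thesis unfolding CX c(1) by simp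
  qed
qed

theorem theorem4p1:
  shows "(\<forall>n m :: nat. n \<ge> 1 \<longrightarrow> m \<ge> 1 \<longrightarrow>
            competition_complexity n m \<le> enat (n + 2 * m - 2)) \<and>
         (\<forall>n :: nat. n \<ge> 1 \<longrightarrow>
            (\<exists>\<kappa>::real. \<exists>m0::nat. \<kappa> > 0 \<and>
               (\<forall>m\<ge>m0. ereal (\<kappa> * ln (real m)) \<le> ereal_of_enat (competition_complexity n m))))"
proof (intro conjI allI impI)
  fix n m :: nat assume "1 \<le> n" "1 \<le> m"
  then show "competition_complexity n m \<le> enat (n + 2 * m - 2)" by (rule competition_complexity_upper)
next
  fix n :: nat assume n: "1 \<le> n"
  obtain m0 :: nat where m0: "exp (16 * real n) \<le> real m0" using real_arch_simple by blast
  have "16 * real n \<le> ln (real m)" if "m0 \<le> m" for m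
  proof -
    have "exp (16 * real n) \<le> real m" using m0 that by (simp add: order_trans)
    then show ?thesis using ln_ge_iff[of "real m" "16 * real n"] less_le_trans[OF exp_gt_zero] by blast
  qed
  then have "\<forall>m\<ge>m0. ereal (1 / 16 * ln (real m)) \<le> ereal_of_enat (competition_complexity n m)"
    using competition_complexity_lower[OF n] by blast
  then show "\<exists>\<kappa>::real. \<exists>m0::nat. \<kappa> > 0 \<and>
      (\<forall>m\<ge>m0. ereal (\<kappa> * ln (real m)) \<le> ereal_of_enat (competition_complexity n m))"
    by (intro exI[of _ "1 / 16"] exI[of _ m0]) simp
qed

end
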